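(* The space of bounded linear operators on $GM$ (with the operator norm) contains a subspace isometric to $\ell_\infty$, the Banach space of all bounded sequences of scalars; thus the set of operators on $GM$ is non-separable. Moreover, if $X$ is either the space $S$ or the space $GM$, then $\ell_\infty$ embeds in the space of bounded linear operators from $X$ to $GM$.
   Context: All Banach spaces are over $\mathbb{R}$. Notation. $c_{00}$ is the space of finitely supported real sequences, $(e_i)$ its unit vector basis, $(e_i^* )$ the coordinate functionals; $\mathrm{supp}(x)=\{i: x_i\neq 0\}$. Finitely supported functionals $z^*$ are identified with elements of $c_{00}$, with $z^*(x)=\sum_i z^*_i x_i$. For $E\subseteq\mathbb{N}$ and $x=\sum x_ie_i$, $E(x)=Ex=\sum_{i\in E}x_ie_i$ (and likewise for functionals). $E<F$ means $\max E<\min F$ ($\max\emptyset=0$, $\min\emptyset=\infty$; chains $E_1<\dots<E_n$ are understood pairwise), and $x<y$ means $\mathrm{supp}(x)<\mathrm{supp}(y)$. $f(x)=\log_2(x+1)$. Definition of $S$. $S$ is the completion of $(c_{00},\|\cdot\|_S)$, where $\|\cdot\|_S$ is the unique norm on $c_{00}$ satisfying $$\|x\|_S=\max\Big\{\|x\|_{\ell_\infty},\ \sup_{2\le n\in\mathbb{N},\ E_1<\cdots<E_n}\frac1{f(n)}\sum_{j=1}^n\|E_jx\|_S\Big\},$$ the $E_j$ being finite subsets of $\mathbb{N}$. Definition of $GM$. Fix an infinite set $J=\{j_1<j_2<\dots\}\subset\mathbb{N}$ such that $4n^2\le\log\log\log m$ whenever $n<m$ are in $J$, and $f(\min J)\ge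 256$. Put $L=\{j_2,j_4,j_6,\dots\}$. Let $\mathbf{Q}$ be the set of finitely supported scalar sequences with rational coordinates of absolute value at most one. Fix an injective function $\sigma$ from the collection of all finite sequences of elements of $\mathbf{Q}$ to $L$ such that $\frac1{20}f(\sigma(z_1,\dots,z_i)^{1/40})\ge \#\,\mathrm{supp}(\sum_{j=1}^i z_j)$ for every such sequence. Define sets of functionals recursively: $GM_0^*=\{\lambda e_n^*: n\in\mathbb{N}, |\lambda|\le 1\}$; and $GM_{k+1}^*$ is the set of all functionals $Ez^*$ where $E\subseteq\mathbb{N}$ is an interval and $z^*$ has one of the following forms: (1) $z^*=\sum_{i=1}^{\ell}\alpha_i z_i^*$ with $\sum_{i=1}^\ell|\alpha_i|\le1$ and $z_i^*\in GM_k^*$ for $i=1,\dots,\ell$; (2) $z^*=\frac1{f(\ell)}\sum_{i=1}^\ell z_i^*$ with $z_i^*\in GM_k^*$ for $i=1,\dots,\ell$ and $z_1^*<\dots<z_\ell^*$; (3) $z^*=\frac1{\sqrt{f(\ell)}}\sum_{i=1}^\ell z_i^*$ and $z_i^*=\frac1{f(m_i)}\sum_{j=1}^{m_i}z_{i,j}^*$, where $z_{i,j}^*\in GM_k^*$ for $1\le i\le\ell$, $1\le j\le m_i$, $z_{1,1}^*<\dots<z_{1,m_1}^*<z_{2,1}^*<\dots<z_{\ell,m_\ell}^*$, $m_1=j_{2\ell}$, each $z_i^*$ has rational coordinates, and $m_{i+1}=\sigma(z_1^*,\dots,z_i^* )$ for $i=1,\dots,\ell-1$. Then $\|x\|_{GM}=\sup\{z^*(x):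 z^*\in\bigcup_{k\ge0}GM_k^*\}$ for $x\in c_{00}$, and $GM$ is the completion of $(c_{00},\|\cdot\|_{GM})$. *)

theory Defs
  imports "HOL-Analysis.Analysis" "HOL-Analysis.Finite_Function_Topology"
begin

section \<open>Finitely supported sequences\<close>

text \<open>
  \<^typ>\<open>nat \<Rightarrow>\<^sub>0 real\<close> is \<open>c\<^sub>0\<^sub>0\<close>, with \<^const>\<open>Poly_Mapping.keys\<close> as support and
  \<^term>\<open>Poly_Mapping.single n 1\<close> as \<open>e\<^sub>n\<close>; the definitions below use only its vector space structure, not the norm
  of the type class instance. Coordinates are indexed from 0 instead of 1, a relabelling that
  respects the order of the coordinates.
\<close>

type_synonym c00 = "nat \<Rightarrow>\<^sub>0 real"

lift_definition proj :: "nat set \<Rightarrow> c00 \<Rightarrow> c00" is "\<lambda>E x i. if i \<in> E then x i else 0"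
  by (rule rev_finite_subset) auto

definition pairing :: "c00 \<Rightarrow> c00 \<Rightarrow> real" where
  "pairing z x = (\<Sum>i\<in>Poly_Mapping.keys x. Poly_Mapping.lookup z i * Poly_Mapping.lookup x i)"

definition sup_norm :: "c00 \<Rightarrow> real" where
  "sup_norm x = (SUP i. \<bar>Poly_Mapping.lookup x i\<bar>)"

text \<open>For \<open>max \<emptyset> = 0\<close> and \<open>min \<emptyset> = \<infinity>\<close> (and indices starting at 1) this is \<open>max E < min F\<close>.\<close>

definition set_less :: "nat set \<Rightarrow> nat set \<Rightarrow> bool" where
  "set_less E F \<longleftrightarrow> (\<forall>i\<in>E. \<forall>j\<in>F. i < j)"

definition supp_less :: "c00 \<Rightarrow> c00 \<Rightarrow> bool" where
  "supp_less x y \<longleftrightarrow> set_less (Poly_Mapping.keys x) (Poly_Mapping.keys y)"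

definition nat_interval :: "nat set \<Rightarrow> bool" where
  "nat_interval E \<longleftrightarrow> (\<forall>a\<in>E. \<forall>b\<in>E. \<forall>c. a \<le> c \<and> c \<le> b \<longrightarrow> c \<in> E)"

definition logf :: "real \<Rightarrow> real" where
  "logf x = log 2 (x + 1)"

definition norm_on_c00 :: "(c00 \<Rightarrow> real) \<Rightarrow> bool" where
  "norm_on_c00 N \<longleftrightarrow>
     (\<forall>x. N x \<ge> 0) \<and> (\<forall>x. N x = 0 \<longleftrightarrow> x = 0) \<and>
     (\<forall>a x. N (a *\<^sub>R x) = \<bar>a\<bar> * N x) \<and> (\<forall>x y. N (x + y) \<le> N x + N y)"

section \<open>The norm of \<open>S\<close>\<close>

definition S_averages :: "(c00 \<Rightarrow> real) \<Rightarrow> c00 \<Rightarrow> real set" where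
  "S_averages N x =
     {(\<Sum>j=1..n. N (proj (E j) x)) / logf (real n) | n E.
        2 \<le> n \<and> (\<forall>j\<in>{1..n}. finite (E j)) \<and>
        (\<forall>i\<in>{1..n}. \<forall>j\<in>{1..n}. i < j \<longrightarrow> set_less (E i) (E j))}"

text \<open>
  The supremum is over a nonempty set, which is bounded above for every norm \<open>N\<close>: at most
  \<^term>\<open>card (Poly_Mapping.keys x)\<close> summands are nonzero, and the vectors
  \<^term>\<open>proj E x\<close> form a finite set.
\<close>

definition S_norm_equation :: "(c00 \<Rightarrow> real) \<Rightarrow> bool" where
  "S_norm_equation N \<longleftrightarrow>
     norm_on_c00 N \<and> (\<forall>x. N x = max (sup_norm x) (Sup (S_averages N x)))"

definition S_norm :: "c00 \<Rightarrow> real" where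
  "S_norm = (THE N. S_norm_equation N)"

section \<open>The norm of \<open>GM\<close>\<close>

text \<open>
  The set \<open>J = {j\<^sub>1 < j\<^sub>2 < \<dots>}\<close> is numbered from 1, whereas \<^const>\<open>enumerate\<close> starts at 0.
\<close>

definition j_seq :: "nat set \<Rightarrow> nat \<Rightarrow> nat" where
  "j_seq J i = enumerate J (i - 1)"

definition L_set :: "nat set \<Rightarrow> nat set" where
  "L_set J = {j_seq J (2 * k) | k. 1 \<le> k}"

definition Q_set :: "c00 set" where
  "Q_set = {z. \<forall>i. Poly_Mapping.lookup z i \<in> \<rat> \<and> \<bar>Poly_Mapping.lookup z i\<bar> \<le> 1}"

definition Q_seqs :: "c00 list set" where
  "Q_seqs = {zs. zs \<noteq> [] \<and> set zs \<subseteq> Q_set}"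

definition GM_parameters :: "nat set \<Rightarrow> (c00 list \<Rightarrow> nat) \<Rightarrow> bool" where
  "GM_parameters J \<sigma> \<longleftrightarrow>
     infinite J \<and>
     (\<forall>n\<in>J. \<forall>m\<in>J. n < m \<longrightarrow> 4 * (real n)\<^sup>2 \<le> ln (ln (ln (real m)))) \<and>
     logf (real (Inf J)) \<ge> 256 \<and>
     \<sigma> ` Q_seqs \<subseteq> L_set J \<and> inj_on \<sigma> Q_seqs \<and>
     (\<forall>zs\<in>Q_seqs.
        1 / 20 * logf (real (\<sigma> zs) powr (1 / 40)) \<ge> real (card (Poly_Mapping.keys (sum_list zs))))"

definition GM_form1 :: "c00 set \<Rightarrow> c00 \<Rightarrow> bool" where
  "GM_form1 G z \<longleftrightarrow>
     (\<exists>l (\<alpha> :: nat \<Rightarrow> real) zs. 1 \<le> l \<and>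
        (\<Sum>i=1..l. \<bar>\<alpha> i\<bar>) \<le> 1 \<and> (\<forall>i\<in>{1..l}. zs i \<in> G) \<and>
        z = (\<Sum>i=1..l. \<alpha> i *\<^sub>R zs i))"

definition GM_form2 :: "c00 set \<Rightarrow> c00 \<Rightarrow> bool" where
  "GM_form2 G z \<longleftrightarrow>
     (\<exists>l zs. 1 \<le> l \<and> (\<forall>i\<in>{1..l}. zs i \<in> G) \<and>
        (\<forall>i\<in>{1..l}. \<forall>j\<in>{1..l}. i < j \<longrightarrow> supp_less (zs i) (zs j)) \<and>
        z = (1 / logf (real l)) *\<^sub>R (\<Sum>i=1..l. zs i))"

definition GM_form3 :: "nat set \<Rightarrow> (c00 list \<Rightarrow> nat) \<Rightarrow> c00 set \<Rightarrow> c00 \<Rightarrow> bool" where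
  "GM_form3 J \<sigma> G z \<longleftrightarrow>
     (\<exists>l (m :: nat \<Rightarrow> nat) zs (zz :: nat \<Rightarrow> nat \<Rightarrow> c00). 1 \<le> l \<and>
        (\<forall>i\<in>{1..l}. zs i = (1 / logf (real (m i))) *\<^sub>R (\<Sum>j=1..m i. zz i j)) \<and>
        (\<forall>i\<in>{1..l}. \<forall>j\<in>{1..m i}. zz i j \<in> G) \<and>
        (\<forall>i\<in>{1..l}. \<forall>j\<in>{1..m i}. \<forall>i'\<in>{1..l}. \<forall>j'\<in>{1..m i'}.
           i < i' \<or> i = i' \<and> j < j' \<longrightarrow> supp_less (zz i j) (zz i' j')) \<and>
        m 1 = j_seq J (2 * l) \<and>
        (\<forall>i\<in>{1..l}. \<forall>k. Poly_Mapping.lookup (zs i) k \<in> \<rat>) \<and>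
        (\<forall>i\<in>{1..<l}. m (i + 1) = \<sigma> (map zs [1..<i + 1])) \<and>
        z = (1 / sqrt (logf (real l))) *\<^sub>R (\<Sum>i=1..l. zs i))"

primrec GM_star :: "nat set \<Rightarrow> (c00 list \<Rightarrow> nat) \<Rightarrow> nat \<Rightarrow> c00 set" where
  "GM_star J \<sigma> 0 = {Poly_Mapping.single n a | n a. \<bar>a\<bar> \<le> 1}"
| "GM_star J \<sigma> (Suc k) =
     {proj E z | E z. nat_interval E \<and>
        (GM_form1 (GM_star J \<sigma> k) z \<or> GM_form2 (GM_star J \<sigma> k) z \<or> GM_form3 J \<sigma> (GM_star J \<sigma> k) z)}"

text \<open>
  All coordinates of the functionals in \<^const>\<open>GM_star\<close> have absolute value at most 1, so the
  supremum is over a bounded set.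
\<close>

definition GM_norm :: "nat set \<Rightarrow> (c00 list \<Rightarrow> nat) \<Rightarrow> c00 \<Rightarrow> real" where
  "GM_norm J \<sigma> x = (SUP z\<in>(\<Union>k. GM_star J \<sigma> k). pairing z x)"

section \<open>Completions and their operators\<close>

text \<open>
  A completion depends on term parameters (such as \<open>J\<close> and \<open>\<sigma>\<close>) and hence is a set
  rather than a type: the closure of the range of a linear isometry into some Banach space.
  The ambient space may be the completion itself.
\<close>

definition is_completion ::
    "(c00 \<Rightarrow> real) \<Rightarrow> (c00 \<Rightarrow> 'a::banach) \<Rightarrow> 'a set \<Rightarrow> bool" where
  "is_completion N \<iota> X \<longleftrightarrow>
     linear \<iota> \<and> (\<forall>x. norm (\<iota> x) = N x) \<and> X = closure (range \<iota>)"

text \<open>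
  Operators between subspaces \<open>X\<close> and \<open>Y\<close> are functions that vanish outside \<open>X\<close>, so that
  operators that agree on \<open>X\<close> are equal and the vector space operations are pointwise.
\<close>

definition bounded_operators ::
    "'a::real_normed_vector set \<Rightarrow> 'b::real_normed_vector set \<Rightarrow> ('a \<Rightarrow> 'b) set" where
  "bounded_operators X Y =
     {T. (\<forall>x\<in>X. T x \<in> Y) \<and> (\<forall>x. x \<notin> X \<longrightarrow> T x = 0) \<and>
         (\<forall>x\<in>X. \<forall>y\<in>X. T (x + y) = T x + T y) \<and>
         (\<forall>c. \<forall>x\<in>X. T (c *\<^sub>R x) = c *\<^sub>R T x) \<and>
         (\<exists>K. \<forall>x\<in>X. norm (T x) \<le> K * norm x)}"

definition op_norm :: "'a::real_normed_vector set \<Rightarrow> ('a \<Rightarrow> 'b::real_normed_vector) \<Rightarrow> real" where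
  "op_norm X T = (SUP x\<in>{x\<in>X. norm x \<le> 1}. norm (T x))"

definition separable_operators ::
    "'a::real_normed_vector set \<Rightarrow> 'b::real_normed_vector set \<Rightarrow> bool" where
  "separable_operators X Y \<longleftrightarrow>
     (\<exists>D. countable D \<and> D \<subseteq> bounded_operators X Y \<and>
        (\<forall>T\<in>bounded_operators X Y. \<forall>\<epsilon>>0. \<exists>U\<in>D. op_norm X (\<lambda>x. T x - U x) < \<epsilon>))"

definition linear_into_operators ::
    "('l::real_vector \<Rightarrow> 'a \<Rightarrow> 'b) \<Rightarrow> 'a::real_normed_vector set \<Rightarrow> 'b::real_normed_vector set \<Rightarrow> bool" where
  "linear_into_operators \<Phi> X Y \<longleftrightarrow>
     range \<Phi> \<subseteq> bounded_operators X Y \<and>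
     (\<forall>a b. \<Phi> (a + b) = (\<lambda>x. \<Phi> a x + \<Phi> b x)) \<and>
     (\<forall>c a. \<Phi> (c *\<^sub>R a) = (\<lambda>x. c *\<^sub>R \<Phi> a x))"

text \<open>
  As \<^typ>\<open>nat\<close> is discrete, the Banach space \<open>\<ell>\<^sub>\<infinity>\<close> of bounded sequences with the supremum norm is
  \<^typ>\<open>nat \<Rightarrow>\<^sub>C real\<close>.
\<close>

type_synonym l_infinity = "nat \<Rightarrow>\<^sub>C real"

definition l_infinity_isometric_in_operators ::
    "'a::real_normed_vector set \<Rightarrow> 'b::real_normed_vector set \<Rightarrow> bool" where
  "l_infinity_isometric_in_operators X Y \<longleftrightarrow>
     (\<exists>\<Phi> :: l_infinity \<Rightarrow> 'a \<Rightarrow> 'b. linear_into_operators \<Phi> X Y \<and>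
        (\<forall>a. op_norm X (\<Phi> a) = norm a))"

definition l_infinity_embeds_in_operators ::
    "'a::real_normed_vector set \<Rightarrow> 'b::real_normed_vector set \<Rightarrow> bool" where
  "l_infinity_embeds_in_operators X Y \<longleftrightarrow>
     (\<exists>\<Phi> :: l_infinity \<Rightarrow> 'a \<Rightarrow> 'b. linear_into_operators \<Phi> X Y \<and>
        (\<exists>c>0. \<exists>C. \<forall>a. c * norm a \<le> op_norm X (\<Phi> a) \<and> op_norm X (\<Phi> a) \<le> C * norm a))"

section \<open>Existence and uniqueness of the norm of \<open>S\<close>\<close>

lemma lookup_scaleR [simp]: "Poly_Mapping.lookup (a *\<^sub>R x) i = a * Poly_Mapping.lookup (x::c00) i"
  by (simp add: scaleR_poly_mapping_def)

lemma proj_add: "proj E (x + y) = proj E x + proj E y"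
  by (rule poly_mapping_eqI) (simp add: proj.rep_eq lookup_add)

lemma proj_scaleR: "proj E (a *\<^sub>R x) = a *\<^sub>R proj E x"
  by (rule poly_mapping_eqI) (simp add: proj.rep_eq)

lemma keys_proj: "Poly_Mapping.keys (proj E x) = E \<inter> Poly_Mapping.keys x"
  by (auto simp: in_keys_iff proj.rep_eq split: if_splits)

lemma norm_c00: "norm (x::c00) = (\<Sum>i\<in>Poly_Mapping.keys x. \<bar>Poly_Mapping.lookup x i\<bar>)"
proof -
  have "norm x = dist x 0" by (rule norm_conv_dist)
  also have "\<dots> = (\<Sum>i\<in>Poly_Mapping.keys x \<union> Poly_Mapping.keys (0::c00).
      dist (Poly_Mapping.lookup x i) (Poly_Mapping.lookup (0::c00) i))"
    unfolding dist_poly_mapping_def ..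
  finally show ?thesis by (simp only: keys_zero Un_empty_right lookup_zero dist_real_def diff_0_right)
qed

lemma lookup_le_norm: "\<bar>Poly_Mapping.lookup x i\<bar> \<le> norm (x::c00)"
proof (cases "i \<in> Poly_Mapping.keys x")
  case True
  then show ?thesis 
    unfolding norm_c00
    using member_le_sum[of i "Poly_Mapping.keys x" "\<lambda>i. \<bar>Poly_Mapping.lookup x i\<bar>"] by simp
qed (simp add: in_keys_iff)

lemma set_less_chain_disjoint:
  assumes "\<forall>i\<in>{1..n}. \<forall>j\<in>{1..n}. i < j \<longrightarrow> set_less (E i) (E j)"
    and "i \<in> {1..n}" "j \<in> {1..n}" "i \<noteq> (j::nat)"
  shows "E i \<inter> E j = {}"
proof (cases "i < j")
  case True
  from assms(1)[rule_format, OF assms(2,3) this] show ?thesis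
    unfolding set_less_def by (meson disjoint_iff order_less_irrefl)
next
  case False
  then have "j < i" using assms(4) by simp
  from assms(1)[rule_format, OF assms(3,2) this] show ?thesis
    unfolding set_less_def by (meson disjoint_iff order_less_irrefl)
qed

lemma sum_norm_proj_le:
  fixes x :: c00
  assumes "\<forall>i\<in>{1..n}. \<forall>j\<in>{1..n}. i < j \<longrightarrow> set_less (E i) (E j)"
  shows "(\<Sum>j=1..n::nat. norm (proj (E j) x)) \<le> norm x"
proof -
  have disj: "E i \<inter> E j = {}" if "i \<in> {1..n}" "j \<in> {1..n}" "i \<noteq> j" for i j
    by (rule set_less_chain_disjoint[OF assms that])
  have "(\<Sum>j=1..n. norm (proj (E j) x))
      = (\<Sum>j=1..n. \<Sum>i\<in>E j \<inter> Poly_Mapping.keys x. \<bar>Poly_Mapping.lookup x i\<bar>)"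
    by (intro sum.cong refl) (simp add: norm_c00 keys_proj proj.rep_eq)
  also have "\<dots> = (\<Sum>i\<in>(\<Union>j\<in>{1..n}. E j \<inter> Poly_Mapping.keys x). \<bar>Poly_Mapping.lookup x i\<bar>)"
  proof (rule sum.UNION_disjoint[symmetric])
    show "\<forall>i\<in>{1..n}. \<forall>j\<in>{1..n}. i \<noteq> j \<longrightarrow>
        (E i \<inter> Poly_Mapping.keys x) \<inter> (E j \<inter> Poly_Mapping.keys x) = {}"
    proof (intro ballI impI)
      fix i j assume "i \<in> {1..n}" "j \<in> {1..n}" "i \<noteq> j"
      from disj[OF this] show "(E i \<inter> Poly_Mapping.keys x) \<inter> (E j \<inter> Poly_Mapping.keys x) = {}" by blast
    qed
  qed auto
  also have "\<dots> \<le> norm x"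
    unfolding norm_c00 by (rule sum_mono2) auto
  finally show ?thesis .
qed

lemma logf_ge_1: "n \<ge> 1 \<Longrightarrow> logf n \<ge> 1"
  using log_le_cancel_iff[of 2 2 "n + 1"] by (simp add: logf_def)

lemma logf_mono: "0 \<le> m \<Longrightarrow> m \<le> n \<Longrightarrow> logf m \<le> logf n"
  by (simp add: logf_def)

lemma logf_2_gt_1: "logf 2 > 1"
  by (simp add: logf_def less_log_iff)

lemma bdd_sup_norm: "bdd_above (range (\<lambda>i. \<bar>Poly_Mapping.lookup (x::c00) i\<bar>))"
  by (rule bdd_aboveI[where M="norm x"]) (auto simp: lookup_le_norm)

lemma lookup_le_sup_norm: "\<bar>Poly_Mapping.lookup x i\<bar> \<le> sup_norm x"
  unfolding sup_norm_def by (rule cSUP_upper) (auto intro: bdd_sup_norm)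

lemma sup_norm_least: "(\<And>i. \<bar>Poly_Mapping.lookup x i\<bar> \<le> b) \<Longrightarrow> sup_norm x \<le> b"
  unfolding sup_norm_def by (rule cSUP_least) auto

lemma sup_norm_nonneg: "0 \<le> sup_norm x"
  using lookup_le_sup_norm[of x 0] by linarith

lemma S_averages_nonempty: "S_averages N x \<noteq> {}"
proof -
  have "(\<Sum>j=(1::nat)..2. N (proj ((\<lambda>_. {}) j) x)) / logf (real 2) \<in> S_averages N x"
    unfolding S_averages_def mem_Collect_eq
    by (intro exI[of _ "2::nat"] exI[of _ "\<lambda>_. {}"]) (simp add: set_less_def)
  then show ?thesis by blast
qed

text \<open>
  For existence, the norm is obtained as the largest seminorm \<open>p\<close> below the \<open>\<ell>\<^sub>1\<close>-norm (the type
  class norm of \<^typ>\<open>c00\<close>) with \<open>p \<le> S_op p\<close>.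
\<close>

definition S_op :: "(c00 \<Rightarrow> real) \<Rightarrow> c00 \<Rightarrow> real" where
  "S_op N x = max (sup_norm x) (Sup (S_averages N x))"

definition seminorm1 :: "(c00 \<Rightarrow> real) \<Rightarrow> bool" where
  "seminorm1 N \<longleftrightarrow> (\<forall>x. 0 \<le> N x \<and> N x \<le> norm x) \<and>
     (\<forall>a x. N (a *\<^sub>R x) \<le> \<bar>a\<bar> * N x) \<and> (\<forall>x y. N (x + y) \<le> N x + N y)"

lemma S_averages_le_norm:
  assumes "\<And>x. N x \<le> norm x" "v \<in> S_averages N x" shows "v \<le> norm x"
proof -
  obtain n E where nE: "2 \<le> n" "\<forall>i\<in>{1..n}. \<forall>j\<in>{1..n}. i < j \<longrightarrow> set_less (E i) (E j)"
    and v: "v = (\<Sum>j=1..n. N (proj (E j) x)) / logf (real n)"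
    using assms(2) unfolding S_averages_def by auto
  have "(\<Sum>j=1..n. N (proj (E j) x)) \<le> norm x"
    by (rule order_trans[OF sum_mono sum_norm_proj_le[OF nE(2)]]) (rule assms)
  moreover have "1 \<le> logf (real n)" using nE by (intro logf_ge_1) simp
  ultimately show ?thesis
    unfolding v using mult_left_mono[of 1 "logf (real n)" "norm x"] by (simp add: divide_le_eq)
qed

lemma S_op_upper:
  assumes "\<And>x. N x \<le> norm x" "v \<in> S_averages N x" shows "v \<le> S_op N x"
proof -
  have "v \<le> Sup (S_averages N x)"
    by (rule cSup_upper[OF assms(2)]) (rule bdd_aboveI, rule S_averages_le_norm[OF assms(1)])
  then show ?thesis by (simp add: S_op_def)
qed

lemma S_op_least:
  assumes "sup_norm x \<le> b" "\<And>v. v \<in> S_averages N x \<Longrightarrow> v \<le> b" shows "S_op N x \<le> b"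
  unfolding S_op_def using assms by (simp add: cSup_least S_averages_nonempty)

lemma S_op_mono:
  assumes MN: "\<And>x. M x \<le> N x" and N: "\<And>x. N x \<le> norm x" shows "S_op M x \<le> S_op N x"
proof (rule S_op_least)
  show "sup_norm x \<le> S_op N x" by (simp add: S_op_def)
next
  fix v assume "v \<in> S_averages M x"
  then obtain n E where nE: "2 \<le> n" "\<forall>j\<in>{1..n}. finite (E j)"
      "\<forall>i\<in>{1..n}. \<forall>j\<in>{1..n}. i < j \<longrightarrow> set_less (E i) (E j)"
    and v: "v = (\<Sum>j=1..n. M (proj (E j) x)) / logf (real n)"
    unfolding S_averages_def by auto
  have "1 \<le> logf (real n)" using nE by (intro logf_ge_1) simp
  then have "v \<le> (\<Sum>j=1..n. N (proj (E j) x)) / logf (real n)"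
    unfolding v by (intro divide_right_mono sum_mono MN) simp
  also have "\<dots> \<le> S_op N x"
    by (rule S_op_upper[OF N]) (use nE in \<open>auto simp: S_averages_def\<close>)
  finally show "v \<le> S_op N x" .
qed

lemma S_op_seminorm1: assumes "seminorm1 N" shows "seminorm1 (S_op N)"
proof -
  have N: "0 \<le> N x" "N x \<le> norm x" "N (a *\<^sub>R x) \<le> \<bar>a\<bar> * N x" "N (x + y) \<le> N x + N y" for a x y
    using assms by (auto simp: seminorm1_def)
  have 1: "0 \<le> S_op N x" for x using sup_norm_nonneg[of x] by (simp add: S_op_def)
  have 2: "S_op N x \<le> norm x" for x
    by (rule S_op_least, rule sup_norm_least, rule lookup_le_norm, rule S_averages_le_norm[OF N(2)])
  have 3: "S_op N (a *\<^sub>R x) \<le> \<bar>a\<bar> * S_op N x" for a x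
  proof (rule S_op_least)
    have "sup_norm (a *\<^sub>R x) \<le> \<bar>a\<bar> * sup_norm x"
      by (rule sup_norm_least) (simp add: abs_mult mult_left_mono lookup_le_sup_norm)
    also have "\<dots> \<le> \<bar>a\<bar> * S_op N x" by (simp add: S_op_def mult_left_mono)
    finally show "sup_norm (a *\<^sub>R x) \<le> \<bar>a\<bar> * S_op N x" .
  next
    fix v assume "v \<in> S_averages N (a *\<^sub>R x)"
    then obtain n E where nE: "2 \<le> n" "\<forall>j\<in>{1..n}. finite (E j)"
        "\<forall>i\<in>{1..n}. \<forall>j\<in>{1..n}. i < j \<longrightarrow> set_less (E i) (E j)"
      and v: "v = (\<Sum>j=1..n. N (proj (E j) (a *\<^sub>R x))) / logf (real n)"
      unfolding S_averages_def by auto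
    have "1 \<le> logf (real n)" using nE by (intro logf_ge_1) simp
    then have "v \<le> (\<Sum>j=1..n. \<bar>a\<bar> * N (proj (E j) x)) / logf (real n)"
      unfolding v proj_scaleR by (intro divide_right_mono sum_mono N) simp
    also have "\<dots> = \<bar>a\<bar> * ((\<Sum>j=1..n. N (proj (E j) x)) / logf (real n))"
      by (simp add: sum_distrib_left)
    also have "\<dots> \<le> \<bar>a\<bar> * S_op N x"
      by (intro mult_left_mono S_op_upper N) (use nE in \<open>auto simp: S_averages_def\<close>)
    finally show "v \<le> \<bar>a\<bar> * S_op N x" .
  qed
  have 4: "S_op N (x + y) \<le> S_op N x + S_op N y" for x y
  proof (rule S_op_least)
    have "sup_norm (x + y) \<le> sup_norm x + sup_norm y"
    proof (rule sup_norm_least)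
      fix i show "\<bar>Poly_Mapping.lookup (x + y) i\<bar> \<le> sup_norm x + sup_norm y"
        using lookup_le_sup_norm[of x i] lookup_le_sup_norm[of y i] by (simp add: lookup_add)
    qed
    also have "\<dots> \<le> S_op N x + S_op N y" unfolding S_op_def by (intro add_mono) auto
    finally show "sup_norm (x + y) \<le> S_op N x + S_op N y" .
  next
    fix v assume "v \<in> S_averages N (x + y)"
    then obtain n E where nE: "2 \<le> n" "\<forall>j\<in>{1..n}. finite (E j)"
        "\<forall>i\<in>{1..n}. \<forall>j\<in>{1..n}. i < j \<longrightarrow> set_less (E i) (E j)"
      and v: "v = (\<Sum>j=1..n. N (proj (E j) (x + y))) / logf (real n)"
      unfolding S_averages_def by auto
    have "1 \<le> logf (real n)" using nE by (intro logf_ge_1) simp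
    then have "v \<le> (\<Sum>j=1..n. N (proj (E j) x) + N (proj (E j) y)) / logf (real n)"
      unfolding v proj_add by (intro divide_right_mono sum_mono N) simp
    also have "\<dots> = (\<Sum>j=1..n. N (proj (E j) x)) / logf (real n)
        + (\<Sum>j=1..n. N (proj (E j) y)) / logf (real n)"
      by (simp add: sum.distrib add_divide_distrib)
    also have "\<dots> \<le> S_op N x + S_op N y"
      by (intro add_mono S_op_upper N) (use nE in \<open>auto simp: S_averages_def\<close>)
    finally show "v \<le> S_op N x + S_op N y" .
  qed
  show ?thesis using 1 2 3 4 by (simp add: seminorm1_def)
qed

lemma S_norm_exists: "\<exists>N. S_norm_equation N"
proof -
  define P where "P = {p. seminorm1 p \<and> (\<forall>x. p x \<le> S_op p x)}"
  define N where "N x = (SUP p\<in>P. p x)" for x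
  have P: "0 \<le> p x" "p x \<le> norm x" "p (a *\<^sub>R x) \<le> \<bar>a\<bar> * p x" "p (x + y) \<le> p x + p y" "p x \<le> S_op p x"
    if "p \<in> P" for p a x y
    using that by (auto simp: P_def seminorm1_def)
  have zero: "(\<lambda>_. 0) \<in> P"
    using sup_norm_nonneg by (auto simp: P_def seminorm1_def S_op_def le_max_iff_disj)
  have upper: "p x \<le> N x" if "p \<in> P" for p x
    unfolding N_def by (rule cSUP_upper[OF that]) (rule bdd_aboveI2, rule P)
  have least: "N x \<le> b" if "\<And>p. p \<in> P \<Longrightarrow> p x \<le> b" for x b
    unfolding N_def by (rule cSUP_least) (use zero that in auto)
  have N_norm: "N x \<le> norm x" for x by (rule least) (rule P)
  have sN: "seminorm1 N"
    unfolding seminorm1_def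
  proof (intro conjI allI)
    fix x show "0 \<le> N x" using upper[OF zero] .
    show "N x \<le> norm x" by (rule N_norm)
    fix a show "N (a *\<^sub>R x) \<le> \<bar>a\<bar> * N x"
    proof (rule least)
      fix p assume p: "p \<in> P"
      have "p (a *\<^sub>R x) \<le> \<bar>a\<bar> * p x" by (rule P[OF p])
      also have "\<dots> \<le> \<bar>a\<bar> * N x" by (intro mult_left_mono upper p) simp
      finally show "p (a *\<^sub>R x) \<le> \<bar>a\<bar> * N x" .
    qed
  next
    fix x y show "N (x + y) \<le> N x + N y"
    proof (rule least)
      fix p assume p: "p \<in> P"
      show "p (x + y) \<le> N x + N y" using P(4)[OF p, of x y] upper[OF p, of x] upper[OF p, of y] by linarith
    qed
  qed
  have le: "N x \<le> S_op N x" for x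
  proof (rule least)
    fix p assume p: "p \<in> P"
    show "p x \<le> S_op N x"
      by (rule order_trans[OF P(5)[OF p] S_op_mono]) (auto intro: upper[OF p] N_norm)
  qed
  have sS: "seminorm1 (S_op N)" by (rule S_op_seminorm1[OF sN])
  then have "S_op N \<in> P"
    unfolding P_def using S_op_mono[of N "S_op N"] le by (simp add: seminorm1_def)
  then have eq: "N x = S_op N x" for x
    using upper[of "S_op N" x] le[of x] by linarith
  have sup: "sup_norm x \<le> N x" for x by (subst eq) (simp add: S_op_def)
  have N: "0 \<le> N x" "N (a *\<^sub>R x) \<le> \<bar>a\<bar> * N x" "N (x + y) \<le> N x + N y" for a x y
    using sN by (auto simp: seminorm1_def)
  have "norm_on_c00 N"
    unfolding norm_on_c00_def
  proof (intro conjI allI)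
    fix x :: c00
    show "N x = 0 \<longleftrightarrow> x = 0"
    proof
      assume "N x = 0"
      then have "\<bar>Poly_Mapping.lookup x i\<bar> \<le> 0" for i
        using lookup_le_sup_norm[of x i] sup[of x] by linarith
      then show "x = 0" by (intro poly_mapping_eqI) auto
    next
      assume "x = 0" then show "N x = 0" using N_norm[of x] N(1)[of x] by simp
    qed
    fix a :: real
    show "N (a *\<^sub>R x) = \<bar>a\<bar> * N x"
    proof (cases "a = 0")
      case True then show ?thesis using N_norm[of 0] N(1)[of 0] by simp
    next
      case False
      have "N x = N (inverse a *\<^sub>R (a *\<^sub>R x))" using False by simp
      also have "\<dots> \<le> \<bar>inverse a\<bar> * N (a *\<^sub>R x)" by (rule N)
      finally have "\<bar>a\<bar> * N x \<le> N (a *\<^sub>R x)"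
        using False by (simp add: abs_inverse field_simps)
      then show ?thesis using N(2)[of a x] by linarith
    qed
  qed (auto intro: N)
  then have "S_norm_equation N"
    unfolding S_norm_equation_def using eq by (simp add: S_op_def)
  then show ?thesis by (rule exI[where P = S_norm_equation])
qed

lemma proj_eq_self: "Poly_Mapping.keys x \<subseteq> E \<Longrightarrow> proj E x = x"
  by (rule poly_mapping_eqI) (auto simp: proj.rep_eq in_keys_iff)

lemma proj_eq_0: "E \<inter> Poly_Mapping.keys x = {} \<Longrightarrow> proj E x = 0"
  by (rule poly_mapping_eqI) (auto simp: proj.rep_eq in_keys_iff)

lemma S_norm_le:
  assumes N: "S_norm_equation N" and M: "S_norm_equation M"
  shows "N x \<le> M x"
proof (induction "card (Poly_Mapping.keys x)" arbitrary: x rule: less_induct)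
  case less
  have bdd: "bdd_above (S_averages K x)" if K: "norm_on_c00 K" for K
  proof -
    define C where "C = Max ((\<lambda>A. K (proj A x)) ` Pow (Poly_Mapping.keys x))"
    have C: "K (proj A x) \<le> C" for A
    proof -
      have "proj A x = proj (A \<inter> Poly_Mapping.keys x) x"
        by (rule poly_mapping_eqI) (auto simp: proj.rep_eq in_keys_iff)
      then show ?thesis unfolding C_def by (intro Max_ge) auto
    qed
    have K0: "K y \<ge> 0" "K y = 0 \<longleftrightarrow> y = 0" for y using K by (auto simp: norm_on_c00_def)
    have "C \<ge> 0" by (rule order_trans[OF K0(1) C])
    have "v \<le> real (card (Poly_Mapping.keys x)) * C" if "v \<in> S_averages K x" for v
    proof -
      obtain n E where nE: "2 \<le> n" "\<forall>i\<in>{1..n}. \<forall>j\<in>{1..n}. i < j \<longrightarrow> set_less (E i) (E j)"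
        and v: "v = (\<Sum>j=1..n. K (proj (E j) x)) / logf (real n)"
        using \<open>v \<in> S_averages K x\<close> unfolding S_averages_def by auto
      have disj: "E i \<inter> E j = {}" if "i \<in> {1..n}" "j \<in> {1..n}" "i \<noteq> j" for i j
        by (rule set_less_chain_disjoint[OF nE(2) that])
      define I where "I = {j\<in>{1..n}. E j \<inter> Poly_Mapping.keys x \<noteq> {}}"
      have "\<forall>j\<in>I. \<exists>i. i \<in> E j \<inter> Poly_Mapping.keys x" unfolding I_def by blast
      then obtain g where g: "\<forall>j\<in>I. g j \<in> E j \<inter> Poly_Mapping.keys x"
        by (rule bchoice[THEN exE])
      have card: "card I \<le> card (Poly_Mapping.keys x)"
      proof (rule card_inj_on_le)
        show "inj_on g I"
        proof (rule inj_onI, rule ccontr)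
          fix i j assume ij: "i \<in> I" "j \<in> I" "g i = g j" "i \<noteq> j"
          then have "E i \<inter> E j = {}" by (intro disj) (simp_all add: I_def)
          then show False using bspec[OF g ij(1)] bspec[OF g ij(2)] ij(3) by auto
        qed
        show "g ` I \<subseteq> Poly_Mapping.keys x" using g by blast
      qed simp
      have "(\<Sum>j=1..n. K (proj (E j) x)) = (\<Sum>j\<in>I. K (proj (E j) x))"
        by (rule sum.mono_neutral_right) (auto simp: I_def K0(2) intro: proj_eq_0)
      also have "\<dots> \<le> real (card I) * C" by (rule sum_bounded_above) (rule C)
      also have "\<dots> \<le> real (card (Poly_Mapping.keys x)) * C"
        using card \<open>C \<ge> 0\<close> by (intro mult_right_mono) auto
      finally have le: "(\<Sum>j=1..n. K (proj (E j) x)) \<le> real (card (Poly_Mapping.keys x)) * C" .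
      have "1 \<le> logf (real n)" using nE by (intro logf_ge_1) simp
      moreover have "0 \<le> (\<Sum>j=1..n. K (proj (E j) x))" by (intro sum_nonneg K0)
      ultimately have "v \<le> (\<Sum>j=1..n. K (proj (E j) x)) / 1" unfolding v by (intro divide_left_mono) auto
      with le show ?thesis by simp
    qed
    then show ?thesis by (rule bdd_aboveI)
  qed
  have Nn: "norm_on_c00 N" and Mn: "norm_on_c00 M"
    and Neq: "N x = max (sup_norm x) (Sup (S_averages N x))"
    and Meq: "M x = max (sup_norm x) (Sup (S_averages M x))"
    using N M by (auto simp: S_norm_equation_def)
  have N0: "N y \<ge> 0" "N 0 = 0" and M0: "M y \<ge> 0" for y using Nn Mn by (auto simp: norm_on_c00_def)
  show ?case
  proof (rule ccontr)
    assume "\<not> N x \<le> M x"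
    then have gt: "M x < N x" by simp
    then have pos: "0 < N x" using M0[of x] by linarith
    have "v \<le> max (M x) (N x / logf 2)" if "v \<in> S_averages N x" for v
    proof -
      obtain n E where nE: "2 \<le> n" "\<forall>j\<in>{1..n}. finite (E j)"
          "\<forall>i\<in>{1..n}. \<forall>j\<in>{1..n}. i < j \<longrightarrow> set_less (E i) (E j)"
        and v: "v = (\<Sum>j=1..n. N (proj (E j) x)) / logf (real n)"
        using \<open>v \<in> S_averages N x\<close> unfolding S_averages_def by auto
      have disj: "E i \<inter> E j = {}" if "i \<in> {1..n}" "j \<in> {1..n}" "i \<noteq> j" for i j
        by (rule set_less_chain_disjoint[OF nE(3) that])
      have l1: "1 \<le> logf (real n)" using nE by (intro logf_ge_1) simp
      show ?thesis
      proof (cases "\<exists>j\<in>{1..n}. Poly_Mapping.keys x \<subseteq> E j")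
        case True
        then obtain j where j: "j \<in> {1..n}" "Poly_Mapping.keys x \<subseteq> E j" by blast
        have "(\<Sum>i=1..n. N (proj (E i) x)) = (\<Sum>i\<in>{j}. N (proj (E i) x))"
        proof (rule sum.mono_neutral_right)
          show "\<forall>i\<in>{1..n} - {j}. N (proj (E i) x) = 0"
          proof
            fix i assume "i \<in> {1..n} - {j}"
            then have "E i \<inter> E j = {}" using disj j by auto
            then show "N (proj (E i) x) = 0" using j N0 by (subst proj_eq_0) auto
          qed
        qed (use j in auto)
        then have "v = N x / logf (real n)" using j by (simp add: v proj_eq_self)
        also have "\<dots> \<le> N x / logf 2"
          using nE logf_2_gt_1 l1 pos by (intro divide_left_mono logf_mono) auto
        finally show ?thesis by simp
      next
        case False
        have "N (proj (E j) x) \<le> M (proj (E j) x)" if "j \<in> {1..n}" for j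
        proof (rule less)
          have "E j \<inter> Poly_Mapping.keys x \<subset> Poly_Mapping.keys x" using False that by blast
          then show "card (Poly_Mapping.keys (proj (E j) x)) < card (Poly_Mapping.keys x)"
            unfolding keys_proj by (intro psubset_card_mono) auto
        qed
        then have "v \<le> (\<Sum>j=1..n. M (proj (E j) x)) / logf (real n)"
          unfolding v using l1 by (intro divide_right_mono sum_mono) auto
        also have "\<dots> \<le> Sup (S_averages M x)"
          by (rule cSup_upper[OF _ bdd[OF Mn]]) (use nE in \<open>auto simp: S_averages_def\<close>)
        also have "\<dots> \<le> M x" by (subst Meq) simp
        finally show ?thesis by simp
      qed
    qed
    then have "Sup (S_averages N x) \<le> max (M x) (N x / logf 2)"
      by (rule cSup_least[OF S_averages_nonempty])
    moreover have "sup_norm x \<le> M x" by (subst Meq) simp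
    ultimately have "N x \<le> max (M x) (N x / logf 2)" by (subst Neq) auto
    moreover have "N x / logf 2 < N x" using pos logf_2_gt_1 by (simp add: divide_less_eq)
    ultimately show False using gt by auto
  qed
qed

lemma S_norm_ex1: "\<exists>!N. S_norm_equation N"
proof -
  obtain N where N: "S_norm_equation N" using S_norm_exists by blast
  show ?thesis
  proof (rule ex1I[of _ N])
    fix M assume M: "S_norm_equation M"
    show "M = N" by (rule ext) (intro antisym S_norm_le M N)
  qed (rule N)
qed

lemma S_norm_equation_S_norm: "S_norm_equation S_norm"
  unfolding S_norm_def by (rule theI'[OF S_norm_ex1])

end

(* A bounded sequence (b_n) acts as the multiplier x |-> sum_n b_n y_n(x) e_n, where (y_n) are successive
   functionals obtained by evaluating finite trees of averages: the average at node r has length N r and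
   weight 1/f(N r), and y_n expands the first n nodes. Every y_n is bounded by 1 on S and on GM, and equals 1
   at a vector of norm at most 2, obtained from a coordinate vector by replacing, node after node, a coordinate
   by a normalized constant vector on N r coordinates, which changes the norm by at most (1/2)^(r+1).

   The multiplier is bounded by sup |b_n| even into a larger norm NK, whose special functionals are only
   required to use each length of L at most twice. A functional z in the norming set of NK is composed with the
   multiplier; averages in z become averages of functionals of norm one. The special functionals are
   harmless because the lengths N r lie far away from L: for m in L let r be the first node with m <= N r.
   At node r each of m successive functionals is mapped to 2/f(N r) times a sum of N r functionals of norm
   one. These are at most (N r)^2 in total, and f((N r)^2) <= 2 f(N r), so the whole sum is mapped to a
   functional whose norm is bounded in terms of the nodes before r only. This is negligible against f(m), even
   if the square root of f(m) is lost. Since NK dominates the norms of S and GM, this gives the upper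
   estimates, and the vectors above give the lower ones. If y_n is replaced by its multiple of norm one
   in the dual of GM, the embedding becomes isometric. *)
theory Submission
  imports Defs
begin

section \<open>The logarithmic weights\<close>

text \<open>The trees must grow with \<open>n\<close>: a fixed average is short compared with all
  but finitely many lengths in \<open>L\<close>, whereas for each length \<open>m\<close> all but
  finitely many of the trees reach the nodes at which \<open>m\<close> is overtaken. The remaining
  \<open>n\<close> are simply counted. Two obstacles shape the estimates. Only restrictions to
  intervals are built into the functionals of \<open>GM\<close>, so on the domain side functionals
  are replaced by successive intervals, and what is tracked is their number. On the range side,
  special functionals must respect the bound \<open>n / f(n)\<close> for sums of \<open>n\<close>
  coordinates, since this is what makes normalized constant vectors behave like coordinate vectors.
  Both explain the weight \<open>4 / 5\<close> of special functionals. It is at least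
  \<open>1 / sqrt (f(2))\<close>, as domination of \<open>GM\<close> requires, and its distance from
  1 pays for the loss in Jensen's inequality and for the larger groups formed when a short special
  block is composed with a multiplier. The lengths are \<open>4 ^ (l ^ 4)\<close> with
  \<open>l\<close> in \<open>L\<close>: the eighth power of such a number is
  \<open>2 ^ (16 * l ^ 4)\<close>, the lower bound for \<open>f\<close> at all later elements of
  \<open>L\<close>.\<close>

lemma two_mult_le_ln_add_one:
  fixes y :: real
  assumes "0 \<le> y"
  shows "2 * y \<le> (2 + y) * ln (1 + y)"
proof -
  have "ln (1 + 0) - 2 * 0 / (2 + 0) \<le> ln (1 + y) - 2 * y / (2 + y)"
  proof (rule DERIV_nonneg_imp_nondecreasing[OF assms])
    fix x :: real assume x: "0 \<le> x" "x \<le> y"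
    have "((\<lambda>x. ln (1 + x) - 2 * x / (2 + x)) has_real_derivative
        1 / (1 + x) - (2 * (2 + x) - 2 * x) / ((2 + x) * (2 + x))) (at x)"
      using x by (auto intro!: derivative_eq_intros)
    moreover have "1 / (1 + x) - (2 * (2 + x) - 2 * x) / ((2 + x) * (2 + x)) = x\<^sup>2 / ((1 + x) * (2 + x)\<^sup>2)"
      using x by (simp add: divide_simps power2_eq_square) (simp add: algebra_simps)
    ultimately show "\<exists>D. ((\<lambda>x. ln (1 + x) - 2 * x / (2 + x)) has_real_derivative D) (at x) \<and> 0 \<le> D"
      using x by (metis divide_nonneg_nonneg mult_nonneg_nonneg zero_le_power2 add_nonneg_nonneg zero_le_one)
  qed
  then have "2 * y / (2 + y) \<le> ln (1 + y)" by simp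
  then show ?thesis using assms by (simp add: pos_divide_le_eq mult.commute)
qed

text \<open>Provides Jensen's inequality for \<open>n / f(n)\<close>, the function that will bound
  coordinate sums of norming functionals. The numerator of the second derivative has the sign given
  by \<open>two_mult_le_ln_add_one\<close>.\<close>

lemma concave_divide_logf: "concave_on {0<..} (\<lambda>y. y / logf y)"
proof -
  have "concave_on {0<..} (\<lambda>y. y / ln (1 + y))"
  proof (rule f''_le0_imp_concave)
    fix x :: real assume "x \<in> {0<..}"
    then have x: "0 < x" by simp
    then have L: "0 < ln (1 + x)" by simp
    show "((\<lambda>y. y / ln (1 + y)) has_real_derivative
        1 / ln (1 + x) - x / (1 + x) / (ln (1 + x))\<^sup>2) (at x)"
      using x L
      by (auto intro!: derivative_eq_intros simp: power2_eq_square)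
         (simp add: diff_divide_distrib)
    show "((\<lambda>x. 1 / ln (1 + x) - x / (1 + x) / (ln (1 + x))\<^sup>2) has_real_derivative
        (2 * x - (2 + x) * ln (1 + x)) / ((1 + x)\<^sup>2 * (ln (1 + x))^3)) (at x)"
      using x L
      apply (auto intro!: derivative_eq_intros simp: power2_eq_square power3_eq_cube)
      apply (simp add: divide_simps add_eq_0_iff)
      apply (simp add: algebra_simps)
      done
    show "(2 * x - (2 + x) * ln (1 + x)) / ((1 + x)\<^sup>2 * (ln (1 + x))^3) \<le> 0"
      using two_mult_le_ln_add_one[of x] x L by (intro divide_nonpos_nonneg) auto
  qed auto
  then have "concave_on {0<..} (\<lambda>y. ln 2 * (y / ln (1 + y)))"
    unfolding concave_on_def
    using convex_on_cmul[of "ln 2" "{0<..}" "\<lambda>y. - (y / ln (1 + y))"] by simp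
  then show ?thesis
    by (simp add: logf_def log_def add.commute mult.commute)
qed

lemma logf_nonneg: "0 \<le> x \<Longrightarrow> 0 \<le> logf x"
  by (simp add: logf_def)

lemma logf_pos: "0 < x \<Longrightarrow> 0 < logf x"
  by (simp add: logf_def)

lemma logf_1 [simp]: "logf 1 = 1"
  by (simp add: logf_def)

text \<open>Amounts to \<open>2 ^ 25 <= 3 ^ 16\<close>. The value is the square of
  \<open>5 / 4\<close>, so that \<open>1 / sqrt (logf l) <= 4 / 5\<close> for
  \<open>l >= 2\<close>.\<close>

lemma logf_2_ge: "25 / 16 \<le> logf 2"
proof -
  have "(2 powr (25 / 16) :: real) ^ 16 = 2 powr 25" by (simp flip: powr_realpow add: powr_powr)
  also have "\<dots> \<le> 3 ^ 16" by simp
  finally have "2 powr (25 / 16) \<le> (3::real)" by (rule power_le_imp_le_base[of _ 15, unfolded eval_nat_numeral, simplified]) simp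
  then have "log 2 (2 powr (25 / 16)) \<le> log 2 (3::real)" by (subst log_le_cancel_iff) auto
  then show ?thesis by (simp add: logf_def)
qed

lemma logf_mult_le:
  assumes "1 \<le> x" "1 \<le> y" shows "logf (x * y) \<le> logf x + logf y"
proof -
  have "0 < x * y" using assms by simp
  then have "log 2 (x * y + 1) \<le> log 2 ((x + 1) * (y + 1))"
    using assms by (subst log_le_cancel_iff) (auto simp: algebra_simps add_pos_pos)
  also have "\<dots> = log 2 (x + 1) + log 2 (y + 1)" using assms by (subst log_mult) auto
  finally show ?thesis by (simp add: logf_def)
qed

text \<open>With \<open>a = logf x\<close> one has \<open>2 powr a = x + 1\<close>. Since 2 is the
  convex combination of 1 and \<open>1 + y\<close> with weight \<open>1 / y\<close> on the latter,
  convexity of \<open>t powr a\<close> gives \<open>x * y + 1 <= (1 + y) powr a\<close>.\<close>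

lemma logf_submult:
  assumes x: "1 \<le> x" and y: "1 \<le> y" shows "logf (x * y) \<le> logf x * logf y"
proof -
  let ?a = "logf x"
  have a: "1 \<le> ?a" by (rule logf_ge_1[OF x])
  have cv: "convex_on {0<..} (\<lambda>t::real. t powr ?a)" by (rule powr_convex[OF a])
  have "((1 - 1 / y) *\<^sub>R 1 + (1 / y) *\<^sub>R (1 + y)) powr ?a \<le> (1 - 1 / y) * 1 powr ?a + (1 / y) * (1 + y) powr ?a"
    using y by (intro convex_onD[OF cv]) auto
  moreover have "(1 - 1 / y) *\<^sub>R 1 + (1 / y) *\<^sub>R (1 + y) = 2" using y by (simp add: field_simps)
  moreover have "2 powr ?a = x + 1" using x by (simp add: logf_def)
  ultimately have "x + 1 \<le> (1 - 1 / y) + (1 / y) * (1 + y) powr ?a" by (simp only: mult_1_right powr_one_eq_one)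
  then have "y * (x + 1) \<le> y * ((1 - 1 / y) + (1 / y) * (1 + y) powr ?a)" using y by (intro mult_left_mono) auto
  also have "\<dots> = y - 1 + (1 + y) powr ?a" using y by (simp add: field_simps)
  finally have "x * y + 1 \<le> (1 + y) powr ?a" by (simp add: algebra_simps)
  moreover have "0 < x * y" using x y by simp
  ultimately have "log 2 (x * y + 1) \<le> log 2 ((1 + y) powr ?a)" by (subst log_le_cancel_iff) auto
  also have "\<dots> = ?a * log 2 (1 + y)" using y by (simp add: log_powr)
  finally show ?thesis by (simp add: logf_def add.commute)
qed

lemma logf_le_of_nat: "logf (real n) \<le> real n"
proof -
  have "n + 1 \<le> 2 ^ n" using less_exp[of n] by (simp only: Suc_eq_plus1[symmetric] Suc_le_eq)
  then have "real n + 1 \<le> 2 ^ n" by (metis of_nat_1 of_nat_add of_nat_le_numeral_power_cancel_iff)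
  then have "log 2 (real n + 1) \<le> log 2 (2 ^ n)" by (subst log_le_cancel_iff) auto
  then show ?thesis by (simp add: logf_def)
qed

lemma divide_logf_mono:
  assumes "0 < x" "x \<le> y" shows "x / logf x \<le> y / logf y"
proof -
  have "x / ln (1 + x) \<le> y / ln (1 + y)"
  proof (rule DERIV_nonneg_imp_nondecreasing[OF assms(2)])
    fix t :: real assume "x \<le> t" "t \<le> y"
    then have t: "0 < t" using assms by simp
    then have L: "0 < ln (1 + t)" by simp
    have "((\<lambda>y. y / ln (1 + y)) has_real_derivative
        (ln (1 + t) - t / (1 + t)) / (ln (1 + t))\<^sup>2) (at t)"
      using t L by (auto intro!: derivative_eq_intros simp: power2_eq_square)
    moreover have "t / (1 + t) \<le> ln (1 + t)"
    proof -
      have "ln (1 / (1 + t)) \<le> 1 / (1 + t) - 1" using t by (intro ln_le_minus_one) simp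
      then show ?thesis using t by (simp add: ln_div field_simps)
    qed
    ultimately show "\<exists>D. ((\<lambda>y. y / ln (1 + y)) has_real_derivative D) (at t) \<and> 0 \<le> D"
      by (metis diff_ge_0_iff_ge divide_nonneg_nonneg zero_le_power2)
  qed
  then have "ln 2 * (x / ln (1 + x)) \<le> ln 2 * (y / ln (1 + y))" by (intro mult_left_mono) auto
  then show ?thesis by (simp add: logf_def log_def add.commute mult.commute)
qed

lemma divide_logf_mono_nat:
  assumes "m \<le> n" shows "real m / logf (real m) \<le> real n / logf (real n)"
proof (cases "m = 0")
  case False
  then show ?thesis using assms by (intro divide_logf_mono) auto
qed (simp add: logf_nonneg)

lemma sum_divide_logf_le:
  fixes a :: "'i \<Rightarrow> real"
  assumes "finite I" "I \<noteq> {}" "\<And>i. i \<in> I \<Longrightarrow> 0 < a i"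
  shows "(\<Sum>i\<in>I. a i / logf (a i)) \<le> sum a I / logf (sum a I / real (card I))"
proof -
  let ?q = "real (card I)"
  have q: "0 < ?q" using assms by (simp add: card_gt_0_iff)
  have "(\<Sum>i\<in>I. (1 / ?q) * (a i / logf (a i))) \<le> (\<Sum>i\<in>I. (1 / ?q) *\<^sub>R a i) / logf (\<Sum>i\<in>I. (1 / ?q) *\<^sub>R a i)"
    by (rule concave_on_sum[OF assms(1,2) concave_divide_logf]) (use assms q in auto)
  also have "(\<Sum>i\<in>I. (1 / ?q) *\<^sub>R a i) = sum a I / ?q" by (simp add: sum_divide_distrib)
  finally have "(\<Sum>i\<in>I. a i / logf (a i)) / ?q \<le> (sum a I / ?q) / logf (sum a I / ?q)"
    by (simp only: sum_divide_distrib times_divide_eq_left mult_1_left)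
  then show ?thesis using q by (simp add: field_simps)
qed

text \<open>The induction step showing that the bound \<open>n / f(n)\<close> survives averaging.
  Jensen's inequality gives \<open>n / f(n / k)\<close> for \<open>k\<close> nonzero parts, and
  submultiplicativity gives \<open>f(n / k) * f(q) >= f(n)\<close>. Zero parts are removed first
  because concavity is only available on the positive reals.\<close>

lemma sum_divide_logf_le_nat:
  fixes a :: "'i \<Rightarrow> nat"
  assumes "finite I" "card I \<le> q" "1 \<le> q"
  shows "(\<Sum>i\<in>I. real (a i) / logf (real (a i))) / logf (real q) \<le> real (sum a I) / logf (real (sum a I))"
proof -
  define I' where "I' = {i\<in>I. a i \<noteq> 0}"
  have fin: "finite I'" using assms by (simp add: I'_def)
  have s: "sum a I = sum a I'" unfolding I'_def by (rule sum.mono_neutral_right) (use assms in auto)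
  have s': "(\<Sum>i\<in>I. real (a i) / logf (real (a i))) = (\<Sum>i\<in>I'. real (a i) / logf (real (a i)))"
    unfolding I'_def by (rule sum.mono_neutral_right) (use assms in auto)
  show ?thesis
  proof (cases "I' = {}")
    case True then show ?thesis by (simp add: s s')
  next
    case False
    let ?k = "card I'" and ?n = "sum a I'"
    have k: "0 < ?k" using False fin by (simp add: card_gt_0_iff)
    have kq: "?k \<le> q" using assms card_mono[of I I'] by (auto simp: I'_def)
    have "?k \<le> ?n" using sum_mono[of I' "\<lambda>_. 1" a] by (simp add: I'_def Suc_leI)
    then have n: "1 \<le> real ?n / real ?k" "1 \<le> real ?n" using k by (auto simp del: of_nat_sum)
    have "(\<Sum>i\<in>I'. real (a i) / logf (real (a i))) \<le> real ?n / logf (real ?n / real ?k)"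
      using sum_divide_logf_le[OF fin False, of "\<lambda>i. real (a i)"] by (simp add: I'_def)
    then have "(\<Sum>i\<in>I'. real (a i) / logf (real (a i))) / logf (real q)
        \<le> (real ?n / logf (real ?n / real ?k)) / logf (real q)"
      using assms by (intro divide_right_mono logf_nonneg) auto
    also have "\<dots> \<le> real ?n / logf (real ?n)"
    proof -
      have "logf (real ?n) = logf (real ?k * (real ?n / real ?k))" using k by simp
      also have "\<dots> \<le> logf (real ?k) * logf (real ?n / real ?k)" using k n by (intro logf_submult) auto
      also have "\<dots> \<le> logf (real q) * logf (real ?n / real ?k)"
        using kq n by (intro mult_right_mono logf_mono logf_nonneg) auto
      finally have "logf (real ?n) \<le> logf (real ?n / real ?k) * logf (real q)" by (simp add: mult.commute)
      then show ?thesis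
        using n logf_pos[of "real ?n"] assms by (auto intro!: divide_left_mono mult_pos_pos logf_pos)
    qed
    finally show ?thesis by (simp add: s s')
  qed
qed

lemma logf_4_power: "2 * real M \<le> logf (real (4 ^ M))" "logf (real (4 ^ M)) \<le> 2 * real M + 1"
proof -
  have e: "(4::real) ^ M = 2 ^ (2 * M)" by (simp add: power_mult)
  have pos: "0 < (4::real) ^ M + 1" by (intro add_pos_pos) auto
  have "log 2 (2 ^ (2 * M)) \<le> log 2 ((4::real) ^ M + 1)"
    using pos unfolding e by (subst log_le_cancel_iff) auto
  then show "2 * real M \<le> logf (real (4 ^ M))" by (simp add: logf_def)
  have "log 2 ((4::real) ^ M + 1) \<le> log 2 (2 ^ (2 * M + 1))"
    using pos unfolding e by (subst log_le_cancel_iff) auto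
  also have "\<dots> = real (2 * M + 1)" by (rule log_pow_cancel) auto
  finally show "logf (real (4 ^ M)) \<le> 2 * real M + 1" by (simp add: logf_def)
qed

text \<open>The threshold 256 is the lower bound of \<open>logf\<close> on \<open>L\<close>. Passing
  from \<open>n\<close> to \<open>n / (10 * f(n)^2)\<close> thus costs at most a ninth of
  \<open>f(n)\<close>, which is the origin of the factor \<open>9 / 8\<close> in
  \<open>K_flat\<close>.\<close>

lemma logf_square_le:
  assumes "256 \<le> y" shows "logf (10 * y\<^sup>2) \<le> y / 9"
proof -
  have ln2: "1 / 2 \<le> ln (2::real)"
    using ln_le_minus_one[of "1 / 2 :: real"] by (simp add: ln_div)
  have y2: "65536 \<le> y\<^sup>2" using power_mono[OF assms, of 2] by simp
  have "log 2 (10 * y\<^sup>2 + 1) \<le> log 2 (2 ^ 20 * (y / 256)\<^sup>2)"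
    using y2 by (subst log_le_cancel_iff) (auto simp: power_divide)
  also have "\<dots> = 20 + 2 * log 2 (y / 256)"
  proof -
    have "log 2 (2 ^ 20) = (20::real)" by (subst log_pow_cancel) auto
    then show ?thesis using assms by (subst log_mult) (auto simp: log_nat_power simp del: power_numeral numeral_power_eq_of_nat_cancel_iff)
  qed
  also have "log 2 (y / 256) \<le> 2 * (y / 256 - 1)"
  proof -
    have "ln (y / 256) \<le> y / 256 - 1" using assms by (intro ln_le_minus_one) auto
    also have "\<dots> \<le> 2 * ln 2 * (y / 256 - 1)" 
      using assms ln2 mult_right_mono[of 1 "2 * ln 2" "y / 256 - 1"] by simp
    also have "\<dots> = 2 * (y / 256 - 1) * ln 2" by simp
    finally show ?thesis unfolding log_def by (subst pos_divide_le_eq) simp_all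
  qed
  finally show ?thesis using assms by (simp add: logf_def)
qed

text \<open>The left side bounds what a functional with coordinate sums at most
  \<open>n / f(n)\<close> can gain from \<open>n\<close> coordinates of the normalized constant
  vector of length \<open>4 ^ M\<close>; the ideal value is the proportion \<open>t\<close> of the
  coordinates used. Below \<open>2 ^ M\<close>, the square root of the length, the whole left side
  is tiny. Above it \<open>f(n) >= M\<close>, while \<open>t\<close> times the difference of the two
  logarithms is bounded, as \<open>t * ln (1 / t)\<close> is.\<close>

lemma flat_excess_le:
  assumes n: "1 \<le> n" "n \<le> 4 ^ M" and M: "1 \<le> M"
  shows "logf (real (4 ^ M)) / real (4 ^ M) * (real n / logf (real n)) \<le> real n / real (4 ^ M) + 4 / real M"
proof -
  let ?N = "real (4 ^ M)"
  have N: "0 < ?N" by simp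
  have f1: "1 \<le> logf (real n)" using n by (intro logf_ge_1) simp
  show ?thesis
  proof (cases "n < 2 ^ M")
    case True
    have *: "m * (2 * m + 1) \<le> 4 * 2 ^ m" for m :: nat
    proof (induction m rule: nat_less_induct)
      case (1 m)
      consider "m = 0" | "m = 1" | "m = 2" | "m = 3" | "4 \<le> m" by linarith
      then show ?case
      proof cases
        case 5
        then obtain k where k: "m = Suc k" "3 \<le> k" by (cases m) auto
        with 1 have "k * (2 * k + 1) \<le> 4 * 2 ^ k" by simp
        moreover have "4 * k + 3 \<le> k * (2 * k + 1)" using k mult_le_mono1[of 3 k "2 * k + 1"] by simp
        ultimately show ?thesis using k by (simp add: algebra_simps)
      qed auto
    qed
    have "real M * (2 * real M + 1) \<le> 4 * 2 ^ M"
      using *[of M] by (metis (mono_tags) of_nat_1 of_nat_add of_nat_le_iff of_nat_mult of_nat_numeral of_nat_power)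
    then have b: "(2 * real M + 1) / 2 ^ M \<le> 4 / real M" using M by (simp add: divide_simps mult.commute)
    have "logf ?N / ?N * (real n / logf (real n)) \<le> (2 * real M + 1) / ?N * (2 ^ M / 1)"
    proof (intro mult_mono divide_right_mono logf_4_power frac_le)
      show "real n \<le> 2 ^ M" using True by (metis less_imp_le of_nat_less_numeral_power_cancel_iff)
    qed (use f1 in auto)
    also have "\<dots> = (2 * real M + 1) / 2 ^ M"
    proof -
      have "(4::real) ^ M = 2 ^ M * 2 ^ M" by (simp flip: power_mult_distrib)
      then show ?thesis by simp
    qed
    also note b
    finally show ?thesis using N by (simp add: add.commute add_increasing2)
  next
    case False
    let ?t = "real n / ?N"
    have nN: "real n \<le> ?N" using n by (metis of_nat_le_iff)
    have "log 2 (2 ^ M) \<le> log 2 (real n + 1)"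
    proof (subst log_le_cancel_iff)
      have "real (2 ^ M) \<le> real n" using False by (simp only: of_nat_le_iff not_less)
      then show "2 ^ M \<le> real n + 1" by (simp only: of_nat_power of_nat_numeral add_increasing2)
    qed auto
    then have fM: "real M \<le> logf (real n)" by (simp add: logf_def)
    have "logf ?N - logf (real n) = log 2 ((?N + 1) / (real n + 1))"
      unfolding logf_def using add_pos_pos[OF N zero_less_one] by (subst log_divide) auto
    also have "\<dots> \<le> log 2 (?N / real n)"
    proof (subst log_le_cancel_iff)
      have "0 < ?N + 1" by (rule add_pos_pos[OF N zero_less_one])
      then show "0 < (?N + 1) / (real n + 1)" by simp
      have "(?N + 1) * real n \<le> ?N * (real n + 1)" using nN by (simp add: algebra_simps)
      then show "(?N + 1) / (real n + 1) \<le> ?N / real n" using n by (simp add: divide_simps)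
    qed (use n N in auto)
    also have "\<dots> = ln (?N / real n) / ln 2" by (simp add: log_def)
    also have "\<dots> \<le> (?N / real n - 1) / ln 2"
      using n by (intro divide_right_mono ln_le_minus_one) auto
    also have "\<dots> \<le> (?N / real n - 1) / (1 / 2)"
    proof (intro divide_left_mono)
      have "ln (1 / 2) \<le> 1 / 2 - (1::real)" by (intro ln_le_minus_one) simp
      then show "1 / 2 \<le> ln (2::real)" by (simp add: ln_div)
    qed (use nN n in auto)
    finally have "?t * (logf ?N - logf (real n)) \<le> ?t * ((?N / real n - 1) / (1 / 2))"
      by (intro mult_left_mono) auto
    also have "\<dots> = 2 * (1 - ?t)" using n by (simp add: field_simps)
    also have "\<dots> \<le> 2" by simp
    finally have "?t * (logf ?N - logf (real n)) \<le> 2" .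
    then have "?t * (logf ?N - logf (real n)) / logf (real n) \<le> 2 / logf (real n)"
      using f1 by (intro divide_right_mono) auto
    also have "\<dots> \<le> 4 / real M" using fM M f1 by (intro frac_le) auto
    finally show ?thesis using f1 by (simp add: diff_divide_distrib algebra_simps)
  qed
qed

section \<open>Finitely supported functionals\<close>

abbreviation coord :: "c00 \<Rightarrow> nat \<Rightarrow> real" where "coord \<equiv> Poly_Mapping.lookup"
abbreviation supp :: "c00 \<Rightarrow> nat set" where "supp \<equiv> Poly_Mapping.keys"

text \<open>The function \<open>c\<close> need not be finitely supported: functionals are applied to
  the sequence of values of a multiplier before that sequence is known to lie in
  \<open>c00\<close>.\<close>

definition ev :: "(nat \<Rightarrow> real) \<Rightarrow> c00 \<Rightarrow> real" where
  "ev c z = (\<Sum>n\<in>supp z. coord z n * c n)"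

lemma ev_superset: "finite A \<Longrightarrow> supp z \<subseteq> A \<Longrightarrow> ev c z = (\<Sum>n\<in>A. coord z n * c n)"
  unfolding ev_def by (rule sum.mono_neutral_left) (auto simp: in_keys_iff)

lemma ev_zero [simp]: "ev c 0 = 0"
  by (simp add: ev_def)

lemma ev_add: "ev c (z + w) = ev c z + ev c w"
proof -
  let ?A = "supp z \<union> supp w"
  have "ev c (z + w) = (\<Sum>n\<in>?A. coord (z + w) n * c n)"
    by (rule ev_superset) (auto dest: Poly_Mapping.keys_add[THEN subsetD])
  also have "\<dots> = ev c z + ev c w"
    by (simp add: ev_superset[of ?A] lookup_add algebra_simps sum.distrib)
  finally show ?thesis .
qed

lemma ev_scaleR: "ev c (a *\<^sub>R z) = a * ev c z"
proof -
  have "ev c (a *\<^sub>R z) = (\<Sum>n\<in>supp z. coord (a *\<^sub>R z) n * c n)"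
    by (rule ev_superset) (auto simp: in_keys_iff)
  then show ?thesis by (simp add: ev_def sum_distrib_left mult.assoc)
qed

lemma ev_uminus: "ev c (- z) = - ev c z"
  using ev_add[of c z "- z"] by simp

lemma ev_sum: "ev c (sum z I) = (\<Sum>i\<in>I. ev c (z i))"
  by (induction I rule: infinite_finite_induct) (auto simp: ev_add)

lemma ev_sum_list: "ev c (sum_list zs) = sum_list (map (ev c) zs)"
  by (induction zs) (auto simp: ev_add)

lemma ev_cong: "(\<And>n. n \<in> supp z \<Longrightarrow> c n = d n) \<Longrightarrow> ev c z = ev d z"
  by (simp add: ev_def)

lemma ev_fun_add: "ev (\<lambda>n. c n + d n) z = ev c z + ev d z"
  by (simp add: ev_def algebra_simps sum.distrib)

lemma ev_fun_scale: "ev (\<lambda>n. a * c n) z = a * ev c z"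
  by (simp add: ev_def sum_distrib_left mult_ac)

lemma ev_fun_sum: "ev (\<lambda>n. \<Sum>i\<in>I. c i n) z = (\<Sum>i\<in>I. ev (c i) z)"
  by (induction I rule: infinite_finite_induct) (auto simp: ev_fun_add ev_def[of "\<lambda>_. 0"])

lemma ev_single [simp]: "ev c (Poly_Mapping.single n a) = a * c n"
  by (cases "a = 0") (auto simp: ev_def)

lemma ev_proj: "ev c (proj E z) = ev (\<lambda>n. if n \<in> E then c n else 0) z"
proof -
  have "ev c (proj E z) = (\<Sum>n\<in>supp z. coord (proj E z) n * c n)"
    by (rule ev_superset) (auto simp: keys_proj)
  also have "\<dots> = ev (\<lambda>n. if n \<in> E then c n else 0) z"
    unfolding ev_def by (rule sum.cong) (auto simp: proj.rep_eq)
  finally show ?thesis .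
qed

lemma ev_coord_commute: "ev (coord x) z = ev (coord z) x"
proof -
  let ?A = "supp z \<union> supp x"
  have "ev (coord x) z = (\<Sum>n\<in>?A. coord z n * coord x n)" by (rule ev_superset) auto
  also have "\<dots> = ev (coord z) x" by (simp add: ev_superset[of ?A] mult.commute)
  finally show ?thesis .
qed

lemma pairing_eq_ev: "pairing z x = ev (coord x) z"
  by (subst ev_coord_commute) (simp add: pairing_def ev_def mult.commute)

lemma ev_coord_proj: "ev (coord (proj E x)) z = ev (coord x) (proj E z)"
  by (simp add: ev_proj proj.rep_eq)

lemma ev_coord_add: "ev (coord (x + y)) z = ev (coord x) z + ev (coord y) z"
  unfolding lookup_add[abs_def] by (rule ev_fun_add)

lemma ev_coord_scaleR: "ev (coord (a *\<^sub>R x)) z = a * ev (coord x) z"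
  by (simp add: ev_def sum_distrib_left mult_ac)

lemma lookup_sum_list: "coord (sum_list xs) n = sum_list (map (\<lambda>x. coord x n) xs)"
  by (induction xs) (auto simp: lookup_add)

lemma supp_less_disjoint: "supp_less z w \<Longrightarrow> supp z \<inter> supp w = {}"
  by (auto simp: supp_less_def set_less_def)

lemma supp_less_subset:
  "supp_less z w \<Longrightarrow> supp z' \<subseteq> supp z \<Longrightarrow> supp w' \<subseteq> supp w \<Longrightarrow> supp_less z' w'"
  by (auto simp: supp_less_def set_less_def)

lemma supp_sum_list: "supp (sum_list xs) \<subseteq> (\<Union>x\<in>set xs. supp x)"
proof (induction xs)
  case (Cons x xs)
  then show ?case using Poly_Mapping.keys_add[of x "sum_list xs"] by auto
qed simp

definition comb :: "real list \<Rightarrow> c00 list \<Rightarrow> c00" where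
  "comb \<gamma>s zs = (\<Sum>c<length zs. (\<gamma>s ! c) *\<^sub>R (zs ! c))"

lemma ev_comb: "ev f (comb \<gamma>s zs) = (\<Sum>c<length zs. \<gamma>s ! c * ev f (zs ! c))"
  by (simp add: comb_def ev_sum ev_scaleR)

lemma coord_comb: "coord (comb \<gamma>s zs) n = (\<Sum>c<length zs. \<gamma>s ! c * coord (zs ! c) n)"
  by (simp add: comb_def lookup_sum)

lemma proj_comb: "proj E (comb \<gamma>s zs) = comb \<gamma>s (map (proj E) zs)"
  by (rule poly_mapping_eqI) (auto simp: coord_comb proj.rep_eq)

lemma uminus_comb: "- comb \<gamma>s zs = comb \<gamma>s (map uminus zs)"
  by (rule poly_mapping_eqI) (auto simp: coord_comb lookup_uminus sum_negf)

lemma coord_comb_cases: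
  assumes "sorted_wrt supp_less zs"
  obtains "coord (comb \<gamma>s zs) n = 0" "\<And>c. c < length zs \<Longrightarrow> n \<notin> supp (zs ! c)"
  | c where "c < length zs" "n \<in> supp (zs ! c)" "coord (comb \<gamma>s zs) n = \<gamma>s ! c * coord (zs ! c) n"
      "\<And>c'. c' < length zs \<Longrightarrow> c' \<noteq> c \<Longrightarrow> n \<notin> supp (zs ! c')"
proof (cases "\<exists>c<length zs. n \<in> supp (zs ! c)")
  case False
  then show ?thesis by (intro that(1)) (auto simp: coord_comb in_keys_iff)
next
  case True
  then obtain c where c: "c < length zs" "n \<in> supp (zs ! c)" by blast
  have *: "n \<notin> supp (zs ! c')" if "c' < length zs" "c' \<noteq> c" for c'
  proof (cases "c' < c")
    case True
    then have "supp_less (zs ! c') (zs ! c)" using assms c by (simp add: sorted_wrt_iff_nth_less)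
    then show ?thesis using c supp_less_disjoint by blast
  next
    case False
    then have "supp_less (zs ! c) (zs ! c')" using assms that by (simp add: sorted_wrt_iff_nth_less)
    then show ?thesis using c supp_less_disjoint by blast
  qed
  have "coord (comb \<gamma>s zs) n = (\<Sum>d\<in>{c}. \<gamma>s ! d * coord (zs ! d) n)"
    unfolding coord_comb by (rule sum.mono_neutral_right) (use c * in \<open>auto simp: in_keys_iff\<close>)
  then show ?thesis using c * by (intro that(2)[of c]) auto
qed

lemma supp_comb:
  assumes "sorted_wrt supp_less zs" "\<And>c. c < length zs \<Longrightarrow> \<gamma>s ! c \<noteq> 0"
  shows "supp (comb \<gamma>s zs) = (\<Union>z\<in>set zs. supp z)"
proof (intro set_eqI)
  fix n show "n \<in> supp (comb \<gamma>s zs) \<longleftrightarrow> n \<in> (\<Union>z\<in>set zs. supp z)"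
    by (rule coord_comb_cases[OF assms(1), of \<gamma>s n])
       (use assms(2) in \<open>auto simp: in_keys_iff set_conv_nth\<close>)
qed

lemma sum_abs_coord_comb_le:
  assumes "sorted_wrt supp_less zs" "finite A" "\<And>c. c < length zs \<Longrightarrow> 0 \<le> \<gamma>s ! c"
  shows "(\<Sum>n\<in>A. \<bar>coord (comb \<gamma>s zs) n\<bar>)
    \<le> (\<Sum>c<length zs. \<gamma>s ! c * (\<Sum>n\<in>A \<inter> supp (zs ! c). \<bar>coord (zs ! c) n\<bar>))"
proof -
  have "(\<Sum>n\<in>A. \<bar>coord (comb \<gamma>s zs) n\<bar>) \<le> (\<Sum>n\<in>A. \<Sum>c<length zs. \<gamma>s ! c * \<bar>coord (zs ! c) n\<bar>)"
    unfolding coord_comb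
    by (intro sum_mono order_trans[OF sum_abs]) (auto simp: abs_mult assms(3))
  also have "\<dots> = (\<Sum>c<length zs. \<gamma>s ! c * (\<Sum>n\<in>A. \<bar>coord (zs ! c) n\<bar>))"
    by (subst sum.swap) (simp add: sum_distrib_left)
  also have "\<dots> = (\<Sum>c<length zs. \<gamma>s ! c * (\<Sum>n\<in>A \<inter> supp (zs ! c). \<bar>coord (zs ! c) n\<bar>))"
    by (intro sum.cong refl arg_cong2[of _ _ _ _ "(*)"] sum.mono_neutral_right)
       (use assms(2) in \<open>auto simp: in_keys_iff\<close>)
  finally show ?thesis .
qed

lemma sum_card_Int_supp_le:
  assumes "sorted_wrt supp_less zs" "finite A"
  shows "(\<Sum>c<length zs. card (A \<inter> supp (zs ! c))) \<le> card A"
proof -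
  have "(\<Sum>c<length zs. card (A \<inter> supp (zs ! c))) = card (\<Union>c<length zs. A \<inter> supp (zs ! c))"
  proof (rule card_UN_disjoint[symmetric])
    show "\<forall>i\<in>{..<length zs}. \<forall>j\<in>{..<length zs}. i \<noteq> j \<longrightarrow>
        (A \<inter> supp (zs ! i)) \<inter> (A \<inter> supp (zs ! j)) = {}"
    proof (intro ballI impI)
      fix i j assume ij: "i \<in> {..<length zs}" "j \<in> {..<length zs}" "i \<noteq> j"
      then consider "i < j" | "j < i" by linarith
      then have "supp (zs ! i) \<inter> supp (zs ! j) = {}"
      proof cases
        case 1
        then have "supp_less (zs ! i) (zs ! j)" using assms ij by (simp add: sorted_wrt_iff_nth_less)
        then show ?thesis by (rule supp_less_disjoint)
      next
        case 2
        then have "supp_less (zs ! j) (zs ! i)" using assms ij by (simp add: sorted_wrt_iff_nth_less)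
        then show ?thesis using supp_less_disjoint by blast
      qed
      then show "(A \<inter> supp (zs ! i)) \<inter> (A \<inter> supp (zs ! j)) = {}" by blast
    qed
  qed (use assms(2) in auto)
  also have "\<dots> \<le> card A" by (rule card_mono) (use assms(2) in auto)
  finally show ?thesis .
qed

text \<open>The blocks are fixed before \<open>h\<close> is chosen, so that one decomposition serves
  all quantities summed along it. Vector values of \<open>h\<close> allow the identity to be used
  for functionals themselves as well as for their values.\<close>

lemma sum_block_weights:
  fixes zs :: "'b list"
  assumes "length zs = sum_list ms"
  obtains zss where "zs = concat zss" "map length zss = ms"
    "\<And>h :: 'b \<Rightarrow> 'a::real_vector.
      (\<Sum>c<length zs. (concat (map (\<lambda>m. replicate m (w m)) ms) ! c) *\<^sub>R h (zs ! c))
        = (\<Sum>ys\<leftarrow>zss. w (length ys) *\<^sub>R (\<Sum>y\<leftarrow>ys. h y))"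
proof -
  have "\<exists>zss. zs = concat zss \<and> map length zss = ms \<and> (\<forall>h :: 'b \<Rightarrow> 'a.
      (\<Sum>c<length zs. (concat (map (\<lambda>m. replicate m (w m)) ms) ! c) *\<^sub>R h (zs ! c))
        = (\<Sum>ys\<leftarrow>zss. w (length ys) *\<^sub>R (\<Sum>y\<leftarrow>ys. h y)))"
    using assms
  proof (induction ms arbitrary: zs)
    case (Cons m ms)
    let ?ys = "take m zs" and ?zs = "drop m zs"
    let ?w = "concat (map (\<lambda>m. replicate m (w m)) ms)"
    from Cons.prems have len: "length zs = m + sum_list ms" by simp
    then have "length ?zs = sum_list ms" by simp
    from Cons.IH[OF this] obtain zss where zss: "?zs = concat zss" "map length zss = ms"
      and h: "\<And>h :: 'b \<Rightarrow> 'a. (\<Sum>c<length ?zs. (?w ! c) *\<^sub>R h (?zs ! c))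
        = (\<Sum>ys\<leftarrow>zss. w (length ys) *\<^sub>R (\<Sum>y\<leftarrow>ys. h y))" by blast
    have ly: "length ?ys = m" using len by simp
    have "(\<Sum>c<length zs. ((replicate m (w m) @ ?w) ! c) *\<^sub>R h (zs ! c))
        = (\<Sum>ys\<leftarrow>?ys # zss. w (length ys) *\<^sub>R (\<Sum>y\<leftarrow>ys. h y))" for h :: "'b \<Rightarrow> 'a"
    proof -
      let ?g = "\<lambda>c. ((replicate m (w m) @ ?w) ! c) *\<^sub>R h (zs ! c)"
      have "sum ?g {..<length zs} = sum ?g {..<m} + sum ?g {m..<m + length ?zs}"
        using len sum.atLeastLessThan_concat[of 0 m "length zs" ?g] by (simp add: atLeast0LessThan)
      also have "sum ?g {m..<m + length ?zs} = (\<Sum>c<length ?zs. ?g (m + c))"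
        using sum.shift_bounds_nat_ivl[of ?g 0 m "length ?zs"]
        by (simp add: atLeast0LessThan add.commute)
      also have "\<dots> = (\<Sum>c<length ?zs. (?w ! c) *\<^sub>R h (?zs ! c))"
        using len by (intro sum.cong) (auto simp: nth_append add.commute)
      also have "sum ?g {..<m} = w m *\<^sub>R (\<Sum>y\<leftarrow>?ys. h y)"
        using len by (simp add: nth_append sum_list_sum_nth scaleR_sum_right atLeast0LessThan)
      finally show ?thesis using ly h by simp
    qed
    moreover have "zs = ?ys @ concat zss" using zss(1) append_take_drop_id[of m zs] by simp
    ultimately show ?case using zss(2) ly by (intro exI[of _ "?ys # zss"]) (simp del: append_take_drop_id)
  qed (auto intro: exI[of _ "[]"])
  then show ?thesis using that by blast
qed

section \<open>A larger norm with explicit functionals\<close>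

text \<open>The gap is stated so that the square root of \<open>logf m\<close> still dominates the
  fourth power of \<open>4 ^ (n ^ 4)\<close>, the block length that will be attached to
  \<open>n\<close>.\<close>

locale lacunary =
  fixes L :: "nat set"
  assumes infinite_L: "infinite L"
    and L_large: "m \<in> L \<Longrightarrow> 256 \<le> logf (real m)"
    and L_gap: "n \<in> L \<Longrightarrow> m \<in> L \<Longrightarrow> n < m \<Longrightarrow> 2 ^ (16 * n ^ 4) \<le> logf (real m)"
begin

lemma L_ge: "m \<in> L \<Longrightarrow> 256 \<le> m"
  using L_large[of m] logf_le_of_nat[of m] by linarith

lemma L_quadruple: assumes "n \<in> L" "m \<in> L" "n < m" shows "4 * logf (real n) \<le> logf (real m)"
proof -
  have n: "256 \<le> n" using L_ge assms by simp
  have "4 * logf (real n) \<le> 4 * real n" using logf_le_of_nat by simp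
  also have "4 * real n \<le> 4 * 2 ^ n" by (simp add: less_imp_le)
  also have "\<dots> = 2 ^ (n + 2)" by simp
  also have "(2::real) ^ (n + 2) \<le> 2 ^ (16 * n ^ 4)"
  proof (rule power_increasing)
    have "n \<le> n ^ 4" using n by (simp add: self_le_power)
    then show "n + 2 \<le> 16 * n ^ 4" using n by linarith
  qed simp
  also have "\<dots> \<le> logf (real m)" by (rule L_gap[OF assms])
  finally show ?thesis .
qed

text \<open>Since \<open>logf\<close> at least quadruples from one element of \<open>L\<close> to
  the next, the terms decay like a geometric series of ratio \<open>1 / 2\<close>. The sum is at
  most twice its largest term, which is at most \<open>1 / sqrt 256 = 1 / 16\<close>.\<close>

lemma sum_inverse_sqrt_logf:
  assumes "finite M" "M \<subseteq> L" shows "(\<Sum>m\<in>M. 1 / sqrt (logf (real m))) \<le> 1 / 8"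
proof -
  have "M = {} \<or> (\<Sum>m\<in>M. 1 / sqrt (logf (real m))) \<le> 2 / sqrt (logf (real (Min M)))"
    using assms
  proof (induction M rule: finite_linorder_min_induct)
    case (insert b A)
    show ?case
    proof (cases "A = {}")
      case False
      then have A: "(\<Sum>m\<in>A. 1 / sqrt (logf (real m))) \<le> 2 / sqrt (logf (real (Min A)))"
        using insert by auto
      have minA: "Min A \<in> A" using False insert by auto
      then have "4 * logf (real b) \<le> logf (real (Min A))"
        using insert by (intro L_quadruple) auto
      then have "sqrt (4 * logf (real b)) \<le> sqrt (logf (real (Min A)))" by simp
      then have "2 * sqrt (logf (real b)) \<le> sqrt (logf (real (Min A)))" by (simp add: real_sqrt_mult)
      moreover have b: "0 < sqrt (logf (real b))" using L_large[of b] insert by auto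
      moreover have "0 < logf (real (Min A))" using L_large[of "Min A"] minA insert by auto
      ultimately have "2 / sqrt (logf (real (Min A))) \<le> 2 / (2 * sqrt (logf (real b)))"
        by (intro divide_left_mono mult_pos_pos) auto
      with A have "(\<Sum>m\<in>A. 1 / sqrt (logf (real m))) \<le> 1 / sqrt (logf (real b))" by simp
      moreover have "Min (insert b A) = b" using insert False by (subst Min_insert) (auto simp: min_def dest: less_imp_le)
      moreover have "b \<notin> A" using insert by blast
      ultimately show ?thesis using insert by simp
    next
      case True
      then show ?thesis using L_large[of b] insert by (simp add: divide_right_mono)
    qed
  qed simp
  moreover have "2 / sqrt (logf (real (Min M))) \<le> 1 / 8" if "M \<noteq> {}"
  proof -
    have l: "256 \<le> logf (real (Min M))"
      using that assms by (intro L_large) (auto dest: Min_in)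
    then have "sqrt 256 \<le> sqrt (logf (real (Min M)))" by (rule real_sqrt_le_mono)
    moreover have "sqrt 256 = (16::real)" by (rule real_sqrt_unique) auto
    ultimately have "2 / sqrt (logf (real (Min M))) \<le> 2 / 16" using l by (intro divide_left_mono) auto
    then show ?thesis by simp
  qed
  ultimately show ?thesis by (cases "M = {}") auto
qed

definition lengths_ok :: "nat list \<Rightarrow> bool" where
  "lengths_ok ms \<longleftrightarrow> set ms \<subseteq> L \<and> (\<forall>m. count_list ms m \<le> 2)"

text \<open>Every length occurs at most twice, which doubles the bound \<open>1 / 8\<close>. This is
  the sense in which a loss of a square root of \<open>logf m\<close> can be afforded.\<close>

lemma sum_list_lengths_ok:
  fixes g :: "nat \<Rightarrow> real"
  assumes "lengths_ok ms" "\<And>m. m \<in> L \<Longrightarrow> 0 \<le> g m" "\<And>m. m \<in> L \<Longrightarrow> g m \<le> C / sqrt (logf (real m))" "0 \<le> C"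
  shows "(\<Sum>m\<leftarrow>ms. g m) \<le> C / 4"
proof -
  have ms: "set ms \<subseteq> L" "\<And>m. count_list ms m \<le> 2" using assms(1) by (auto simp: lengths_ok_def)
  have "(\<Sum>m\<leftarrow>ms. g m) = (\<Sum>m\<in>set ms. real (count_list ms m) * g m)"
  proof (induction ms)
    case (Cons a ms)
    have "(\<Sum>m\<in>set (a # ms). real (count_list (a # ms) m) * g m)
        = (\<Sum>m\<in>insert a (set ms). real (count_list ms m) * g m + (if m = a then g a else 0))"
      by (intro sum.cong) (auto simp: algebra_simps)
    also have "\<dots> = (\<Sum>m\<in>insert a (set ms). real (count_list ms m) * g m) + g a"
      by (simp add: sum.distrib)
    also have "(\<Sum>m\<in>insert a (set ms). real (count_list ms m) * g m) = (\<Sum>m\<in>set ms. real (count_list ms m) * g m)"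
      by (rule sum.mono_neutral_right) (auto simp: count_list_0_iff)
    finally show ?case using Cons by simp
  qed simp
  also have "\<dots> \<le> (\<Sum>m\<in>set ms. 2 * (C / sqrt (logf (real m))))"
    using ms assms by (intro sum_mono mult_mono) (auto simp: subset_iff)
  also have "\<dots> = 2 * C * (\<Sum>m\<in>set ms. 1 / sqrt (logf (real m)))"
    by (simp add: sum_distrib_left)
  also have "\<dots> \<le> 2 * C * (1 / 8)"
    using assms(4) ms by (intro mult_left_mono sum_inverse_sqrt_logf) auto
  finally show ?thesis by simp
qed

lemma lengths_ok_filter: "lengths_ok ms \<Longrightarrow> lengths_ok (filter P ms)"
proof -
  have "count_list (filter P ms) m \<le> count_list ms m" for m by (induction ms) auto
  then show "lengths_ok ms \<Longrightarrow> lengths_ok (filter P ms)"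
    unfolding lengths_ok_def by (auto intro: order_trans)
qed

text \<open>Each counted length contributes 1, which is at most
  \<open>sqrt (logf x) / sqrt (logf m)\<close>; these numbers are summable by the previous
  estimate.\<close>

lemma length_light_le:
  assumes "lengths_ok ms" "1 \<le> x"
  shows "real (length (filter (\<lambda>m. real m \<le> x) ms)) \<le> sqrt (logf x) / 4"
proof -
  let ?ms = "filter (\<lambda>m. real m \<le> x) ms"
  have s: "0 < sqrt (logf x)" using logf_ge_1[OF assms(2)] by simp
  have "real (length ?ms) = (\<Sum>m\<leftarrow>?ms. 1)" by (simp add: sum_list_triv)
  also have "(\<Sum>m\<leftarrow>?ms. 1) \<le> (\<Sum>m\<leftarrow>?ms. sqrt (logf x) / sqrt (logf (real m)))"
  proof (rule sum_list_mono)
    fix m assume "m \<in> set ?ms"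
    then have m: "m \<in> L" "real m \<le> x" using assms by (auto simp: lengths_ok_def)
    have "0 < sqrt (logf (real m))" using L_large[OF m(1)] by simp
    moreover have "sqrt (logf (real m)) \<le> sqrt (logf x)" using m by (intro real_sqrt_le_mono logf_mono) auto
    ultimately show "1 \<le> sqrt (logf x) / sqrt (logf (real m))" by simp
  qed
  also have "\<dots> \<le> sqrt (logf x) / 4"
    by (rule sum_list_lengths_ok)
      (use assms s lengths_ok_filter in \<open>auto intro!: divide_nonneg_nonneg logf_nonneg\<close>)
  finally show ?thesis .
qed

text \<open>
  The second alternative relaxes the special functionals of \<open>GM\<close>: as \<open>\<sigma>\<close> is injective, a length can
  repeat only that of the first block, and \<open>4 / 5 \<ge> 1 / sqrt (f(l))\<close> for \<open>l \<ge> 2\<close>. The dependence of a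
  length on the preceding blocks is dropped.
\<close>

definition adm :: "real list \<Rightarrow> bool" where
  "adm \<gamma>s \<longleftrightarrow> (\<exists>q\<ge>1. \<gamma>s = replicate q (1 / logf (real q))) \<or>
     (\<exists>ms. lengths_ok ms \<and> \<gamma>s = concat (map (\<lambda>m. replicate m (4 / 5 / logf (real m))) ms))"

text \<open>Form (1) of the definition of \<open>GM\<close> and the restrictions to intervals have
  no clause of their own: both preserve domination by \<open>NK\<close>, and this is what the
  comparison with \<open>GM\<close> asks for.\<close>

inductive_set K :: "c00 set" where
  leaf: "\<bar>a\<bar> \<le> 1 \<Longrightarrow> Poly_Mapping.single n a \<in> K"
| node: "adm \<gamma>s \<Longrightarrow> length zs = length \<gamma>s \<Longrightarrow> sorted_wrt supp_less zs \<Longrightarrow> (\<forall>z\<in>set zs. z \<in> K) \<Longrightarrow> comb \<gamma>s zs \<in> K"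

lemma adm_weight:
  assumes "adm \<gamma>s" "c < length \<gamma>s" shows "0 < \<gamma>s ! c" "\<gamma>s ! c \<le> 1"
proof -
  have "\<gamma>s ! c \<in> set \<gamma>s" using assms by simp
  moreover have "0 < \<gamma> \<and> \<gamma> \<le> 1" if g: "\<gamma> \<in> set \<gamma>s" for \<gamma>
    using assms(1) unfolding adm_def
  proof (elim disjE exE conjE)
    fix q :: nat assume "1 \<le> q" "\<gamma>s = replicate q (1 / logf (real q))"
    then show ?thesis using that logf_ge_1[of "real q"] by auto
  next
    fix ms assume "lengths_ok ms" "\<gamma>s = concat (map (\<lambda>m. replicate m (4 / 5 / logf (real m))) ms)"
    then obtain m where "m \<in> L" "\<gamma> = 4 / 5 / logf (real m)" using g by (auto simp: lengths_ok_def subset_iff simp del: divide_divide_eq_left)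
    then show ?thesis using L_large[of m] by (auto simp: divide_le_eq)
  qed
  ultimately show "0 < \<gamma>s ! c" "\<gamma>s ! c \<le> 1" by auto
qed

lemma abs_coord_K_le: "z \<in> K \<Longrightarrow> \<bar>coord z n\<bar> \<le> 1"
proof (induction rule: K.induct)
  case (leaf a m)
  then show ?case by (simp add: lookup_single when_def)
next
  case (node \<gamma>s zs)
  show ?case
  proof (rule coord_comb_cases[OF node(3), of \<gamma>s n])
    fix c assume c: "c < length zs" "coord (comb \<gamma>s zs) n = \<gamma>s ! c * coord (zs ! c) n"
    have "\<bar>\<gamma>s ! c * coord (zs ! c) n\<bar> \<le> 1 * 1"
      unfolding abs_mult using adm_weight[OF node(1), of c] c node by (intro mult_mono) auto
    then show ?thesis using c by simp
  qed auto
qed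

lemma zero_in_K: "0 \<in> K"
  using leaf[of 0 0] by simp

text \<open>Admissibility reads only the number of functionals, and those that become zero stay in
  the list, so the weights are unchanged. Here \<open>E\<close> is arbitrary: with lengths that no
  longer depend on the preceding blocks, restriction to sets that are not intervals causes no
  damage.\<close>

lemma proj_in_K: "z \<in> K \<Longrightarrow> proj E z \<in> K"
proof (induction rule: K.induct)
  case (leaf a n)
  have "proj E (Poly_Mapping.single n a) = Poly_Mapping.single n (if n \<in> E then a else 0)"
    by (rule poly_mapping_eqI) (auto simp: proj.rep_eq lookup_single when_def)
  then show ?case using leaf by (simp add: K.leaf)
next
  case (node \<gamma>s zs)
  have "sorted_wrt supp_less (map (proj E) zs)"
    unfolding sorted_wrt_map
    by (rule sorted_wrt_mono_rel[OF _ node(3)]) (auto intro: supp_less_subset simp: keys_proj)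
  then show ?case unfolding proj_comb using node by (intro K.node) auto
qed

lemma uminus_in_K: "z \<in> K \<Longrightarrow> - z \<in> K"
proof (induction rule: K.induct)
  case (leaf a n)
  have "- Poly_Mapping.single n a = Poly_Mapping.single n (- a)"
    by (rule poly_mapping_eqI) (auto simp: lookup_single when_def)
  then show ?case using leaf by (simp add: K.leaf)
next
  case (node \<gamma>s zs)
  have *: "supp (- z) = supp z" for z :: c00 by (auto simp: in_keys_iff)
  have "sorted_wrt supp_less (map uminus zs)"
    unfolding sorted_wrt_map
    by (rule sorted_wrt_mono_rel[OF _ node(3)]) (auto intro: supp_less_subset simp: *)
  then show ?case unfolding uminus_comb using node by (intro K.node) auto
qed

definition NK :: "c00 \<Rightarrow> real" where
  "NK x = (SUP z\<in>K. ev (coord x) z)"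

lemma ev_K_le_norm: assumes "z \<in> K" shows "ev (coord x) z \<le> norm x"
proof -
  have "ev (coord x) z = ev (coord z) x" by (rule ev_coord_commute)
  also have "\<dots> \<le> (\<Sum>i\<in>supp x. \<bar>coord x i\<bar>)"
    unfolding ev_def
  proof (rule sum_mono)
    fix i
    have "coord x i * coord z i \<le> \<bar>coord x i\<bar> * \<bar>coord z i\<bar>" by (simp flip: abs_mult)
    also have "\<dots> \<le> \<bar>coord x i\<bar> * 1" by (intro mult_left_mono abs_coord_K_le assms) simp
    finally show "coord x i * coord z i \<le> \<bar>coord x i\<bar>" by simp
  qed
  finally show ?thesis by (simp add: norm_c00)
qed

lemma NK_upper: "z \<in> K \<Longrightarrow> ev (coord x) z \<le> NK x"
  unfolding NK_def by (rule cSUP_upper) (auto intro!: bdd_aboveI2 ev_K_le_norm)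

lemma NK_least: "(\<And>z. z \<in> K \<Longrightarrow> ev (coord x) z \<le> b) \<Longrightarrow> NK x \<le> b"
  unfolding NK_def by (rule cSUP_least) (use zero_in_K in auto)

lemma NK_nonneg: "0 \<le> NK x"
  using NK_upper[OF zero_in_K, of x] by simp

lemma NK_le_norm: "NK x \<le> norm x"
  by (rule NK_least) (rule ev_K_le_norm)

lemma NK_zero [simp]: "NK 0 = 0"
  using NK_le_norm[of 0] NK_nonneg[of 0] by simp

lemma NK_add: "NK (x + y) \<le> NK x + NK y"
  by (rule NK_least) (auto simp: ev_coord_add intro!: add_mono NK_upper)

lemma NK_scaleR_nonneg: assumes "0 \<le> a" shows "NK (a *\<^sub>R x) \<le> a * NK x"
  by (rule NK_least) (use assms in \<open>auto simp: ev_coord_scaleR intro!: mult_left_mono NK_upper\<close>)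

lemma NK_uminus: "NK (- x) \<le> NK x"
proof (rule NK_least)
  fix z assume z: "z \<in> K"
  have "ev (coord (- x)) z = ev (coord x) (- z)"
    using ev_coord_add[of x "- x" z] by (simp add: ev_uminus ev_def)
  then show "ev (coord (- x)) z \<le> NK x" using NK_upper[OF uminus_in_K[OF z]] by simp
qed

lemma coord_le_NK: "\<bar>coord x n\<bar> \<le> NK x"
  using NK_upper[OF leaf[of 1 n], of x] NK_upper[OF leaf[of "-1" n], of x] by simp

text \<open>Nearly optimal functionals for the vectors, cut down to their supports, form an
  admissible combination. This inequality transfers to \<open>NK\<close> the defining properties of
  the norms of \<open>GM\<close> and \<open>S\<close>, and it carries the induction on collapsed
  vectors.\<close>

lemma NK_adm:
  assumes "adm \<gamma>s" "length xs = length \<gamma>s" "sorted_wrt supp_less xs"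
  shows "(\<Sum>c<length xs. \<gamma>s ! c * NK (xs ! c)) \<le> NK (sum_list xs)"
proof (rule field_le_epsilon)
  fix e :: real assume e: "0 < e"
  define d where "d = e / (real (length xs) + 1)"
  have d: "0 < d" using e by (simp add: d_def add_nonneg_pos)
  have "\<exists>z\<in>K. NK x - d < ev (coord x) z" for x
  proof (rule ccontr)
    assume "\<not> ?thesis"
    then have "NK x \<le> NK x - d" by (intro NK_least) (auto simp: not_less)
    then show False using d by simp
  qed
  then obtain Z where Z: "\<And>x. Z x \<in> K" "\<And>x. NK x - d < ev (coord x) (Z x)" by metis
  define zs where "zs = map (\<lambda>x. proj (supp x) (Z x)) xs"
  have zK: "comb \<gamma>s zs \<in> K"
  proof (rule node[OF assms(1)])
    show "sorted_wrt supp_less zs"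
      unfolding zs_def sorted_wrt_map
      by (rule sorted_wrt_mono_rel[OF _ assms(3)]) (auto intro: supp_less_subset simp: keys_proj)
  qed (auto simp: zs_def assms Z proj_in_K)
  have ev: "ev (coord (sum_list xs)) (zs ! c) = ev (coord (xs ! c)) (Z (xs ! c))" if c: "c < length xs" for c
  proof -
    have "coord (sum_list xs) n = coord (xs ! c) n" if "n \<in> supp (xs ! c)" for n
    proof -
      have "sum_list xs = comb (replicate (length xs) 1) xs"
        by (simp add: comb_def sum_list_sum_nth atLeast0LessThan)
      moreover have "coord (comb (replicate (length xs) 1) xs) n = coord (xs ! c) n"
      proof (rule coord_comb_cases[OF assms(3), of "replicate (length xs) 1" n])
        fix c' assume c': "c' < length xs" "coord (comb (replicate (length xs) 1) xs) n
            = replicate (length xs) 1 ! c' * coord (xs ! c') n"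
          and uniq: "\<And>d. d < length xs \<Longrightarrow> d \<noteq> c' \<Longrightarrow> n \<notin> supp (xs ! d)"
        have "c' = c" using uniq[OF c] that by blast
        then show ?thesis using c' by simp
      qed (use c that in blast)
      ultimately show ?thesis by simp
    qed
    then have "ev (coord (sum_list xs)) (zs ! c) = ev (coord (xs ! c)) (zs ! c)"
      using c by (intro ev_cong) (auto simp: zs_def keys_proj)
    also have "\<dots> = ev (coord (xs ! c)) (Z (xs ! c))"
      using c by (simp add: zs_def flip: ev_coord_proj) (simp add: proj_eq_self)
    finally show ?thesis .
  qed
  have "(\<Sum>c<length xs. \<gamma>s ! c * NK (xs ! c)) \<le> (\<Sum>c<length xs. \<gamma>s ! c * ev (coord (sum_list xs)) (zs ! c) + d)"
  proof (rule sum_mono)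
    fix c assume "c \<in> {..<length xs}"
    then have c: "c < length xs" "c < length \<gamma>s" using assms by auto
    have "\<gamma>s ! c * NK (xs ! c) \<le> \<gamma>s ! c * (ev (coord (xs ! c)) (Z (xs ! c)) + d)"
      using adm_weight[OF assms(1) c(2)] Z(2)[of "xs ! c"] by (intro mult_left_mono) auto
    also have "\<dots> \<le> \<gamma>s ! c * ev (coord (xs ! c)) (Z (xs ! c)) + 1 * d"
      using mult_right_mono[OF adm_weight(2)[OF assms(1) c(2)], of d] d by (simp add: distrib_left)
    finally show "\<gamma>s ! c * NK (xs ! c) \<le> \<gamma>s ! c * ev (coord (sum_list xs)) (zs ! c) + d"
      using ev[OF c(1)] by simp
  qed
  also have "\<dots> = ev (coord (sum_list xs)) (comb \<gamma>s zs) + real (length xs) * d"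
    by (simp add: ev_comb sum.distrib zs_def)
  also have "\<dots> \<le> NK (sum_list xs) + e"
  proof (rule add_mono[OF NK_upper[OF zK]])
    show "real (length xs) * d \<le> e" using e by (simp add: d_def divide_le_eq mult.commute)
  qed
  finally show "(\<Sum>c<length xs. \<gamma>s ! c * NK (xs ! c)) \<le> NK (sum_list xs) + e" .
qed

lemma adm_replicate: "1 \<le> q \<Longrightarrow> adm (replicate q (1 / logf (real q)))"
  by (auto simp: adm_def)

end

context lacunary
begin

lemma comb_adm_cases:
  assumes "adm \<gamma>s" "length zs = length \<gamma>s"
  obtains (average) q where "1 \<le> q" "length zs = q" "\<gamma>s = replicate q (1 / logf (real q))"
  | (blocks) zss where "zs = concat zss" "lengths_ok (map length zss)"
      "\<And>h :: c00 \<Rightarrow> real. (\<Sum>c<length zs. \<gamma>s ! c * h (zs ! c))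
        = (\<Sum>ys\<leftarrow>zss. 4 / 5 / logf (real (length ys)) * (\<Sum>y\<leftarrow>ys. h y))"
  using assms(1) unfolding adm_def
proof (elim disjE exE conjE)
  fix q :: nat assume "1 \<le> q" "\<gamma>s = replicate q (1 / logf (real q))"
  then show thesis using assms(2) by (intro average[of q]) auto
next
  fix ms assume ms: "lengths_ok ms" "\<gamma>s = concat (map (\<lambda>m. replicate m (4 / 5 / logf (real m))) ms)"
  have "length zs = sum_list ms" using ms assms(2) by (simp add: length_concat comp_def)
  from sum_block_weights[where 'a = real, OF this, of "\<lambda>m. 4 / 5 / logf (real m)"]
  obtain zss where zss: "zs = concat zss" "map length zss = ms"
    "\<And>h :: c00 \<Rightarrow> real.
      (\<Sum>c<length zs. (concat (map (\<lambda>m. replicate m (4 / 5 / logf (real m))) ms) ! c) *\<^sub>R h (zs ! c))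
        = (\<Sum>ys\<leftarrow>zss. (4 / 5 / logf (real (length ys))) *\<^sub>R (\<Sum>y\<leftarrow>ys. h y))" by blast
  show thesis
  proof (rule blocks[of zss])
    show "lengths_ok (map length zss)" using zss ms by simp
    show "(\<Sum>c<length zs. \<gamma>s ! c * h (zs ! c))
        = (\<Sum>ys\<leftarrow>zss. 4 / 5 / logf (real (length ys)) * (\<Sum>y\<leftarrow>ys. h y))" for h
      using zss(3)[of h] ms by simp
  qed (rule zss)
qed

section \<open>Coordinate sums of norming functionals\<close>

lemma block_count_le:
  assumes ok: "lengths_ok (map length zss)" and n: "1 \<le> n"
  shows "real (length (filter (\<lambda>ys. length ys \<le> n) zss)) \<le> sqrt (logf (real n)) / 4"
proof -
  have "filter (\<lambda>m. real m \<le> real n) (map length zss) = map length (filter (\<lambda>ys. length ys \<le> n) zss)"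
    by (simp add: filter_map comp_def)
  then show ?thesis using length_light_le[OF ok, of "real n"] n by (metis length_map of_nat_1 of_nat_le_iff)
qed

text \<open>
  A block of length \<open>m > n\<close> has coefficients at most \<open>1 / f(n)\<close>. The few remaining blocks either contain
  a proportion of the \<open>n\<close> coordinates so large that Jensen's inequality loses only a factor \<open>9 / 8\<close>, or
  contribute little in total; the factor \<open>4 / 5\<close> absorbs both losses.
\<close>

lemma K_flat:
  "z \<in> K \<Longrightarrow> finite A \<Longrightarrow> (\<Sum>n\<in>A. \<bar>coord z n\<bar>) \<le> real (card A) / logf (real (card A))"
proof (induction arbitrary: A rule: K.induct)
  case (leaf a m)
  show ?case
  proof (cases "A = {}")
    case False
    then have A: "1 \<le> card A" using leaf by (simp add: Suc_le_eq card_gt_0_iff)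
    have "(\<Sum>n\<in>A. \<bar>coord (Poly_Mapping.single m a) n\<bar>) = (\<Sum>n\<in>A. if n = m then \<bar>a\<bar> else 0)"
      by (rule sum.cong) (auto simp: lookup_single when_def)
    also have "\<dots> \<le> 1" using leaf by simp
    also have "1 \<le> real (card A) / logf (real (card A))"
      using A logf_le_of_nat[of "card A"] logf_pos[of "real (card A)"] by simp
    finally show ?thesis .
  qed simp
next
  case (node \<gamma>s zs)
  let ?k = "\<lambda>z. card (A \<inter> supp z)" and ?n = "card A"
  let ?h = "\<lambda>z. real (?k z) / logf (real (?k z))"
  have hn: "0 \<le> ?h z" for z by (simp add: logf_nonneg)
  have w: "0 \<le> \<gamma>s ! c" if "c < length zs" for c using adm_weight[OF node(1), of c] that node(2) by simp
  have "(\<Sum>n\<in>A. \<bar>coord (comb \<gamma>s zs) n\<bar>)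
      \<le> (\<Sum>c<length zs. \<gamma>s ! c * (\<Sum>n\<in>A \<inter> supp (zs ! c). \<bar>coord (zs ! c) n\<bar>))"
    by (rule sum_abs_coord_comb_le[OF node(3,5) w])
  also have "\<dots> \<le> (\<Sum>c<length zs. \<gamma>s ! c * ?h (zs ! c))"
    using node(4,5) w by (intro sum_mono mult_left_mono) auto
  also have "\<dots> \<le> real ?n / logf (real ?n)"
    using node(1,2)
  proof (cases rule: comb_adm_cases)
    case (average q)
    have "(\<Sum>c<length zs. \<gamma>s ! c * ?h (zs ! c)) = (\<Sum>c<q. ?h (zs ! c)) / logf (real q)"
      using average by (simp add: sum_divide_distrib mult.commute)
    also have "\<dots> \<le> real (\<Sum>c<q. ?k (zs ! c)) / logf (real (\<Sum>c<q. ?k (zs ! c)))"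
      using average by (intro sum_divide_logf_le_nat) auto
    also have "\<dots> \<le> real ?n / logf (real ?n)"
      using average sum_card_Int_supp_le[OF node(3,5)] by (intro divide_logf_mono_nat) auto
    finally show ?thesis .
  next
    case (blocks zss)
    let ?F = "logf (real ?n)"
    show ?thesis
    proof (cases "?n = 0")
      case True
      then have "?k z = 0" for z using node(5) by auto
      then show ?thesis using blocks by (simp add: logf_nonneg)
    next
      case False
      then have n1: "1 \<le> ?n" by simp
      have F: "1 \<le> ?F" using n1 by (intro logf_ge_1) simp
      let ?K = "\<lambda>ys. \<Sum>y\<leftarrow>ys. ?k y"
      let ?T = "\<lambda>ys. 1 / logf (real (length ys)) * (\<Sum>y\<leftarrow>ys. ?h y)"
      let ?light = "\<lambda>ys. length ys \<le> ?n"
      have lenL: "length ys \<in> L" if "ys \<in> set zss" for ys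
        using blocks(2) that by (auto simp: lengths_ok_def)
      have T: "?T ys \<le> 9 / 8 * (real (?K ys) / ?F) + (if ?light ys then real ?n / (10 * ?F\<^sup>2) else 0)"
        if ys: "ys \<in> set zss" for ys
      proof -
        let ?m = "length ys"
        have m: "256 \<le> logf (real ?m)" "256 \<le> ?m" using L_large L_ge lenL[OF ys] by auto
        have "(\<Sum>y\<leftarrow>ys. ?h y) \<le> (\<Sum>y\<leftarrow>ys. real (?k y))"
        proof (rule sum_list_mono)
          fix y show "?h y \<le> real (?k y)"
          proof (cases "?k y = 0")
            case False
            then have "1 \<le> logf (real (?k y))" by (intro logf_ge_1) linarith
            then show ?thesis by (simp add: divide_le_eq mult_left_le mult_le_cancel_left1)
          qed simp
        qed
        also have "(\<Sum>y\<leftarrow>ys. real (?k y)) = real (?K ys)" by (induction ys) auto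
        finally have le1: "(\<Sum>y\<leftarrow>ys. ?h y) \<le> real (?K ys)" .
        show ?thesis
        proof (cases "?light ys")
          case False
          then have "?F \<le> logf (real ?m)" using n1 by (intro logf_mono) auto
          then have "?T ys \<le> 1 / ?F * real (?K ys)"
            using le1 F by (intro mult_mono frac_le) (auto intro!: sum_list_nonneg simp: hn logf_nonneg)
          also have "\<dots> \<le> 9 / 8 * (real (?K ys) / ?F)" using F by (simp add: field_simps)
          finally show ?thesis using False by simp
        next
          case True
          then have Fm: "256 \<le> ?F" using m logf_mono[of "real ?m" "real ?n"] by simp
          show ?thesis
          \<comment> \<open>At most \<open>?F\<close> blocks are light, so those with fewer than
            \<open>n / (10 * F^2)\<close> coordinates contribute together at most a tenth of
            \<open>n / F\<close>.\<close>
          proof (cases "real ?n \<le> 10 * ?F\<^sup>2 * real (?K ys)")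
            case big: True
            have K1: "1 \<le> ?K ys"
            proof (rule ccontr)
              assume "\<not> 1 \<le> ?K ys"
              then have "real (?K ys) = 0" by linarith
              then have "real ?n \<le> 0" using big by (simp only: mult_zero_right)
              then show False using n1 by simp
            qed
            have "(\<Sum>y\<leftarrow>ys. ?h y) = (\<Sum>i<?m. ?h (ys ! i))" by (simp add: sum_list_sum_nth atLeast0LessThan)
            moreover have "?K ys = (\<Sum>i<?m. ?k (ys ! i))" by (simp add: sum_list_sum_nth atLeast0LessThan)
            ultimately have "?T ys \<le> real (?K ys) / logf (real (?K ys))"
              using sum_divide_logf_le_nat[of "{..<?m}" ?m "\<lambda>i. ?k (ys ! i)"] m by simp
            also have "\<dots> \<le> real (?K ys) / (8 / 9 * ?F)"
            proof (intro divide_left_mono)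
              have "?F \<le> logf (10 * ?F\<^sup>2 * real (?K ys))" using big by (intro logf_mono) auto
              also have "\<dots> \<le> logf (10 * ?F\<^sup>2) + logf (real (?K ys))"
              proof (rule logf_mult_le)
                show "1 \<le> 10 * ?F\<^sup>2" using one_le_power[OF F, of 2] by linarith
                show "1 \<le> real (?K ys)" using K1 by linarith
              qed
              also have "logf (10 * ?F\<^sup>2) \<le> ?F / 9" by (rule logf_square_le[OF Fm])
              finally show "8 / 9 * ?F \<le> logf (real (?K ys))" by simp
              have "1 \<le> logf (real (?K ys))" using K1 by (intro logf_ge_1) linarith
              then show "0 < logf (real (?K ys)) * (8 / 9 * ?F)" using F by simp
            qed simp
            finally have "?T ys \<le> 9 / 8 * (real (?K ys) / ?F)" by simp
            moreover have "0 \<le> real ?n / (10 * ?F\<^sup>2)" by simp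
            ultimately show ?thesis unfolding if_P[OF True] by linarith
          next
            case small: False
            have "?T ys \<le> 1 * (\<Sum>y\<leftarrow>ys. ?h y)"
              using m by (intro mult_right_mono sum_list_nonneg) (auto simp: hn)
            also have "\<dots> \<le> real (?K ys)" using le1 by simp
            also have "\<dots> \<le> real ?n / (10 * ?F\<^sup>2)" using small F by (simp add: field_simps)
            finally have "?T ys \<le> real ?n / (10 * ?F\<^sup>2)" .
            moreover have "0 \<le> 9 / 8 * (real (?K ys) / ?F)" using F by simp
            ultimately show ?thesis unfolding if_P[OF True] by linarith
          qed
        qed
      qed
      have sumK: "(\<Sum>ys\<leftarrow>zss. ?K ys) \<le> ?n"
      proof -
        have "(\<Sum>ys\<leftarrow>zss. ?K ys) = (\<Sum>y\<leftarrow>concat zss. ?k y)" by (induction zss) auto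
        also have "\<dots> = (\<Sum>c<length zs. ?k (zs ! c))"
          using blocks(1) by (simp add: sum_list_sum_nth atLeast0LessThan)
        also have "\<dots> \<le> ?n" by (rule sum_card_Int_supp_le[OF node(3,5)])
        finally show ?thesis .
      qed
      have "(\<Sum>ys\<leftarrow>zss. if ?light ys then real ?n / (10 * ?F\<^sup>2) else 0)
          = real (length (filter ?light zss)) * (real ?n / (10 * ?F\<^sup>2))"
        by (induction zss) (auto simp: algebra_simps add_divide_distrib)
      also have "\<dots> \<le> ?F * (real ?n / (10 * ?F\<^sup>2))"
      proof (intro mult_right_mono)
        have "sqrt ?F \<le> ?F" using F by (simp add: real_sqrt_le_iff sqrt_le_D real_le_lsqrt self_le_power power2_eq_square)
        then show "real (length (filter ?light zss)) \<le> ?F"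
          using block_count_le[OF blocks(2) n1] F by linarith
      qed auto
      also have "\<dots> = (1 / 10) * (real ?n / ?F)" using F by (simp add: power2_eq_square)
      finally have small: "(\<Sum>ys\<leftarrow>zss. if ?light ys then real ?n / (10 * ?F\<^sup>2) else 0) \<le> (1 / 10) * (real ?n / ?F)" .
      have "(\<Sum>ys\<leftarrow>zss. ?T ys) \<le> (\<Sum>ys\<leftarrow>zss. 9 / 8 * (real (?K ys) / ?F)
          + (if ?light ys then real ?n / (10 * ?F\<^sup>2) else 0))"
        by (rule sum_list_mono) (rule T)
      also have "\<dots> = 9 / 8 * (real (\<Sum>ys\<leftarrow>zss. ?K ys) / ?F)
          + (\<Sum>ys\<leftarrow>zss. if ?light ys then real ?n / (10 * ?F\<^sup>2) else 0)"
        by (induction zss) (auto simp: add_divide_distrib algebra_simps)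
      also have "\<dots> \<le> 9 / 8 * (real ?n / ?F) + (1 / 10) * (real ?n / ?F)"
        using sumK F by (intro add_mono small mult_left_mono divide_right_mono) (simp_all only: of_nat_le_iff)
      finally have "(\<Sum>ys\<leftarrow>zss. ?T ys) \<le> 49 / 40 * (real ?n / ?F)" by simp
      moreover have "(\<Sum>ys\<leftarrow>zss. 4 / 5 / logf (real (length ys)) * (\<Sum>y\<leftarrow>ys. ?h y)) = 4 / 5 * (\<Sum>ys\<leftarrow>zss. ?T ys)"
        by (induction zss) (auto simp: algebra_simps)
      moreover have "0 \<le> real ?n / ?F" using F by simp
      \<comment> \<open>The total is \<open>4 / 5 * (9 / 8 + 1 / 10) = 49 / 50\<close> times the
        bound.\<close>
      ultimately show ?thesis using blocks(3)[of ?h] by simp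
    qed
  qed
  finally show ?case .
qed

end

section \<open>Spreading one coordinate over a block\<close>

lemma proj_Un_disjoint: "E \<inter> F = {} \<Longrightarrow> proj (E \<union> F) x = proj E x + proj F x"
  by (rule poly_mapping_eqI) (auto simp: proj.rep_eq lookup_add)

lemma sum_list_proj_supp:
  "sorted_wrt supp_less zs \<Longrightarrow> (\<Sum>z\<leftarrow>zs. proj (supp z) x) = proj (\<Union>z\<in>set zs. supp z) x"
proof (induction zs)
  case Nil
  show ?case by (rule poly_mapping_eqI) (simp add: proj.rep_eq)
next
  case (Cons z zs)
  then have "supp z \<inter> (\<Union>z\<in>set zs. supp z) = {}" using supp_less_disjoint by auto
  then show ?case using Cons by (simp add: proj_Un_disjoint)
qed

lemma abs_ev_le:
  assumes "\<And>n. \<bar>coord z n\<bar> \<le> g" "0 \<le> g" shows "\<bar>ev (coord x) z\<bar> \<le> g * norm x"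
proof -
  have "\<bar>ev (coord z) x\<bar> \<le> (\<Sum>i\<in>supp x. g * \<bar>coord x i\<bar>)"
    unfolding ev_def
  proof (rule order_trans[OF sum_abs sum_mono])
    fix i
    show "\<bar>coord x i * coord z i\<bar> \<le> g * \<bar>coord x i\<bar>"
      using mult_right_mono[OF assms(1)[of i], of "\<bar>coord x i\<bar>"] by (simp add: abs_mult mult.commute)
  qed
  then show ?thesis by (simp add: ev_coord_commute[of x z] norm_c00 sum_distrib_left)
qed

lemma sum_abs_ev_le_norm:
  assumes "sorted_wrt supp_less zs" "\<And>z n. z \<in> set zs \<Longrightarrow> \<bar>coord z n\<bar> \<le> 1"
  shows "(\<Sum>z\<leftarrow>zs. \<bar>ev (coord x) z\<bar>) \<le> norm x"
proof -
  let ?s = "map (\<lambda>z. sgn (ev (coord x) z)) zs"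
  have "(\<Sum>z\<leftarrow>zs. \<bar>ev (coord x) z\<bar>) = ev (coord x) (comb ?s zs)"
    by (simp add: ev_comb sum_list_sum_nth atLeast0LessThan abs_sgn mult.commute)
  also have "\<dots> \<le> \<bar>ev (coord x) (comb ?s zs)\<bar>" by simp
  also have "\<dots> \<le> 1 * norm x"
  proof (rule abs_ev_le)
    fix n show "\<bar>coord (comb ?s zs) n\<bar> \<le> 1"
    proof (rule coord_comb_cases[OF assms(1), of ?s n])
      fix c assume c: "c < length zs" "coord (comb ?s zs) n = ?s ! c * coord (zs ! c) n"
      have "\<bar>?s ! c * coord (zs ! c) n\<bar> \<le> 1 * 1"
        unfolding abs_mult using c assms(2) by (intro mult_mono) (auto simp: abs_sgn_eq)
      then show ?thesis using c by simp
    qed auto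
  qed simp
  finally show ?thesis by simp
qed

context lacunary
begin

lemma NK_proj_le: "NK (proj E x) \<le> NK x"
  by (rule NK_least) (auto simp: ev_coord_proj intro!: NK_upper proj_in_K)

lemma NK_convex:
  assumes "0 \<le> r" "r \<le> 1"
  shows "NK (x + r *\<^sub>R y) \<le> r * NK (x + y) + (1 - r) * NK x"
proof -
  have "x + r *\<^sub>R y = r *\<^sub>R (x + y) + (1 - r) *\<^sub>R x" by (simp add: algebra_simps)
  then have "NK (x + r *\<^sub>R y) \<le> NK (r *\<^sub>R (x + y)) + NK ((1 - r) *\<^sub>R x)" using NK_add by metis
  also have "\<dots> \<le> r * NK (x + y) + (1 - r) * NK x"
    using assms by (intro add_mono NK_scaleR_nonneg) auto
  finally show ?thesis .
qed

end

text \<open>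
  \<open>spread\<close> replaces the coordinate \<open>b\<close> at \<open>d\<close> of the vector \<open>A + b e\<^sub>d\<close> by the normalized constant vector
  on a block \<open>D\<close> that no coordinate of \<open>A\<close> splits. A functional \<open>z\<close> that uses a proportion \<open>r\<close> of the
  block is compared with the vector \<open>collapse z\<close>, where only \<open>r b\<close> is left at \<open>d\<close>. For intervals this is
  compatible with one step in the construction of \<open>K\<close>: by convexity all of \<open>r b\<close> may be assigned to a single
  successor. Errors arise only from successors that see both \<open>D\<close> and \<open>A\<close>, at most one on each side.
\<close>

locale spread_block = lacunary +
  fixes A :: c00 and b :: real and D :: "nat set" and d :: nat
  assumes fin_D: "finite D" and d_D: "d \<in> D" and b_nonneg: "0 \<le> b" and b_le_1: "b \<le> 1"
    and sep: "i \<in> supp A \<Longrightarrow> (\<forall>j\<in>D. i < j) \<or> (\<forall>j\<in>D. j < i)"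
begin

abbreviation "N \<equiv> card D"

definition spread :: c00 where
  "spread = A + (\<Sum>j\<in>D. Poly_Mapping.single j (b * (logf (real N) / real N)))"

definition r :: "c00 \<Rightarrow> real" where "r z = real (card (D \<inter> supp z)) / real N"

definition collapse :: "c00 \<Rightarrow> c00" where
  "collapse z = proj (supp z) A + r z *\<^sub>R Poly_Mapping.single d b"

definition mid :: "c00 \<Rightarrow> bool" where "mid z \<longleftrightarrow> D \<inter> supp z \<noteq> {}"
definition left :: "c00 \<Rightarrow> bool" where "left z \<longleftrightarrow> (\<exists>i\<in>supp z \<inter> supp A. \<forall>j\<in>D. i < j)"
definition right :: "c00 \<Rightarrow> bool" where "right z \<longleftrightarrow> (\<exists>i\<in>supp z \<inter> supp A. \<forall>j\<in>D. j < i)"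
text \<open>The error in \<open>ev_spread_le\<close> is charged per crossing. Counting the two sides
  of the block separately makes the count superadditive over successive parts of a functional, so
  the errors of the parts sum to at most the error of the whole.\<close>

definition crossings :: "c00 \<Rightarrow> real" where
  "crossings z = of_bool (left z \<and> mid z) + of_bool (right z \<and> mid z)"

lemma N_pos: "0 < N" using fin_D d_D by (auto simp: card_gt_0_iff)

lemma d_notin_A: "d \<notin> supp A" using sep[of d] d_D by auto

lemma r_nonneg: "0 \<le> r z" by (simp add: r_def)

lemma r_le_1: "r z \<le> 1"
  using card_mono[OF fin_D, of "D \<inter> supp z"] N_pos by (simp add: r_def divide_le_eq)

lemma r_eq_0: "\<not> mid z \<Longrightarrow> r z = 0" by (simp add: r_def mid_def)

lemma r_pos_mid: "r z \<noteq> 0 \<Longrightarrow> mid z" by (auto simp: r_def mid_def)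

lemma ev_spread: "ev (coord spread) z = ev (coord A) z + b * (logf (real N) / real N) * (\<Sum>j\<in>D. coord z j)"
proof -
  have "ev (coord spread) z = ev (coord A) z
      + ev (coord z) (\<Sum>j\<in>D. Poly_Mapping.single j (b * (logf (real N) / real N)))"
    by (simp add: spread_def ev_coord_add ev_coord_commute[of "sum _ _"])
  then show ?thesis by (simp add: ev_sum sum_distrib_left)
qed

lemma norm_spread_le: "norm spread \<le> norm A + logf (real N)"
proof -
  have "norm spread \<le> norm A + norm (\<Sum>j\<in>D. Poly_Mapping.single j (b * (logf (real N) / real N)) :: c00)"
    unfolding spread_def by (rule norm_triangle_ineq)
  also have "norm (\<Sum>j\<in>D. Poly_Mapping.single j (b * (logf (real N) / real N)) :: c00)
      \<le> (\<Sum>j\<in>D. norm (Poly_Mapping.single j (b * (logf (real N) / real N)) :: c00))"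
    by (rule norm_sum)
  also have "\<dots> \<le> (\<Sum>j\<in>D. logf (real N) / real N)"
  proof (rule sum_mono)
    fix j
    have "norm (Poly_Mapping.single j c :: c00) = \<bar>c\<bar>" for c
      by (cases "c = 0") (auto simp: norm_c00)
    moreover have "\<bar>b * (logf (real N) / real N)\<bar> \<le> 1 * (logf (real N) / real N)"
      unfolding abs_mult using b_nonneg b_le_1 by (intro mult_mono) (auto simp: logf_nonneg)
    ultimately show "norm (Poly_Mapping.single j (b * (logf (real N) / real N)) :: c00) \<le> logf (real N) / real N"
      by simp
  qed
  also have "\<dots> = logf (real N)" using N_pos by simp
  finally show ?thesis by simp
qed

lemma ev_A_le: assumes "z \<in> K" shows "ev (coord A) z \<le> NK (proj (supp z) A)"
proof -
  have "ev (coord A) z = ev (coord (proj (supp z) A)) z"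
    by (rule ev_cong) (simp add: proj.rep_eq)
  then show ?thesis using NK_upper[OF assms] by simp
qed

lemma NK_proj_collapse: "NK (proj (supp z) A) \<le> NK (collapse z)"
proof -
  have "proj (- {d}) (collapse z) = proj (supp z) A"
    using d_notin_A by (intro poly_mapping_eqI)
      (auto simp: collapse_def proj.rep_eq lookup_add lookup_single when_def in_keys_iff)
  then show ?thesis using NK_proj_le[of "- {d}" "collapse z"] by simp
qed

lemma NK_collapse_ge: "b * r z \<le> NK (collapse z)"
proof -
  have "coord (collapse z) d = b * r z"
    using d_notin_A by (simp add: collapse_def proj.rep_eq lookup_add in_keys_iff)
  then show ?thesis using coord_le_NK[of "collapse z" d] by simp
qed

lemma NK_collapse_le: "NK (collapse z) \<le> NK (A + Poly_Mapping.single d b)"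
proof -
  have 1: "proj (insert d (supp z)) (A + Poly_Mapping.single d b) = proj (supp z) A + Poly_Mapping.single d b"
    using d_notin_A by (intro poly_mapping_eqI) (auto simp: proj.rep_eq lookup_add lookup_single when_def in_keys_iff)
  have 2: "proj (supp z - {d}) (A + Poly_Mapping.single d b) = proj (supp z) A"
    using d_notin_A by (intro poly_mapping_eqI) (auto simp: proj.rep_eq lookup_add lookup_single when_def in_keys_iff)
  have "NK (collapse z) \<le> r z * NK (proj (supp z) A + Poly_Mapping.single d b) + (1 - r z) * NK (proj (supp z) A)"
    unfolding collapse_def by (rule NK_convex[OF r_nonneg r_le_1])
  also have "\<dots> \<le> r z * NK (A + Poly_Mapping.single d b) + (1 - r z) * NK (A + Poly_Mapping.single d b)"
    using NK_proj_le[of "insert d (supp z)" "A + Poly_Mapping.single d b"]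
      NK_proj_le[of "supp z - {d}" "A + Poly_Mapping.single d b"] r_nonneg[of z] r_le_1[of z]
    unfolding 1 2 by (intro add_mono mult_left_mono) auto
  finally show ?thesis by (simp add: algebra_simps)
qed

text \<open>The share \<open>r z\<close> of the block splits among the successors. By convexity each
  collapsed successor is bounded by a mixture of two cases: it receives the whole amount at
  \<open>d\<close>, or nothing. Summing with the shares as weights turns this into a mixture over
  \<open>e\<close> of configurations in which successor \<open>e\<close> alone receives everything.
  In each of these the vectors are still successive, so \<open>NK_adm\<close> applies.\<close>

lemma sum_NK_collapse_le:
  assumes \<gamma>s: "adm \<gamma>s" "length zs = length \<gamma>s" and zs: "sorted_wrt supp_less zs"
  shows "(\<Sum>c<length zs. \<gamma>s ! c * NK (collapse (zs ! c))) \<le> NK (collapse (comb \<gamma>s zs))"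
proof -
  let ?n = "length zs" and ?z = "comb \<gamma>s zs"
  let ?A = "\<lambda>c. proj (supp (zs ! c)) A"
  have w: "0 < \<gamma>s ! c" if "c < ?n" for c using adm_weight[OF \<gamma>s(1)] \<gamma>s(2) that by simp
  have supp: "supp ?z = (\<Union>z\<in>set zs. supp z)" using w by (intro supp_comb[OF zs]) force
  have sumA: "(\<Sum>c<?n. ?A c) = proj (supp ?z) A"
    using sum_list_proj_supp[OF zs, of A] by (simp add: supp sum_list_sum_nth atLeast0LessThan)
  have r: "r ?z = (\<Sum>c<?n. r (zs ! c))"
  proof -
    have "D \<inter> supp ?z = (\<Union>c<?n. D \<inter> supp (zs ! c))" unfolding supp by (auto simp: set_conv_nth)
    also have "card \<dots> = (\<Sum>c<?n. card (D \<inter> supp (zs ! c)))"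
    proof (rule card_UN_disjoint)
      show "\<forall>i\<in>{..<?n}. \<forall>j\<in>{..<?n}. i \<noteq> j \<longrightarrow> (D \<inter> supp (zs ! i)) \<inter> (D \<inter> supp (zs ! j)) = {}"
      proof (intro ballI impI)
        fix i j assume ij: "i \<in> {..<?n}" "j \<in> {..<?n}" "i \<noteq> j"
        then have "supp_less (zs ! i) (zs ! j) \<or> supp_less (zs ! j) (zs ! i)"
          using zs by (auto simp: sorted_wrt_iff_nth_less linorder_neq_iff)
        then show "(D \<inter> supp (zs ! i)) \<inter> (D \<inter> supp (zs ! j)) = {}"
          using supp_less_disjoint by blast
      qed
    qed (use fin_D in auto)
    finally show ?thesis by (simp add: r_def sum_divide_distrib)
  qed
  \<comment> \<open>The value \<open>e = ?n\<close> stands for no successor receiving the coordinate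
    at \<open>d\<close>; it settles the case in which the functional misses the block.\<close>
  have chain: "(\<Sum>c<?n. \<gamma>s ! c * NK (?A c + (if c = e then Poly_Mapping.single d t else 0)))
      \<le> NK (proj (supp ?z) A + (if e < ?n then Poly_Mapping.single d t else 0))"
    if e: "e < ?n \<Longrightarrow> mid (zs ! e)" for e t
  proof -
    let ?x = "\<lambda>c. ?A c + (if c = e then Poly_Mapping.single d t else 0)"
    have sx: "supp (?x c) \<subseteq> (supp (zs ! c) \<inter> supp A) \<union> (if c = e then {d} else {})" for c
      using Poly_Mapping.keys_add[of "?A c" "if c = e then Poly_Mapping.single d t else 0"]
      by (auto simp: keys_proj split: if_splits)
    have "sorted_wrt supp_less (map ?x [0..<?n])"
      unfolding sorted_wrt_iff_nth_less
    proof (intro allI impI)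
      fix i j assume ij: "i < j" "j < length (map ?x [0..<?n])"
      then have less: "set_less (supp (zs ! i)) (supp (zs ! j))"
        using zs by (auto simp: sorted_wrt_iff_nth_less supp_less_def)
      have "set_less (supp (?x i)) (supp (?x j))"
        unfolding set_less_def
      proof (intro ballI)
        fix p q assume p: "p \<in> supp (?x i)" and q: "q \<in> supp (?x j)"
        have "(p \<in> supp (zs ! i) \<and> p \<in> supp A) \<or> (p = d \<and> i = e)"
          using subsetD[OF sx p] by (cases "i = e") auto
        moreover have "(q \<in> supp (zs ! j) \<and> q \<in> supp A) \<or> (q = d \<and> j = e)"
          using subsetD[OF sx q] by (cases "j = e") auto
        moreover have "i \<noteq> j" using ij by simp
        \<comment> \<open>A successor that receives \<open>d\<close> meets the block at some
          \<open>u\<close>. A point of \<open>supp A\<close> seen by another successor lies on the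
          proper side of \<open>u\<close>, hence by \<open>sep\<close> on that side of the whole
          block, and so of \<open>d\<close>.\<close>
        ultimately consider "p \<in> supp (zs ! i)" "q \<in> supp (zs ! j)"
          | "p = d" "i = e" "q \<in> supp (zs ! j)" "q \<in> supp A"
          | "p \<in> supp (zs ! i)" "p \<in> supp A" "q = d" "j = e"
          by blast
        then show "p < q"
        proof cases
          case 1 then show ?thesis using less by (auto simp: set_less_def)
        next
          case 2
          then obtain u where u: "u \<in> D" "u \<in> supp (zs ! i)" using e ij by (auto simp: mid_def)
          then have "u < q" using less 2 by (auto simp: set_less_def)
          then have "\<not> (\<forall>j\<in>D. q < j)" using u(1) less_asym by blast
          then have "\<forall>j\<in>D. j < q" using sep[OF 2(4)] by blast
          then show ?thesis using 2 d_D by simp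
        next
          case 3
          then obtain u where u: "u \<in> D" "u \<in> supp (zs ! j)" using e ij by (auto simp: mid_def)
          then have "p < u" using less 3 by (auto simp: set_less_def)
          then have "\<not> (\<forall>j\<in>D. j < p)" using u(1) less_asym by blast
          then have "\<forall>j\<in>D. p < j" using sep[OF 3(2)] by blast
          then show ?thesis using 3 d_D by simp
        qed
      qed
      then show "supp_less (map ?x [0..<?n] ! i) (map ?x [0..<?n] ! j)" using ij by (simp add: supp_less_def)
    qed
    from NK_adm[OF \<gamma>s(1) _ this] \<gamma>s(2)
    have "(\<Sum>c<?n. \<gamma>s ! c * NK (?x c)) \<le> NK (sum_list (map ?x [0..<?n]))" by simp
    also have "sum_list (map ?x [0..<?n]) = (\<Sum>c<?n. ?x c)"
      by (simp add: sum_list_sum_nth atLeast0LessThan)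
    also have "\<dots> = proj (supp ?z) A + (if e < ?n then Poly_Mapping.single d t else 0)"
      by (simp add: sum.distrib sumA)
    finally show ?thesis .
  qed
  show ?thesis
  proof (cases "r ?z = 0")
    case True
    then have "r (zs ! c) = 0" if "c < ?n" for c
      using that r_nonneg sum_nonneg_eq_0_iff[of "{..<?n}" "\<lambda>c. r (zs ! c)"] by (simp add: r)
    then show ?thesis using chain[of ?n 0] True by (simp add: collapse_def)
  next
    case False
    let ?r = "r ?z"
    have rpos: "0 < ?r" using False r_nonneg[of ?z] by simp
    let ?B = "\<lambda>c. NK (?A c + Poly_Mapping.single d (?r * b))"
    have "(\<Sum>c<?n. \<gamma>s ! c * NK (collapse (zs ! c)))
        \<le> (\<Sum>c<?n. \<gamma>s ! c * (\<Sum>e<?n. (r (zs ! e) / ?r) * (if c = e then ?B c else NK (?A c))))"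
    proof (intro sum_mono mult_left_mono)
      fix c assume "c \<in> {..<?n}"
      then have c: "c < ?n" by simp
      let ?q = "r (zs ! c) / ?r"
      have q: "0 \<le> ?q" "?q \<le> 1"
        using rpos r_nonneg c member_le_sum[of c "{..<?n}" "\<lambda>c. r (zs ! c)"] by (auto simp: r divide_le_eq)
      have tot: "(\<Sum>e<?n. r (zs ! e) / ?r) = 1" using False by (simp add: r flip: sum_divide_distrib)
      have "collapse (zs ! c) = ?A c + ?q *\<^sub>R Poly_Mapping.single d (?r * b)"
        unfolding collapse_def using False
        by (intro poly_mapping_eqI) (auto simp: lookup_add lookup_single when_def)
      then have "NK (collapse (zs ! c)) \<le> ?q * ?B c + (1 - ?q) * NK (?A c)" using NK_convex[OF q] by metis
      also have "\<dots> = (\<Sum>e<?n. (r (zs ! e) / ?r) * (if c = e then ?B c else NK (?A c)))"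
      proof -
        have "(\<Sum>e<?n. (r (zs ! e) / ?r) * (if c = e then ?B c else NK (?A c)))
            = (\<Sum>e<?n. (r (zs ! e) / ?r) * NK (?A c) + (if c = e then ?q * (?B c - NK (?A c)) else 0))"
          by (intro sum.cong) (auto simp: algebra_simps)
        also have "\<dots> = (\<Sum>e<?n. r (zs ! e) / ?r) * NK (?A c) + ?q * (?B c - NK (?A c))"
          using c by (simp add: sum.distrib sum_distrib_right)
        finally show ?thesis by (simp add: tot algebra_simps)
      qed
      finally show "NK (collapse (zs ! c)) \<le> (\<Sum>e<?n. (r (zs ! e) / ?r) * (if c = e then ?B c else NK (?A c)))" .
    qed (use w in force)
    also have "\<dots> = (\<Sum>e<?n. (r (zs ! e) / ?r) * (\<Sum>c<?n. \<gamma>s ! c * (if c = e then ?B c else NK (?A c))))"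
      unfolding sum_distrib_left by (subst sum.swap) (simp add: mult_ac)
    also have "\<dots> \<le> (\<Sum>e<?n. (r (zs ! e) / ?r) * NK (collapse ?z))"
    proof (rule sum_mono)
      fix e assume e: "e \<in> {..<?n}"
      show "(r (zs ! e) / ?r) * (\<Sum>c<?n. \<gamma>s ! c * (if c = e then ?B c else NK (?A c)))
          \<le> (r (zs ! e) / ?r) * NK (collapse ?z)"
      proof (cases "r (zs ! e) = 0")
        case False
        have eq: "(\<Sum>c<?n. \<gamma>s ! c * (if c = e then ?B c else NK (?A c)))
            = (\<Sum>c<?n. \<gamma>s ! c * NK (?A c + (if c = e then Poly_Mapping.single d (?r * b) else 0)))"
          by (intro sum.cong) auto
        also have "\<dots> \<le> NK (proj (supp ?z) A + Poly_Mapping.single d (?r * b))"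
          using chain[of e "?r * b"] r_pos_mid[OF False] e by simp
        also have "proj (supp ?z) A + Poly_Mapping.single d (?r * b) = collapse ?z"
          unfolding collapse_def by (intro poly_mapping_eqI) (auto simp: lookup_add lookup_single when_def)
        finally show ?thesis using r_nonneg[of "zs ! e"] rpos by (intro mult_left_mono) auto
      qed simp
    qed
    also have "\<dots> = NK (collapse ?z)"
      using False by (simp add: r flip: sum_distrib_right sum_divide_distrib)
    finally show ?thesis .
  qed
qed

text \<open>At most one of several successive functionals can cross on a given side. If two crossed
  on the left, the earlier one would meet the block at \<open>t\<close> while the later one sees a
  point left of the block, hence before \<open>t\<close>; the right side is symmetric.\<close>

lemma sum_crossings_le:
  assumes zs: "sorted_wrt supp_less zs" and supp: "supp z = (\<Union>z\<in>set zs. supp z)"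
  shows "(\<Sum>y\<leftarrow>zs. crossings y) \<le> crossings z"
proof -
  have le: "(\<Sum>c<length zs. of_bool (P (zs ! c))) \<le> (of_bool Q :: real)"
    if excl: "\<And>i j. i < j \<Longrightarrow> j < length zs \<Longrightarrow> P (zs ! i) \<Longrightarrow> P (zs ! j) \<Longrightarrow> False"
      and that: "\<And>c. c < length zs \<Longrightarrow> P (zs ! c) \<Longrightarrow> Q" for P :: "c00 \<Rightarrow> bool" and Q
  proof (cases "\<exists>c<length zs. P (zs ! c)")
    case True
    then obtain c where c: "c < length zs" "P (zs ! c)" by blast
    have "P (zs ! i) \<longleftrightarrow> i = c" if i: "i < length zs" for i
    proof
      assume P: "P (zs ! i)"
      show "i = c"
      proof (rule linorder_cases[of i c])
        assume "i < c" from excl[OF this c(1) P c(2)] show ?thesis ..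
      next
        assume "c < i" from excl[OF this i c(2) P] show ?thesis ..
      qed
    qed (use c in simp)
    then have "(\<Sum>i<length zs. of_bool (P (zs ! i))) = (\<Sum>i<length zs. if i = c then 1 else (0::real))"
      by (intro sum.cong) auto
    also have "\<dots> \<le> 1" by simp
    also have "1 = (of_bool Q :: real)" using that c by simp
    finally show ?thesis .
  qed simp
  have lt: "u < v" if "i < j" "j < length zs" "u \<in> supp (zs ! i)" "v \<in> supp (zs ! j)" for i j u v
  proof -
    have "supp_less (zs ! i) (zs ! j)" using zs that(1,2) by (simp add: sorted_wrt_iff_nth_less)
    then show ?thesis using that(3,4) unfolding supp_less_def set_less_def by blast
  qed
  have mono: "mid y \<Longrightarrow> mid z" "left y \<Longrightarrow> left z" "right y \<Longrightarrow> right z" if "y \<in> set zs" for y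
    using that unfolding mid_def left_def right_def supp by auto
  have "(\<Sum>c<length zs. of_bool (left (zs ! c) \<and> mid (zs ! c))) \<le> (of_bool (left z \<and> mid z) :: real)"
  proof (rule le)
    fix i j assume ij: "i < j" "j < length zs" "left (zs ! i) \<and> mid (zs ! i)" "left (zs ! j) \<and> mid (zs ! j)"
    then obtain t u where tu: "t \<in> D" "t \<in> supp (zs ! i)" "u \<in> supp (zs ! j)" "u < t"
      unfolding mid_def left_def by blast
    from lt[OF ij(1,2) tu(2,3)] tu(4) show False by simp
  qed (use mono nth_mem in blast)
  moreover have "(\<Sum>c<length zs. of_bool (right (zs ! c) \<and> mid (zs ! c))) \<le> (of_bool (right z \<and> mid z) :: real)"
  proof (rule le)
    fix i j assume ij: "i < j" "j < length zs" "right (zs ! i) \<and> mid (zs ! i)" "right (zs ! j) \<and> mid (zs ! j)"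
    then obtain t u where tu: "t \<in> D" "t \<in> supp (zs ! j)" "u \<in> supp (zs ! i)" "t < u"
      unfolding mid_def right_def by blast
    from lt[OF ij(1,2) tu(3,2)] tu(4) show False by simp
  qed (use mono nth_mem in blast)
  ultimately show ?thesis
    by (simp add: crossings_def sum_list_sum_nth atLeast0LessThan sum.distrib)
qed

lemma crossings_cases: "crossings z = 0 \<or> 1 \<le> crossings z"
  by (simp add: crossings_def)

lemma crossings_nonneg: "0 \<le> crossings z"
  by (simp add: crossings_def)

text \<open>\<open>K_flat\<close> bounds the coordinate sum on the block, and \<open>flat\<close>
  compares the result with the share \<open>b * r z\<close> that \<open>collapse\<close> leaves at
  \<open>d\<close>.\<close>

lemma block_part_le:
  assumes z: "z \<in> K" and \<eta>: "0 \<le> \<eta>"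
    and flat: "\<And>n. 1 \<le> n \<Longrightarrow> n \<le> N \<Longrightarrow> logf (real N) / real N * (real n / logf (real n)) \<le> real n / real N + \<eta>"
  shows "b * (logf (real N) / real N) * (\<Sum>j\<in>D. coord z j) \<le> b * r z + (if mid z then \<eta> else 0)"
proof (cases "mid z")
  case False
  then have "(\<Sum>j\<in>D. coord z j) = 0" by (intro sum.neutral) (auto simp: mid_def in_keys_iff)
  then show ?thesis using False r_eq_0 by simp
next
  case True
  let ?n = "card (D \<inter> supp z)"
  have n: "1 \<le> ?n" "?n \<le> N" using True fin_D by (auto simp: mid_def Suc_le_eq card_gt_0_iff intro: card_mono)
  have "(\<Sum>j\<in>D. coord z j) = (\<Sum>j\<in>D \<inter> supp z. coord z j)"
    by (rule sum.mono_neutral_right) (use fin_D in \<open>auto simp: in_keys_iff\<close>)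
  also have "\<dots> \<le> (\<Sum>j\<in>D \<inter> supp z. \<bar>coord z j\<bar>)" by (rule sum_mono) simp
  also have "\<dots> \<le> real ?n / logf (real ?n)" by (rule K_flat[OF z]) (use fin_D in simp)
  finally have "logf (real N) / real N * (\<Sum>j\<in>D. coord z j) \<le> logf (real N) / real N * (real ?n / logf (real ?n))"
    by (intro mult_left_mono) (auto simp: logf_nonneg)
  also have "\<dots> \<le> r z + \<eta>" using flat[OF n] by (simp add: r_def)
  finally have "b * (logf (real N) / real N * (\<Sum>j\<in>D. coord z j)) \<le> b * (r z + \<eta>)"
    by (rule mult_left_mono) (rule b_nonneg)
  also have "\<dots> \<le> b * r z + 1 * \<eta>"
    unfolding distrib_left using \<eta> b_le_1 by (intro add_left_mono mult_right_mono) auto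
  finally show ?thesis using True by (simp add: mult.assoc)
qed

text \<open>Such a functional sees only \<open>A\<close> or only the block. In either case the value
  is controlled by one part of \<open>collapse z\<close>, with no error beyond
  \<open>\<eta>\<close>.\<close>

lemma ev_spread_le_uncrossed:
  assumes z: "z \<in> K" and \<eta>: "0 \<le> \<eta>"
    and flat: "\<And>n. 1 \<le> n \<Longrightarrow> n \<le> N \<Longrightarrow> logf (real N) / real N * (real n / logf (real n)) \<le> real n / real N + \<eta>"
    and un: "\<not> mid z \<or> crossings z = 0"
  shows "ev (coord spread) z \<le> NK (collapse z) + (if mid z then e * crossings z + \<eta> else 0)"
proof (cases "mid z")
  case False
  then have "ev (coord spread) z \<le> ev (coord A) z"
    using block_part_le[OF z \<eta> flat] r_eq_0[OF False] by (simp add: ev_spread)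
  also have "\<dots> \<le> NK (collapse z)" using ev_A_le[OF z] NK_proj_collapse[of z] by linarith
  finally show ?thesis using False by simp
next
  case True
  then have "\<not> left z" "\<not> right z" using un by (auto simp: crossings_def of_bool_def split: if_splits)
  then have "n \<notin> supp A" if "n \<in> supp z" for n using sep[of n] that by (auto simp: left_def right_def)
  then have "ev (coord A) z = ev (\<lambda>_. 0) z" by (intro ev_cong) (simp add: in_keys_iff)
  then have "ev (coord spread) z \<le> b * r z + \<eta>"
    using block_part_le[OF z \<eta> flat] True by (simp add: ev_spread ev_def[of "\<lambda>_. 0"])
  then show ?thesis using True un NK_collapse_ge[of z] by simp
qed

text \<open>\<open>Q\<close> separates short from long combinations. For an average of length
  \<open>q\<close> with \<open>2 <= q < Q\<close> the inherited errors, at most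
  \<open>e * crossings z + Q^2 * \<eta>\<close> in total, are divided by at least
  \<open>3 / 2\<close>, and the choice of \<open>e\<close> leaves room for the new part. For a
  longer average the part on \<open>A\<close> is at most \<open>h\<close>, and the block part is
  estimated in one piece. In a special functional fewer than \<open>Q * Q\<close> successors lie in
  short blocks, where the weight is at most \<open>1 / 2\<close>; the long blocks together cost at
  most \<open>\<omega>\<close> times the norm of the spread vector, hence at most
  \<open>h\<close>.\<close>

lemma ev_spread_le:
  fixes Q :: nat and \<eta> h \<omega> e :: real
  assumes flat: "\<And>n. 1 \<le> n \<Longrightarrow> n \<le> N \<Longrightarrow> logf (real N) / real N * (real n / logf (real n)) \<le> real n / real N + \<eta>"
    and Q: "2 \<le> Q" and \<eta>: "0 \<le> \<eta>" and h: "0 \<le> h" and \<omega>: "0 \<le> \<omega>"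
    and hQ: "norm A / logf (real Q) \<le> h"
    and heavy: "\<And>m. m \<in> L \<Longrightarrow> Q \<le> m \<Longrightarrow> 1 / logf (real m) \<le> \<omega>" "\<omega> * (norm A + logf (real N)) \<le> h"
    and e: "3 * ((real Q)\<^sup>2 * \<eta> + h) \<le> e"
  shows "z \<in> K \<Longrightarrow> ev (coord spread) z \<le> NK (collapse z) + (if mid z then e * crossings z + \<eta> else 0)"
proof (induction rule: K.induct)
  case (leaf a n)
  then have z: "Poly_Mapping.single n a \<in> K" by (rule K.leaf)
  have "crossings (Poly_Mapping.single n a) = 0"
    using d_D sep by (auto simp: crossings_def left_def right_def mid_def)
  then show ?case by (intro ev_spread_le_uncrossed[OF z \<eta> flat]) simp_all
next
  case (node \<gamma>s zs)
  let ?z = "comb \<gamma>s zs"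
  let ?err = "\<lambda>z. if mid z then e * crossings z + \<eta> else 0"
  let ?c = "crossings ?z"
  have Q\<eta>: "0 \<le> (real Q)\<^sup>2 * \<eta>" using \<eta> by simp
  then have e0: "0 \<le> e" using e h by simp
  have err: "?err y \<le> e * crossings y + \<eta>" for y
    using mult_nonneg_nonneg[OF e0 crossings_nonneg[of y]] \<eta> by simp
  have zsK: "y \<in> K" and IH: "ev (coord spread) y \<le> NK (collapse y) + (e * crossings y + \<eta>)"
    if "y \<in> set zs" for y
    using node(4) that err[of y] by (auto intro: order_trans)
  have zK: "?z \<in> K" by (rule K.node) (use node zsK in auto)
  have w: "0 < \<gamma>s ! c" if "c < length zs" for c using adm_weight[OF node(1), of c] that node(2) by simp
  have supp: "supp ?z = (\<Union>z\<in>set zs. supp z)" using w by (intro supp_comb[OF node(3)]) force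
  have cr: "(\<Sum>y\<leftarrow>zs. crossings y) \<le> ?c" by (rule sum_crossings_le[OF node(3) supp])
  show ?case
  proof (cases "mid ?z \<and> crossings ?z \<noteq> 0")
    case False
    then show ?thesis by (intro ev_spread_le_uncrossed[OF zK \<eta> flat]) auto
  next
    case True
    then have c1: "1 \<le> ?c" and m: "mid ?z" using crossings_cases[of ?z] by auto
    have col: "(\<Sum>c<length zs. \<gamma>s ! c * NK (collapse (zs ! c))) \<le> NK (collapse ?z)"
      by (rule sum_NK_collapse_le[OF node(1,2,3)])
    have ec: "e \<le> e * ?c" using c1 e0 mult_left_mono[of 1 ?c e] by simp
    show ?thesis
      using node(1,2)
    proof (cases rule: comb_adm_cases)
      case (average q)
      \<comment> \<open>An average of length 1 has weight 1 and does not contract the error, so the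
        estimate of its only successor is passed on unchanged.\<close>
      consider "q = 1" | "2 \<le> q" "q < Q" | "Q \<le> q" using average(1) by linarith
      then show ?thesis
      proof cases
        case 1
        then obtain y where y: "zs = [y]" using average by (metis One_nat_def length_0_conv length_Suc_conv)
        then have zy: "?z = y" using average 1 by (simp add: comb_def)
        have "ev (coord spread) y \<le> NK (collapse y) + ?err y"
          using node(4) y by (metis list.set_intros(1))
        then show ?thesis unfolding zy .
      next
        case 2
        have "logf 2 \<le> logf (real q)" using 2 by (intro logf_mono) auto
        then have Fq: "3 / 2 \<le> logf (real q)" using logf_2_ge by linarith
        have "ev (coord spread) ?z
            \<le> (\<Sum>c<length zs. \<gamma>s ! c * (NK (collapse (zs ! c)) + (e * crossings (zs ! c) + \<eta>)))"
          unfolding ev_comb using IH w by (intro sum_mono mult_left_mono) (auto intro: less_imp_le)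
        also have "\<dots> = (\<Sum>c<length zs. \<gamma>s ! c * NK (collapse (zs ! c)))
            + (\<Sum>c<length zs. e * crossings (zs ! c) + \<eta>) / logf (real q)"
          using average by (simp add: distrib_left sum.distrib sum_divide_distrib add_divide_distrib)
        also have "(\<Sum>c<length zs. e * crossings (zs ! c) + \<eta>) = e * (\<Sum>y\<leftarrow>zs. crossings y) + real q * \<eta>"
          using average by (simp add: sum.distrib sum_list_sum_nth atLeast0LessThan sum_distrib_left)
        also have "\<dots> / logf (real q) \<le> (e * ?c + real q * \<eta>) / (3 / 2)"
          using e0 \<eta> cr Fq c1 by (intro frac_le add_mono mult_left_mono) auto
        also have "real q * \<eta> \<le> (real Q)\<^sup>2 * \<eta>"
        proof (rule mult_right_mono)
          have "real q \<le> real Q * 1" using 2 by simp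
          also have "\<dots> \<le> real Q * real Q" using Q by (intro mult_left_mono) auto
          finally show "real q \<le> (real Q)\<^sup>2" by (simp add: power2_eq_square)
        qed (rule \<eta>)
        finally have "ev (coord spread) ?z \<le> NK (collapse ?z) + (e * ?c + (real Q)\<^sup>2 * \<eta>) / (3 / 2)"
          using col by simp
        also have "(e * ?c + (real Q)\<^sup>2 * \<eta>) / (3 / 2) \<le> e * ?c" using e ec h Q\<eta> by simp
        finally show ?thesis using m \<eta> by simp
      next
        case 3
        have Fq: "0 < logf (real q)" using average(1) by (intro logf_pos) simp
        have FQ: "0 < logf (real Q)" using Q by (intro logf_pos) simp
        have "\<bar>coord ?z n\<bar> \<le> 1 / logf (real q)" for n
        proof (rule coord_comb_cases[OF node(3), of \<gamma>s n])
          fix c assume c: "c < length zs" "coord ?z n = \<gamma>s ! c * coord (zs ! c) n"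
          have "\<bar>\<gamma>s ! c * coord (zs ! c) n\<bar> \<le> 1 / logf (real q) * 1"
            unfolding abs_mult using c average Fq abs_coord_K_le[OF zsK[of "zs ! c"]] by (intro mult_mono) auto
          then show ?thesis using c by simp
        qed (use Fq in auto)
        then have "\<bar>ev (coord A) ?z\<bar> \<le> 1 / logf (real q) * norm A" using Fq by (intro abs_ev_le) auto
        also have "\<dots> \<le> 1 / logf (real Q) * norm A"
          using 3 Fq FQ logf_mono[of "real Q" "real q"] by (intro mult_right_mono frac_le) auto
        also have "\<dots> \<le> h" using hQ by simp
        finally have "ev (coord spread) ?z \<le> h + (b * r ?z + \<eta>)"
          using block_part_le[OF zK \<eta> flat] m by (simp add: ev_spread)
        then show ?thesis using NK_collapse_ge[of ?z] ec e m h Q\<eta> by simp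
      qed
    next
      case (blocks zss)
      let ?light = "\<lambda>ys. length ys < Q"
      let ?w = "\<lambda>ys. 4 / 5 / logf (real (length ys))"
      let ?u = "\<lambda>y. e * crossings y + \<eta>"
      have in_zs: "y \<in> set zs" if "ys \<in> set zss" "y \<in> set ys" for y ys using that blocks(1) by auto
      have pos: "0 \<le> ?u y" for y using e0 \<eta> crossings_nonneg[of y] by simp
      have "ev (coord spread) ?z = (\<Sum>ys\<leftarrow>zss. ?w ys * (\<Sum>y\<leftarrow>ys. ev (coord spread) y))"
        unfolding ev_comb by (rule blocks(3))
      also have "\<dots> \<le> (\<Sum>ys\<leftarrow>zss. ?w ys * (\<Sum>y\<leftarrow>ys. NK (collapse y))
          + (1 / 2 * (if ?light ys then \<Sum>y\<leftarrow>ys. ?u y else 0) + \<omega> * (\<Sum>y\<leftarrow>ys. \<bar>ev (coord spread) y\<bar>)))"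
      proof (rule sum_list_mono)
        fix ys assume ys: "ys \<in> set zss"
        then have mL: "length ys \<in> L" using blocks(2) by (auto simp: lengths_ok_def)
        note Fm = L_large[OF mL]
        have abs0: "0 \<le> (\<Sum>y\<leftarrow>ys. \<bar>ev (coord spread) y\<bar>)" by (intro sum_list_nonneg) auto
        show "?w ys * (\<Sum>y\<leftarrow>ys. ev (coord spread) y) \<le> ?w ys * (\<Sum>y\<leftarrow>ys. NK (collapse y))
          + (1 / 2 * (if ?light ys then \<Sum>y\<leftarrow>ys. ?u y else 0) + \<omega> * (\<Sum>y\<leftarrow>ys. \<bar>ev (coord spread) y\<bar>))"
        proof (cases "?light ys")
          case True
          have "(\<Sum>y\<leftarrow>ys. ev (coord spread) y) \<le> (\<Sum>y\<leftarrow>ys. NK (collapse y) + ?u y)"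
            using IH in_zs[OF ys] by (intro sum_list_mono) auto
          also have "\<dots> = (\<Sum>y\<leftarrow>ys. NK (collapse y)) + (\<Sum>y\<leftarrow>ys. ?u y)" by (rule sum_list_addf)
          finally have "?w ys * (\<Sum>y\<leftarrow>ys. ev (coord spread) y)
              \<le> ?w ys * ((\<Sum>y\<leftarrow>ys. NK (collapse y)) + (\<Sum>y\<leftarrow>ys. ?u y))"
            using Fm by (intro mult_left_mono) auto
          moreover have "?w ys * (\<Sum>y\<leftarrow>ys. ?u y) \<le> 1 / 2 * (\<Sum>y\<leftarrow>ys. ?u y)"
            using Fm by (intro mult_right_mono sum_list_nonneg) (auto simp: pos divide_le_eq)
          ultimately have "?w ys * (\<Sum>y\<leftarrow>ys. ev (coord spread) y)
              \<le> ?w ys * (\<Sum>y\<leftarrow>ys. NK (collapse y)) + 1 / 2 * (\<Sum>y\<leftarrow>ys. ?u y)"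
            unfolding distrib_left[of "?w ys"] by linarith
          moreover have "0 \<le> \<omega> * (\<Sum>y\<leftarrow>ys. \<bar>ev (coord spread) y\<bar>)" using \<omega> abs0 by simp
          ultimately show ?thesis unfolding if_P[OF True] by linarith
        next
          case False
          then have "1 / logf (real (length ys)) \<le> \<omega>" using mL by (intro heavy(1)) auto
          moreover have "?w ys \<le> 1 / logf (real (length ys))" using Fm by (simp add: field_simps)
          ultimately have w\<omega>: "?w ys \<le> \<omega>" by linarith
          have "?w ys * (\<Sum>y\<leftarrow>ys. ev (coord spread) y) \<le> ?w ys * (\<Sum>y\<leftarrow>ys. \<bar>ev (coord spread) y\<bar>)"
            using Fm by (intro mult_left_mono sum_list_mono) auto
          also have "\<dots> \<le> \<omega> * (\<Sum>y\<leftarrow>ys. \<bar>ev (coord spread) y\<bar>)" by (rule mult_right_mono[OF w\<omega> abs0])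
          finally have "?w ys * (\<Sum>y\<leftarrow>ys. ev (coord spread) y) \<le> \<omega> * (\<Sum>y\<leftarrow>ys. \<bar>ev (coord spread) y\<bar>)" .
          moreover have "0 \<le> ?w ys * (\<Sum>y\<leftarrow>ys. NK (collapse y))"
            using Fm by (intro mult_nonneg_nonneg sum_list_nonneg) (auto simp: NK_nonneg)
          ultimately show ?thesis unfolding if_not_P[OF False] by linarith
        qed
      qed
      also have "\<dots> = (\<Sum>ys\<leftarrow>zss. ?w ys * (\<Sum>y\<leftarrow>ys. NK (collapse y)))
          + (1 / 2 * (\<Sum>ys\<leftarrow>zss. if ?light ys then \<Sum>y\<leftarrow>ys. ?u y else 0)
          + \<omega> * (\<Sum>ys\<leftarrow>zss. \<Sum>y\<leftarrow>ys. \<bar>ev (coord spread) y\<bar>))"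
        by (simp only: sum_list_addf sum_list_const_mult)
      also have "(\<Sum>ys\<leftarrow>zss. ?w ys * (\<Sum>y\<leftarrow>ys. NK (collapse y))) \<le> NK (collapse ?z)"
        using col blocks(3)[of "\<lambda>y. NK (collapse y)"] by linarith
      also have "(\<Sum>ys\<leftarrow>zss. if ?light ys then \<Sum>y\<leftarrow>ys. ?u y else 0) \<le> e * ?c + (real Q)\<^sup>2 * \<eta>"
      proof -
        have "(\<Sum>ys\<leftarrow>zss. if ?light ys then \<Sum>y\<leftarrow>ys. ?u y else 0)
            \<le> (\<Sum>ys\<leftarrow>zss. e * (\<Sum>y\<leftarrow>ys. crossings y) + (if ?light ys then real Q * \<eta> else 0))"
        proof (rule sum_list_mono)
          fix ys
          have "(\<Sum>y\<leftarrow>ys. ?u y) = e * (\<Sum>y\<leftarrow>ys. crossings y) + real (length ys) * \<eta>"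
            by (simp add: sum_list_addf sum_list_const_mult sum_list_triv)
          moreover have "?light ys \<Longrightarrow> real (length ys) * \<eta> \<le> real Q * \<eta>" using \<eta> by (intro mult_right_mono) auto
          moreover have "0 \<le> e * (\<Sum>y\<leftarrow>ys. crossings y)"
            using e0 by (intro mult_nonneg_nonneg sum_list_nonneg) (auto simp: crossings_nonneg)
          ultimately show "(if ?light ys then \<Sum>y\<leftarrow>ys. ?u y else 0)
              \<le> e * (\<Sum>y\<leftarrow>ys. crossings y) + (if ?light ys then real Q * \<eta> else 0)" by auto
        qed
        also have "\<dots> = e * (\<Sum>ys\<leftarrow>zss. \<Sum>y\<leftarrow>ys. crossings y) + (\<Sum>ys\<leftarrow>zss. if ?light ys then real Q * \<eta> else 0)"
          by (simp only: sum_list_addf sum_list_const_mult)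
        also have "(\<Sum>ys\<leftarrow>zss. \<Sum>y\<leftarrow>ys. crossings y) = (\<Sum>y\<leftarrow>zs. crossings y)"
          unfolding blocks(1) by (induction zss) auto
        also have "(\<Sum>ys\<leftarrow>zss. if ?light ys then real Q * \<eta> else 0) = real (length (filter ?light zss)) * (real Q * \<eta>)"
          by (induction zss) (auto simp: algebra_simps)
        also have "\<dots> \<le> real Q * (real Q * \<eta>)"
        proof (intro mult_right_mono)
          have "real (length (filter ?light zss)) \<le> real (length (filter (\<lambda>ys. length ys \<le> Q) zss))"
            by (induction zss) auto
          also have "\<dots> \<le> sqrt (logf (real Q)) / 4" using Q by (intro block_count_le[OF blocks(2)]) simp
          also have "\<dots> \<le> real Q"
          proof -
            have "sqrt (logf (real Q)) \<le> sqrt ((real Q)\<^sup>2)"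
            proof (rule real_sqrt_le_mono)
              have "logf (real Q) \<le> real Q" by (rule logf_le_of_nat)
              also have "real Q \<le> (real Q)\<^sup>2" using Q by (simp add: power2_eq_square)
              finally show "logf (real Q) \<le> (real Q)\<^sup>2" .
            qed
            then show ?thesis by simp
          qed
          finally show "real (length (filter ?light zss)) \<le> real Q" .
        qed (use \<eta> in simp)
        also have "e * (\<Sum>y\<leftarrow>zs. crossings y) \<le> e * ?c" by (rule mult_left_mono[OF cr e0])
        finally show ?thesis by (simp add: power2_eq_square mult.assoc)
      qed
      also have "(\<Sum>ys\<leftarrow>zss. \<Sum>y\<leftarrow>ys. \<bar>ev (coord spread) y\<bar>) \<le> norm A + logf (real N)"
      proof -
        have "(\<Sum>ys\<leftarrow>zss. \<Sum>y\<leftarrow>ys. \<bar>ev (coord spread) y\<bar>) = (\<Sum>y\<leftarrow>zs. \<bar>ev (coord spread) y\<bar>)"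
          unfolding blocks(1) by (induction zss) auto
        also have "\<dots> \<le> norm spread" using zsK abs_coord_K_le by (intro sum_abs_ev_le_norm node(3)) auto
        also note norm_spread_le
        finally show ?thesis .
      qed
      finally have "ev (coord spread) ?z
          \<le> NK (collapse ?z) + (1 / 2 * (e * ?c + (real Q)\<^sup>2 * \<eta>) + \<omega> * (norm A + logf (real N)))"
        using \<omega> by (simp add: mult_left_mono)
      moreover have "X \<le> Y + (E + \<eta>)"
        if "X \<le> Y + (1 / 2 * (E + q) + W)" "W \<le> h" "3 * (q + h) \<le> e" "e \<le> E" "0 \<le> q" for X Y E q W :: real
        using that h \<eta> by (simp add: field_simps)
      ultimately show ?thesis unfolding if_P[OF m] using heavy(2) e ec Q\<eta> by blast
    qed
  qed
qed

text \<open>A functional has at most two crossings, one on each side, and \<open>collapse z\<close>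
  never exceeds the norm of the vector before spreading.\<close>

lemma NK_spread_le:
  fixes Q :: nat and \<eta> h \<omega> :: real
  assumes flat: "\<And>n. 1 \<le> n \<Longrightarrow> n \<le> N \<Longrightarrow> logf (real N) / real N * (real n / logf (real n)) \<le> real n / real N + \<eta>"
    and Q: "2 \<le> Q" and \<eta>: "0 \<le> \<eta>" and h: "0 \<le> h" and \<omega>: "0 \<le> \<omega>"
    and hQ: "norm A / logf (real Q) \<le> h"
    and heavy: "\<And>m. m \<in> L \<Longrightarrow> Q \<le> m \<Longrightarrow> 1 / logf (real m) \<le> \<omega>" "\<omega> * (norm A + logf (real N)) \<le> h"
  shows "NK spread \<le> NK (A + Poly_Mapping.single d b) + (6 * ((real Q)\<^sup>2 * \<eta> + h) + \<eta>)"
proof (rule NK_least)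
  fix z assume z: "z \<in> K"
  let ?e = "3 * ((real Q)\<^sup>2 * \<eta> + h)"
  have e0: "0 \<le> ?e" using \<eta> h by simp
  have "crossings z \<le> 2" by (simp add: crossings_def)
  then have "?e * crossings z \<le> ?e * 2" using e0 by (rule mult_left_mono)
  then have "(if mid z then ?e * crossings z + \<eta> else 0) \<le> 2 * ?e + \<eta>" using e0 \<eta> by auto
  moreover have "ev (coord spread) z \<le> NK (collapse z) + (if mid z then ?e * crossings z + \<eta> else 0)"
    by (rule ev_spread_le[OF flat Q \<eta> h \<omega> hQ heavy order_refl z])
  ultimately show "ev (coord spread) z \<le> NK (A + Poly_Mapping.single d b) + (6 * ((real Q)\<^sup>2 * \<eta> + h) + \<eta>)"
    using NK_collapse_le[of z] by linarith
qed

end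

context lacunary
begin

text \<open>With \<open>\<eta> = 4 / l ^ 4\<close> the quantity \<open>Q^2 * \<eta>\<close> is of
  order \<open>1 / l ^ 2\<close>. The long special blocks cost about
  \<open>l ^ 4 / 2 ^ (16 * l ^ 4)\<close>, and long averages cost \<open>k / logf (l + 1)\<close>,
  the slowest of the errors. The threshold depends only on the norm bound \<open>k\<close> and on
  \<open>\<epsilon>\<close>, so \<open>A\<close> may later be any vector produced by earlier
  expansions.\<close>

lemma NK_spread_arbitrarily_close:
  assumes k: "0 \<le> k" and \<epsilon>: "0 < \<epsilon>"
  obtains l0 where "\<And>l A b D d. l \<in> L \<Longrightarrow> l0 \<le> l \<Longrightarrow> spread_block L A b D d \<Longrightarrow> norm A \<le> k \<Longrightarrow> card D = 4 ^ (l ^ 4)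
    \<Longrightarrow> NK (spread_block.spread A b D) \<le> NK (A + Poly_Mapping.single d b) + \<epsilon>"
proof -
  define C where "C = 6 * (32 + (3 * k + 6)) + 8"
  have C: "0 < C" using k by (simp add: C_def)
  define l0 where "l0 = nat \<lceil>2 powr (C / \<epsilon>)\<rceil>"
  show thesis
  proof (rule that[of l0])
    fix l A b D d
    assume l: "l \<in> L" "l0 \<le> l" and "spread_block L A b D d" and A: "norm A \<le> k" and D: "card D = 4 ^ (l ^ 4)"
    then interpret spread_block L A b D d by simp
    \<comment> \<open>All elements of \<open>L\<close> from \<open>?Q\<close> on are larger than
      \<open>l\<close>, so \<open>L_gap\<close> applies to them.\<close>
    let ?Q = "l + 1" and ?t = "real (l ^ 4)"
    let ?F = "logf (real ?Q)"
    let ?\<eta> = "4 / ?t"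
    let ?\<omega> = "1 / 2 ^ (16 * l ^ 4)"
    let ?h = "k / ?F + (k + 2 * ?t + 1) / ?t\<^sup>2"
    have l1: "256 \<le> l" using L_ge l by simp
    have lt: "real l \<le> ?t" using l1 by (simp add: self_le_power)
    have t1: "1 \<le> ?t" using lt l1 by simp
    have F: "1 \<le> ?F" by (intro logf_ge_1) simp
    have Fl: "?F \<le> 2 * real l" using logf_le_of_nat[of ?Q] l1 by simp
    have CF: "C / ?F \<le> \<epsilon>"
    proof -
      have "2 powr (C / \<epsilon>) \<le> real l" using l(2) by (simp add: l0_def nat_le_iff ceiling_le_iff)
      then have "log 2 (2 powr (C / \<epsilon>)) \<le> ?F" unfolding logf_def by (subst log_le_cancel_iff) auto
      then have "C / \<epsilon> \<le> ?F" by simp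
      then show ?thesis using \<epsilon> F by (simp add: divide_le_eq mult.commute)
    qed
    have pow: "?t\<^sup>2 \<le> 2 ^ (16 * l ^ 4)"
    proof -
      have "l ^ 4 < 2 ^ (l ^ 4)" by (rule less_exp)
      then have "?t \<le> 2 ^ (l ^ 4)" by (metis less_imp_le of_nat_le_numeral_power_cancel_iff)
      then have "?t\<^sup>2 \<le> (2 ^ (l ^ 4))\<^sup>2" by (intro power_mono) auto
      also have "\<dots> = 2 ^ (2 * l ^ 4)" by (simp add: power_mult[symmetric] mult.commute)
      also have "\<dots> \<le> 2 ^ (16 * l ^ 4)" by (intro power_increasing) auto
      finally show ?thesis .
    qed
    have FN: "logf (real N) \<le> 2 * ?t + 1" using logf_4_power(2)[of "l ^ 4"] by (simp add: D)
    have "NK spread \<le> NK (A + Poly_Mapping.single d b) + (6 * ((real ?Q)\<^sup>2 * ?\<eta> + ?h) + ?\<eta>)"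
    proof (rule NK_spread_le[where \<omega> = ?\<omega>])
      fix n assume "1 \<le> n" "n \<le> N"
      then show "logf (real N) / real N * (real n / logf (real n)) \<le> real n / real N + ?\<eta>"
        using flat_excess_le[of n "l ^ 4"] l1 by (simp add: D)
    next
      fix m assume "m \<in> L" "?Q \<le> m"
      then have "2 ^ (16 * l ^ 4) \<le> logf (real m)" using l by (intro L_gap) auto
      moreover have "0 < (2::real) ^ (16 * l ^ 4)" by simp
      ultimately show "1 / logf (real m) \<le> ?\<omega>" by (intro divide_left_mono mult_pos_pos) linarith+
    next
      have "norm A / ?F \<le> k / ?F" using A F by (intro divide_right_mono) auto
      moreover have "0 \<le> (k + 2 * ?t + 1) / ?t\<^sup>2" using k t1 by simp
      ultimately show "norm A / ?F \<le> ?h" by linarith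
    next
      have "?\<omega> * (norm A + logf (real N)) \<le> ?\<omega> * (k + (2 * ?t + 1))" using A FN by (intro mult_left_mono) auto
      also have "\<dots> \<le> (1 / ?t\<^sup>2) * (k + (2 * ?t + 1))"
      proof (intro mult_right_mono divide_left_mono pow)
        have "0 < ?t\<^sup>2" using l1 by simp
        then show "0 < 2 ^ (16 * l ^ 4) * ?t\<^sup>2" by (intro mult_pos_pos) simp_all
      qed (use k t1 in auto)
      also have "\<dots> = (k + 2 * ?t + 1) / ?t\<^sup>2" by (simp only: times_divide_eq_left mult_1_left add.assoc)
      also have "\<dots> \<le> ?h" using k F by simp
      finally show "?\<omega> * (norm A + logf (real N)) \<le> ?h" .
    qed (use k F l1 t1 in auto)
    moreover have "6 * ((real ?Q)\<^sup>2 * ?\<eta> + ?h) + ?\<eta> \<le> C / ?F"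
    proof -
      have \<eta>: "?\<eta> \<le> 8 / ?F"
      proof -
        have "4 / ?t \<le> 4 / real l" using lt l1 by (intro divide_left_mono) auto
        also have "\<dots> = 8 / (2 * real l)" by simp
        also have "\<dots> \<le> 8 / ?F" using Fl F by (intro divide_left_mono) auto
        finally show ?thesis .
      qed
      have Q: "(real ?Q)\<^sup>2 * ?\<eta> \<le> 32 / ?F"
      proof -
        have "(real ?Q)\<^sup>2 \<le> (2 * real l)\<^sup>2" using l1 by (intro power_mono) auto
        then have "(real ?Q)\<^sup>2 * ?\<eta> \<le> (2 * real l)\<^sup>2 * ?\<eta>" by (intro mult_right_mono) auto
        also have "\<dots> = 16 / (real l)\<^sup>2" using l1 by (simp add: field_simps eval_nat_numeral)
        also have "\<dots> \<le> 16 / real l" using l1 by (intro divide_left_mono) (auto simp: power2_eq_square)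
        also have "\<dots> = 32 / (2 * real l)" by simp
        also have "\<dots> \<le> 32 / ?F" using Fl F by (intro divide_left_mono) auto
        finally show ?thesis .
      qed
      have h2: "(k + 2 * ?t + 1) / ?t\<^sup>2 \<le> (2 * k + 6) / ?F"
      proof -
        have "k * 1 \<le> k * ?t" using k t1 by (intro mult_left_mono) auto
        then have "k + 2 * ?t + 1 \<le> (k + 3) * ?t" using t1 by (simp add: algebra_simps)
        then have "(k + 2 * ?t + 1) / ?t\<^sup>2 \<le> (k + 3) * ?t / ?t\<^sup>2" by (intro divide_right_mono) auto
        also have "\<dots> = (k + 3) / ?t" using l1 by (simp add: field_simps flip: power_add)
        also have "\<dots> \<le> (k + 3) / real l" using lt l1 k by (intro divide_left_mono) auto
        also have "\<dots> = (2 * k + 6) / (2 * real l)" using l1 by (simp add: divide_simps)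
        also have "\<dots> \<le> (2 * k + 6) / ?F" using Fl F k by (intro divide_left_mono) auto
        finally show ?thesis .
      qed
      have "6 * ((real ?Q)\<^sup>2 * ?\<eta> + ?h) + ?\<eta> \<le> 6 * (32 / ?F + (k / ?F + (2 * k + 6) / ?F)) + 8 / ?F"
        by (intro add_mono mult_left_mono \<eta> Q h2 order_refl) simp
      also have "\<dots> = C / ?F" by (simp add: C_def add_divide_distrib algebra_simps)
      finally show ?thesis .
    qed
    ultimately show "NK spread \<le> NK (A + Poly_Mapping.single d b) + \<epsilon>" using CF by linarith
  qed
qed

end

section \<open>Trees of averages\<close>

fun place :: "(nat \<Rightarrow> nat) \<Rightarrow> real list \<Rightarrow> c00" where
  "place h [] = 0"
| "place h (a # as) = Poly_Mapping.single (h 0) a + place (\<lambda>i. h (Suc i)) as"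

lemma place_append: "place h (as @ bs) = place h as + place (\<lambda>i. h (length as + i)) bs"
  by (induction as arbitrary: h) (auto simp: add.assoc)

lemma place_cong: "(\<And>i. i < length as \<Longrightarrow> h i = g i) \<Longrightarrow> place h as = place g as"
proof (induction as arbitrary: h g)
  case (Cons a as)
  have "place (\<lambda>i. h (Suc i)) as = place (\<lambda>i. g (Suc i)) as" using Cons.prems by (intro Cons.IH) auto
  then show ?case using Cons.prems[of 0] by simp
qed simp

lemma place_scale: "place h (map (\<lambda>a. k * a) as) = k *\<^sub>R place h as"
proof (induction as arbitrary: h)
  case (Cons a as)
  have "Poly_Mapping.single (h 0) (k * a) = k *\<^sub>R Poly_Mapping.single (h 0) a"
    by (rule poly_mapping_eqI) (simp add: lookup_single when_def)
  then show ?case using Cons by (simp add: scaleR_add_right)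
qed simp

lemma supp_place: "supp (place h as) \<subseteq> h ` {..<length as}"
proof (induction as arbitrary: h)
  case (Cons a as)
  have "supp (place h (a # as)) \<subseteq> supp (Poly_Mapping.single (h 0) a) \<union> supp (place (\<lambda>i. h (Suc i)) as)"
    using Poly_Mapping.keys_add[of "Poly_Mapping.single (h 0) a" "place (\<lambda>i. h (Suc i)) as"]
    by (simp only: place.simps)
  also have "\<dots> \<subseteq> {h 0} \<union> (\<lambda>i. h (Suc i)) ` {..<length as}" using Cons by (intro Un_mono) auto
  also have "\<dots> \<subseteq> h ` {..<length (a # as)}" by auto
  finally show ?case .
qed simp

lemma place_replicate:
  "inj_on h {..<k} \<Longrightarrow> place h (replicate k a) = (\<Sum>j\<in>h ` {..<k}. Poly_Mapping.single j a)"
proof (induction k arbitrary: h)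
  case (Suc k)
  have "inj_on (\<lambda>i. h (Suc i)) {..<k}" using Suc.prems by (auto simp: inj_on_def)
  moreover have "h ` {..<Suc k} = insert (h 0) ((\<lambda>i. h (Suc i)) ` {..<k})"
    by (simp add: lessThan_Suc_eq_insert_0 image_image)
  moreover have "h 0 \<notin> (\<lambda>i. h (Suc i)) ` {..<k}" using Suc.prems by (auto simp: inj_on_def)
  ultimately show ?case using Suc.IH by simp
qed simp

lemma norm_single_c00: "norm (Poly_Mapping.single n a :: c00) = \<bar>a\<bar>"
  by (cases "a = 0") (auto simp: norm_c00)

lemma norm_place_le: "(\<And>a. a \<in> set as \<Longrightarrow> \<bar>a\<bar> \<le> 1) \<Longrightarrow> norm (place h as) \<le> real (length as)"
proof (induction as arbitrary: h)
  case (Cons a as)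
  have "norm (place h (a # as)) \<le> norm (Poly_Mapping.single (h 0) a :: c00) + norm (place (\<lambda>i. h (Suc i)) as)"
    by (simp add: norm_triangle_ineq)
  also have "\<dots> \<le> 1 + real (length as)" using Cons by (intro add_mono) (auto simp: norm_single_c00)
  finally show ?case by simp
qed simp

lemma place_concat:
  "place (\<lambda>i. s + i) (concat (map g [0..<k]))
    = (\<Sum>t<k. place (\<lambda>i. s + (\<Sum>t'<t. length (g t')) + i) (g t))"
proof (induction k)
  case (Suc k)
  have "length (concat (map g [0..<k])) = (\<Sum>t<k. length (g t))" by (induction k) auto
  then show ?case using Suc by (simp add: place_append add.assoc)
qed simp

lemma ev_place_place:
  assumes "strict_mono h" "length as = length bs"
  shows "ev (coord (place h as)) (place h bs) = (\<Sum>(a, b)\<leftarrow>zip as bs. a * b)"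
  using assms(2,1)
proof (induction as bs arbitrary: h rule: list_induct2)
  case (Cons a as b bs)
  let ?h = "\<lambda>i. h (Suc i)"
  have mono: "strict_mono ?h" using Cons.prems by (auto simp: strict_mono_def)
  have "h 0 \<notin> range ?h" using Cons.prems by (auto dest: strict_mono_eq)
  then have z: "coord (place ?h cs) (h 0) = 0" for cs using supp_place[of ?h cs] by (auto simp: in_keys_iff)
  have "ev (coord (Poly_Mapping.single (h 0) a)) (place ?h bs) = a * coord (place ?h bs) (h 0)"
    by (simp add: ev_coord_commute[of "Poly_Mapping.single _ _"])
  moreover have a: "coord (Poly_Mapping.single (h 0) a + place ?h as) (h 0) = a"
    using z by (simp add: lookup_add)
  ultimately show ?case using Cons.IH[OF mono] z by (simp add: ev_add ev_coord_add)
qed simp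

text \<open>
  The nodes of an infinite tree are numbered breadth first: node \<open>r\<close> has the \<open>N r\<close> successors
  \<open>first_child r + t\<close>. In the \<open>n\<close>-th finite tree the nodes below \<open>n\<close> are expanded and the others are leaves.
  An entry of \<open>leaves n r\<close> holds a leaf below \<open>r\<close>, the coefficient of the functional, where each expansion is
  an average with weight \<open>1 / f(N r)\<close>, and the coefficient of the vector, where each expansion is a
  normalized constant vector.
\<close>

locale tree = lacunary +
  fixes N l :: "nat \<Rightarrow> nat"
  assumes l_in_L: "l r \<in> L"
    and N_eq: "N r = 4 ^ (l r ^ 4)"
    and sum_N_less_l: "(\<Sum>i<r. N i) < l r"
    and prod_N_le_l: "(\<Prod>i<r. N i) \<le> l r"
    and NK_spread_N: "spread_block L A b D d \<Longrightarrow> norm A \<le> 1 + real (\<Sum>i<r. N i) \<Longrightarrow> card D = N r \<Longrightarrow>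
      NK (spread_block.spread A b D) \<le> NK (A + Poly_Mapping.single d b) + (1 / 2) ^ Suc r"
begin

definition first_child :: "nat \<Rightarrow> nat" where
  "first_child r = Suc (\<Sum>i<r. N i)"

abbreviation "f r \<equiv> logf (real (N r))"

lemma l_le_N: "l r \<le> N r"
proof -
  have "l r \<le> l r ^ 4" using L_ge[OF l_in_L[of r]] by (simp add: self_le_power)
  also have "\<dots> < 4 ^ (l r ^ 4)" by (rule less_le_trans[OF less_exp]) (simp add: power_mono)
  finally show ?thesis by (simp add: N_eq)
qed

lemma N_ge: "256 \<le> N r"
  using L_ge[OF l_in_L[of r]] l_le_N[of r] by linarith

lemma strict_mono_N: "strict_mono N"
proof (rule strict_monoI_Suc)
  fix r
  have "N r \<le> (\<Sum>i<Suc r. N i)" by simp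
  also have "\<dots> < l (Suc r)" by (rule sum_N_less_l)
  also note l_le_N
  finally show "N r < N (Suc r)" .
qed

lemma f_ge_1: "1 \<le> f r"
  using N_ge[of r] by (intro logf_ge_1) simp

lemma first_child_Suc: "first_child (Suc r) = first_child r + N r"
  by (simp add: first_child_def)

lemma first_child_gt: "r < first_child r"
proof (induction r)
  case (Suc r)
  then show ?case using N_ge[of r] by (simp add: first_child_Suc)
qed (simp add: first_child_def)

lemma first_child_mono: "r \<le> s \<Longrightarrow> first_child r \<le> first_child s"
  by (simp add: first_child_def sum_mono2)

function leaves :: "nat \<Rightarrow> nat \<Rightarrow> (nat \<times> real \<times> real) list" where
  "leaves n r = (if n \<le> r then [(r, 1, 1)] else concat (map (\<lambda>t.
     map (\<lambda>(i, \<beta>, v). (i, 1 / f r * \<beta>, f r / real (N r) * v)) (leaves n (first_child r + t))) [0..<N r]))"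
  by auto
termination
proof (relation "Wellfounded.measure (\<lambda>(n, r). n - r)")
  fix n r t assume "\<not> n \<le> r" "t \<in> set [0..<N r]"
  then show "((n, first_child r + t), n, r) \<in> Wellfounded.measure (\<lambda>(n, r). n - r)"
    using first_child_gt[of r] by auto
qed simp

declare leaves.simps [simp del]

lemma leaves_leaf: "n \<le> r \<Longrightarrow> leaves n r = [(r, 1, 1)]"
  by (simp add: leaves.simps)

lemma leaves_node: "r < n \<Longrightarrow> leaves n r = concat (map (\<lambda>t.
    map (\<lambda>(i, \<beta>, v). (i, 1 / f r * \<beta>, f r / real (N r) * v)) (leaves n (first_child r + t))) [0..<N r])"
  by (subst leaves.simps) auto

definition ycoef :: "nat \<Rightarrow> nat \<Rightarrow> real list" where "ycoef n r = map (\<lambda>(i, \<beta>, v). \<beta>) (leaves n r)"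
definition vcoef :: "nat \<Rightarrow> nat \<Rightarrow> real list" where "vcoef n r = map (\<lambda>(i, \<beta>, v). v) (leaves n r)"

text \<open>An expansion multiplies the product of the two coefficients by \<open>1 / N r\<close>
  and replaces one entry by \<open>N r\<close> entries.\<close>

lemma sum_list_ycoef_vcoef: "(\<Sum>(i, \<beta>, v)\<leftarrow>leaves n r. \<beta> * v) = 1"
proof (induction n r rule: leaves.induct)
  case (1 n r)
  show ?case
  proof (cases "n \<le> r")
    case False
    have N: "0 < N r" using N_ge[of r] by simp
    have F: "f r \<noteq> 0" using f_ge_1[of r] by simp
    have sc: "(\<Sum>(i, \<beta>, v)\<leftarrow>map (\<lambda>(i, \<beta>, v). (i, 1 / f r * \<beta>, f r / real (N r) * v)) xs. \<beta> * v)
        = 1 / real (N r) * (\<Sum>(i, \<beta>, v)\<leftarrow>xs. \<beta> * v)" for xs :: "(nat \<times> real \<times> real) list"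
      by (induction xs) (use F in \<open>auto simp: add_divide_distrib\<close>)
    have sum_concat: "sum_list (map h (concat (map G xs))) = (\<Sum>x\<leftarrow>xs. sum_list (map h (G x)))"
      for h :: "nat \<times> real \<times> real \<Rightarrow> real" and G :: "nat \<Rightarrow> (nat \<times> real \<times> real) list" and xs
      by (induction xs) auto
    have "(\<Sum>(i, \<beta>, v)\<leftarrow>leaves n r. \<beta> * v) = (\<Sum>t\<leftarrow>[0..<N r]. 1 / real (N r) * (\<Sum>(i, \<beta>, v)\<leftarrow>leaves n (first_child r + t). \<beta> * v))"
      using False by (simp only: leaves_node not_le sum_concat sc)
    also have "\<dots> = (\<Sum>t\<leftarrow>[0..<N r]. 1 / real (N r))"
      using 1 False by (intro arg_cong[of _ _ sum_list] map_cong refl) auto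
    also have "\<dots> = 1" using N by (simp add: sum_list_triv)
    finally show ?thesis .
  qed (simp add: leaves_leaf)
qed

lemma length_ycoef: "length (ycoef n r) = length (vcoef n r)"
  by (simp add: ycoef_def vcoef_def)

lemma ev_ycoef_vcoef:
  assumes "strict_mono h"
  shows "ev (coord (place h (vcoef n r))) (place h (ycoef n r)) = 1"
proof -
  have "(\<Sum>(a, b)\<leftarrow>zip (vcoef n r) (ycoef n r). a * b) = (\<Sum>(i, \<beta>, v)\<leftarrow>leaves n r. \<beta> * v)"
    unfolding ycoef_def vcoef_def
    by (induction "leaves n r") (auto simp: zip_map_map zip_same_conv_map comp_def case_prod_beta mult.commute)
  then show ?thesis using assms by (simp add: ev_place_place length_ycoef sum_list_ycoef_vcoef)
qed

lemma ycoef_leaf: "n \<le> r \<Longrightarrow> ycoef n r = [1]"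
  by (simp add: ycoef_def leaves_leaf)

lemma ycoef_node: "r < n \<Longrightarrow>
    ycoef n r = concat (map (\<lambda>t. map (\<lambda>a. 1 / f r * a) (ycoef n (first_child r + t))) [0..<N r])"
  by (simp add: ycoef_def leaves_node map_concat comp_def case_prod_beta)

definition expand :: "nat \<Rightarrow> nat \<times> real \<times> real \<Rightarrow> (nat \<times> real \<times> real) list" where
  "expand n = (\<lambda>(i, \<beta>, v). if i = n
     then map (\<lambda>t. (first_child n + t, 1 / f n * \<beta>, f n / real (N n) * v)) [0..<N n] else [(i, \<beta>, v)])"

text \<open>The recursion of \<open>leaves\<close> unfolds a tree at its root, whereas the norm
  estimate compares consecutive trees. This lemma translates: the next tree arises by expanding the
  leaf numbered \<open>n\<close>.\<close>

lemma leaves_Suc: "r \<le> n \<Longrightarrow> leaves (Suc n) r = concat (map (expand n) (leaves n r))"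
proof (induction n r rule: leaves.induct)
  case (1 n r)
  show ?case
  proof (cases "n = r")
    case True
    have "leaves (Suc n) (first_child n + t) = [(first_child n + t, 1, 1)]" for t
      using first_child_gt[of n] by (intro leaves_leaf) simp
    then have "leaves (Suc n) n = concat (map (\<lambda>t. [(first_child n + t, 1 / f n, f n / real (N n))]) [0..<N n])"
      by (subst leaves_node) auto
    then show ?thesis using True by (simp add: leaves_leaf expand_def concat_map_singleton)
  next
    case False
    then have rn: "r < n" using 1 by simp
    let ?s = "\<lambda>(i, \<beta>, v). (i::nat, 1 / f r * \<beta>, f r / real (N r) * v)"
    have child: "leaves (Suc n) (first_child r + t) = concat (map (expand n) (leaves n (first_child r + t)))"
      if "t < N r" for t
    proof (cases "first_child r + t \<le> n")
      case True
      then show ?thesis using 1 rn that by simp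
    next
      case False
      then show ?thesis by (simp add: leaves_leaf expand_def)
    qed
    have ex: "expand n (?s x) = map ?s (expand n x)" for x
      by (auto simp: expand_def mult_ac split: prod.splits)
    have "leaves (Suc n) r = concat (map (\<lambda>t. map ?s (leaves (Suc n) (first_child r + t))) [0..<N r])"
      using rn by (intro leaves_node) simp
    also have "\<dots> = concat (map (\<lambda>t. concat (map (expand n) (map ?s (leaves n (first_child r + t))))) [0..<N r])"
    proof (intro arg_cong[of _ _ concat] map_cong refl)
      fix t assume "t \<in> set [0..<N r]"
      then have "leaves (Suc n) (first_child r + t) = concat (map (expand n) (leaves n (first_child r + t)))"
        by (intro child) simp
      then show "map ?s (leaves (Suc n) (first_child r + t))
          = concat (map (expand n) (map ?s (leaves n (first_child r + t))))"
        by (simp only: map_concat map_map comp_def ex)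
    qed
    also have "\<dots> = concat (map (expand n) (leaves n r))"
    proof -
      have "concat (map E (concat (map G xs))) = concat (map (\<lambda>t. concat (map E (G t))) xs)"
        for E :: "nat \<times> real \<times> real \<Rightarrow> (nat \<times> real \<times> real) list" and G :: "nat \<Rightarrow> _" and xs
        by (induction xs) auto
      then show ?thesis by (simp only: leaves_node[OF rn])
    qed
    finally show ?thesis .
  qed
qed

text \<open>By the breadth-first numbering the leaf \<open>n\<close> to be expanded next occurs
  exactly once. The count of the leaves together with the bound on the coefficients gives the bound
  on the \<open>\<ell>\<^sub>1\<close>-norm assumed in \<open>NK_spread_N\<close>.\<close>

lemma leaves_expand_split:
  "distinct (map fst (leaves n 0)) \<and> set (map fst (leaves n 0)) = {n..<first_child n} \<and>
   (\<forall>(i, \<beta>, v)\<in>set (leaves n 0). 0 \<le> v \<and> v \<le> 1)"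
proof (induction n)
  case 0
  then show ?case by (simp add: leaves_leaf first_child_def)
next
  case (Suc n)
  have "n \<in> set (map fst (leaves n 0))" using Suc first_child_gt[of n] by simp
  then obtain \<beta> v where "(n, \<beta>, v) \<in> set (leaves n 0)" by force
  then obtain us ws where s: "leaves n 0 = us @ (n, \<beta>, v) # ws" by (metis split_list)
  have n: "n \<notin> set (map fst us)" "n \<notin> set (map fst ws)" using Suc s by auto
  have id: "concat (map (expand n) xs) = xs" if "n \<notin> set (map fst xs)" for xs
    using that by (induction xs) (auto simp: expand_def)
  let ?new = "map (\<lambda>t. (first_child n + t, 1 / f n * \<beta>, f n / real (N n) * v)) [0..<N n]"
  have e: "leaves (Suc n) 0 = us @ ?new @ ws"
    using leaves_Suc[of 0 n] id[OF n(1)] id[OF n(2)] by (simp add: s expand_def)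
  have ids: "map fst (leaves (Suc n) 0) = map fst us @ [first_child n..<first_child (Suc n)] @ map fst ws"
  proof -
    have "map fst ?new = [first_child n..<first_child (Suc n)]"
      by (rule nth_equalityI) (simp_all add: first_child_Suc)
    then show ?thesis by (simp add: e)
  qed
  have un: "set (map fst us) \<union> set (map fst ws) = {Suc n..<first_child n}"
  proof -
    have "set (map fst us) \<union> set (map fst ws) = set (map fst (leaves n 0)) - {n}" using s n by auto
    also have "\<dots> = {n..<first_child n} - {n}" using Suc by simp
    also have "\<dots> = {Suc n..<first_child n}" by auto
    finally show ?thesis .
  qed
  have "f n / real (N n) \<le> 1" using logf_le_of_nat[of "N n"] N_ge[of n] by simp
  moreover have "0 \<le> v" "v \<le> 1" using Suc s by auto
  ultimately have v: "0 \<le> f n / real (N n) * v" "f n / real (N n) * v \<le> 1"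
    using f_ge_1[of n] mult_mono[of "f n / real (N n)" 1 v 1] by auto
  have "distinct (map fst us @ map fst ws)" using Suc s by auto
  moreover have "x < first_child n" if "x \<in> set (map fst us) \<union> set (map fst ws)" for x
    using that unfolding un by simp
  then have "set (map fst us) \<inter> {first_child n..<first_child (Suc n)} = {}"
    "set (map fst ws) \<inter> {first_child n..<first_child (Suc n)} = {}" by fastforce+
  ultimately have "distinct (map fst (leaves (Suc n) 0))"
    unfolding ids distinct_append set_append set_upt by (simp add: Int_commute Int_Un_distrib2 Int_Un_distrib)
  moreover have "set (map fst (leaves (Suc n) 0)) = {Suc n..<first_child (Suc n)}"
  proof -
    have "set (map fst (leaves (Suc n) 0)) = {Suc n..<first_child n} \<union> {first_child n..<first_child (Suc n)}"
      unfolding ids using un by auto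
    also have "\<dots> = {Suc n..<first_child (Suc n)}"
      using first_child_gt[of n] by (intro ivl_disj_un_two(3)) (auto simp: first_child_Suc)
    finally show ?thesis .
  qed
  moreover have "\<forall>(i, \<beta>, v)\<in>set (leaves (Suc n) 0). 0 \<le> v \<and> v \<le> 1"
  proof
    fix x assume "x \<in> set (leaves (Suc n) 0)"
    then have "x \<in> set (leaves n 0) \<or> x \<in> set ?new" unfolding e s by auto
    then show "case x of (i, \<beta>, v) \<Rightarrow> 0 \<le> v \<and> v \<le> 1"
    proof
      assume "x \<in> set ?new"
      then obtain t where "x = (first_child n + t, 1 / f n * \<beta>, f n / real (N n) * v)" by auto
      then show ?thesis using v by (simp only: prod.case)
    qed (use Suc in blast)
  qed
  ultimately show ?case by blast
qed

text \<open>The next vector is the present one with its coordinate at leaf \<open>n\<close> spread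
  over \<open>N n\<close> positions. Removing all but the first of these positions changes the
  placement, so the induction runs over all strictly increasing placements \<open>h\<close> at
  once.\<close>

lemma NK_place_vcoef_le:
  "strict_mono h \<Longrightarrow> NK (place h (vcoef n 0)) \<le> 1 + (\<Sum>i<n. (1 / 2) ^ Suc i)"
proof (induction n arbitrary: h)
  case 0
  have "NK (place h (vcoef 0 0)) \<le> norm (place h (vcoef 0 0))" by (rule NK_le_norm)
  then show ?case by (simp add: vcoef_def leaves_leaf norm_single_c00)
next
  case (Suc n)
  note E = leaves_expand_split[of n]
  have "n \<in> set (map fst (leaves n 0))" using E first_child_gt[of n] by simp
  then obtain \<beta> b where "(n, \<beta>, b) \<in> set (leaves n 0)" by force
  then obtain us ws where s: "leaves n 0 = us @ (n, \<beta>, b) # ws" by (metis split_list)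
  have n: "n \<notin> set (map fst us)" "n \<notin> set (map fst ws)" using E s by auto
  have id: "concat (map (expand n) xs) = xs" if "n \<notin> set (map fst xs)" for xs
    using that by (induction xs) (auto simp: expand_def)
  have e: "leaves (Suc n) 0 = us @ map (\<lambda>t. (first_child n + t, 1 / f n * \<beta>, f n / real (N n) * b)) [0..<N n] @ ws"
    using leaves_Suc[of 0 n] id[OF n(1)] id[OF n(2)] by (simp add: s expand_def)
  let ?v = "\<lambda>(i::nat, \<beta>::real, v::real). v"
  let ?us = "map ?v us" and ?ws = "map ?v ws" and ?k = "N n" and ?U = "length us"
  let ?a = "b * (f n / real (N n))"
  have vn: "vcoef n 0 = ?us @ [b] @ ?ws" by (simp add: vcoef_def s)
  have vS: "vcoef (Suc n) 0 = ?us @ replicate ?k ?a @ ?ws"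
    by (simp add: vcoef_def e comp_def map_replicate_const mult.commute)
  have k: "1 \<le> ?k" using N_ge[of n] by simp
  \<comment> \<open>The positions of the block are merged into its first one; later entries keep
    their places by skipping the other \<open>?k - 1\<close> positions.\<close>
  define h' where "h' i = (if i \<le> ?U then h i else h (i + ?k - 1))" for i
  have h: "h i < h j" if "i < j" for i j using Suc.prems that by (simp add: strict_mono_def)
  have h': "strict_mono h'" unfolding strict_mono_def
  proof (intro allI impI)
    fix i j :: nat assume "i < j"
    then show "h' i < h' j" unfolding h'_def using k by (cases "i \<le> ?U"; cases "j \<le> ?U") (simp_all add: h)
  qed
  define A where "A = place h ?us + place (\<lambda>i. h (?U + (?k + i))) ?ws"
  define D where "D = h ` {?U..<?U + ?k}"
  have D: "D = (\<lambda>i. h (?U + i)) ` {..<?k}"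
  proof -
    have "{?U..<?U + ?k} = (\<lambda>i. ?U + i) ` {0..<?k}" by (simp add: add.commute)
    then show ?thesis unfolding D_def by (simp only: image_image lessThan_atLeast0)
  qed
  have inj: "inj_on (\<lambda>i. h (?U + i)) {..<?k}"
    by (intro inj_onI) (use strict_mono_eq[OF Suc.prems] in simp)
  have cD: "card D = ?k" unfolding D by (simp add: card_image inj)
  have b01: "0 \<le> b" "b \<le> 1" using E s by auto
  have B: "spread_block L A b D (h ?U)"
  proof
    show "finite D" "h ?U \<in> D" using k by (auto simp: D_def)
    fix i assume "i \<in> supp A"
    then have "i \<in> supp (place h ?us) \<union> supp (place (\<lambda>i. h (?U + (?k + i))) ?ws)"
      unfolding A_def by (rule subsetD[OF Poly_Mapping.keys_add])
    then have "i \<in> h ` {..<?U} \<or> i \<in> (\<lambda>i. h (?U + (?k + i))) ` {..<length ws}"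
      using supp_place[of h ?us] supp_place[of "\<lambda>i. h (?U + (?k + i))" ?ws]
      by (simp only: length_map) blast
    then show "(\<forall>j\<in>D. i < j) \<or> (\<forall>j\<in>D. j < i)"
    proof
      assume "i \<in> h ` {..<?U}"
      then obtain t where "t < ?U" "i = h t" by blast
      then have "\<forall>j\<in>D. i < j" unfolding D_def by (auto intro: h)
      then show ?thesis ..
    next
      assume "i \<in> (\<lambda>i. h (?U + (?k + i))) ` {..<length ws}"
      then obtain t where "i = h (?U + (?k + t))" by blast
      then have "\<forall>j\<in>D. j < i" unfolding D_def by (auto intro: h)
      then show ?thesis ..
    qed
  qed (use b01 in auto)
  have nA: "norm A \<le> 1 + real (\<Sum>i<n. N i)"
  proof -
    have "norm A \<le> norm (place h ?us) + norm (place (\<lambda>i. h (?U + (?k + i))) ?ws)"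
      unfolding A_def by (rule norm_triangle_ineq)
    also have "\<dots> \<le> real (length ?us) + real (length ?ws)"
    proof (intro add_mono norm_place_le)
      have v01: "\<bar>?v x\<bar> \<le> 1" if "x \<in> set (leaves n 0)" for x using E that by (cases x) auto
      fix a assume "a \<in> set ?us"
      then obtain x where "x \<in> set us" "a = ?v x" by (auto simp only: set_map)
      then show "\<bar>a\<bar> \<le> 1" using v01[of x] by (simp add: s)
    next
      have v01: "\<bar>?v x\<bar> \<le> 1" if "x \<in> set (leaves n 0)" for x using E that by (cases x) auto
      fix a assume "a \<in> set ?ws"
      then obtain x where "x \<in> set ws" "a = ?v x" by (auto simp only: set_map)
      then show "\<bar>a\<bar> \<le> 1" using v01[of x] by (simp add: s)
    qed
    also have "\<dots> \<le> real (length (leaves n 0))" by (simp add: s)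
    also have "length (leaves n 0) = card {n..<first_child n}"
      using E by (metis distinct_card length_map)
    also have "\<dots> \<le> first_child n" by simp
    finally show ?thesis by (simp add: first_child_def)
  qed
  have "place h (vcoef (Suc n) 0) = spread_block.spread A b D"
  proof -
    have "place (\<lambda>i. h (?U + i)) (replicate ?k ?a) = (\<Sum>j\<in>D. Poly_Mapping.single j ?a)"
      unfolding D by (rule place_replicate[OF inj])
    then show ?thesis
      unfolding spread_block.spread_def[OF B] cD
      unfolding vS place_append A_def length_map length_replicate
      by (simp only: add.assoc add.left_commute add.commute)
  qed
  moreover have "place h' (vcoef n 0) = A + Poly_Mapping.single (h ?U) b"
  proof -
    have "place h' ?us = place h ?us" by (rule place_cong) (simp add: h'_def)
    moreover have "place (\<lambda>i. h' (Suc (?U + i))) ?ws = place (\<lambda>i. h (?U + (?k + i))) ?ws"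
      using k by (intro place_cong) (simp add: h'_def algebra_simps)
    ultimately show ?thesis unfolding vn by (simp add: place_append A_def h'_def add_ac)
  qed
  ultimately have "NK (place h (vcoef (Suc n) 0)) \<le> NK (place h' (vcoef n 0)) + (1 / 2) ^ Suc n"
    using NK_spread_N[OF B nA cD] by simp
  also have "\<dots> \<le> 1 + (\<Sum>i<Suc n. (1 / 2) ^ Suc i)" using Suc.IH[OF h'] by simp
  finally show ?case .
qed

lemma NK_place_vcoef_le_2: "strict_mono h \<Longrightarrow> NK (place h (vcoef n 0)) \<le> 2"
proof -
  assume "strict_mono h"
  then have "NK (place h (vcoef n 0)) \<le> 1 + (\<Sum>i<n. (1 / 2) ^ Suc i)" by (rule NK_place_vcoef_le)
  also have "(\<Sum>i<n. (1 / 2) ^ Suc i) = 1 - (1 / 2 :: real) ^ n" by (induction n) auto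
  finally show ?thesis by (simp add: order_trans)
qed

end

context lacunary
begin

text \<open>The requirement on \<open>l r\<close> involves all earlier lengths, through their sum,
  their product and the norm bound for \<open>A\<close>. Hence the choice is made over initial
  segments, kept as lists each of which extends the previous one.\<close>

lemma tree_exists: obtains N l where "tree L N l"
proof -
  define good where "good = (\<lambda>r (xs :: (nat \<times> nat) list) (y :: nat \<times> nat).
    snd y \<in> L \<and> fst y = 4 ^ (snd y ^ 4) \<and> sum_list (map fst xs) < snd y \<and> prod_list (map fst xs) \<le> snd y \<and>
    (\<forall>A b D d. spread_block L A b D d \<longrightarrow> norm A \<le> 1 + real (sum_list (map fst xs)) \<longrightarrow> card D = fst y \<longrightarrow>
      NK (spread_block.spread A b D) \<le> NK (A + Poly_Mapping.single d b) + (1 / 2) ^ Suc r))"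
  have ex: "\<exists>y. good r xs y" for r xs
  proof -
    obtain l0 where l0: "\<And>l A b D d. l \<in> L \<Longrightarrow> l0 \<le> l \<Longrightarrow> spread_block L A b D d \<Longrightarrow>
        norm A \<le> 1 + real (sum_list (map fst xs)) \<Longrightarrow> card D = 4 ^ (l ^ 4) \<Longrightarrow>
        NK (spread_block.spread A b D) \<le> NK (A + Poly_Mapping.single d b) + (1 / 2) ^ Suc r"
      by (rule NK_spread_arbitrarily_close[of "1 + real (sum_list (map fst xs))" "(1 / 2) ^ Suc r"]) auto
    obtain l where l: "l \<in> L" "l0 + sum_list (map fst xs) + prod_list (map fst xs) < l"
      using infinite_L by (metis infinite_nat_iff_unbounded)
    show ?thesis unfolding good_def
      by (rule exI[of _ "(4 ^ (l ^ 4), l)"]) (use l l0[OF l(1)] in auto)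
  qed
  obtain G where G: "\<And>n. length (G n) = n" "\<And>n. \<exists>y. G (Suc n) = G n @ [y] \<and> good n (G n) y"
  proof -
    have "\<exists>G. \<forall>n. length (G n) = n \<and> (\<exists>y. G (Suc n) = G n @ [y] \<and> good n (G n) y)"
    proof (rule dependent_nat_choice)
      fix xs :: "(nat \<times> nat) list" and n assume "length xs = n"
      then show "\<exists>ys. length ys = Suc n \<and> (\<exists>y. ys = xs @ [y] \<and> good n xs y)"
      proof -
        obtain y where "good n xs y" using ex[of n xs] by blast
        then have "length (xs @ [y]) = Suc n \<and> (\<exists>y'. xs @ [y] = xs @ [y'] \<and> good n xs y')"
          using \<open>length xs = n\<close> by auto
        then show ?thesis by blast
      qed
    qed simp
    then show thesis using that by blast
  qed
  define N where "N n = fst (last (G (Suc n)))" for n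
  define l where "l n = snd (last (G (Suc n)))" for n
  have step: "G (Suc n) = G n @ [(N n, l n)]" "good n (G n) (N n, l n)" for n
    using G(2)[of n] by (auto simp: N_def l_def)
  have GN: "map fst (G n) = map N [0..<n]" for n
    using G(1)[of 0] by (induction n) (auto simp: step(1))
  have s: "sum_list (map fst (G n)) = (\<Sum>i<n. N i)" for n
    unfolding GN by (simp add: interv_sum_list_conv_sum_set_nat lessThan_atLeast0)
  have p: "prod_list (map fst (G n)) = (\<Prod>i<n. N i)" for n
    unfolding GN by (induction n) (auto simp: mult.commute)
  have "tree L N l"
  proof
    fix r
    show "l r \<in> L" "N r = 4 ^ (l r ^ 4)" "(\<Sum>i<r. N i) < l r" "(\<Prod>i<r. N i) \<le> l r"
      using step(2)[of r] unfolding good_def s p by auto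
  next
    fix A b D d r
    assume "spread_block L A b D d" "norm A \<le> 1 + real (\<Sum>i<r. N i)" "card D = N r"
    then show "NK (spread_block.spread A b D) \<le> NK (A + Poly_Mapping.single d b) + (1 / 2) ^ Suc r"
      using step(2)[of r] unfolding good_def s p by auto
  qed
  then show thesis by (rule that)
qed

end

section \<open>Multipliers built from the trees\<close>

definition interval_hull :: "nat set \<Rightarrow> nat set" where
  "interval_hull S = {i. \<exists>a\<in>S. \<exists>b\<in>S. a \<le> i \<and> i \<le> b}"

lemma interval_hull_superset: "S \<subseteq> interval_hull S"
  by (auto simp: interval_hull_def)

lemma nat_interval_interval_hull: "nat_interval (interval_hull S)"
  unfolding nat_interval_def interval_hull_def by (blast intro: order_trans)

lemma interval_hull_least: assumes "nat_interval I" "S \<subseteq> I" shows "interval_hull S \<subseteq> I"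
proof
  fix i assume "i \<in> interval_hull S"
  then obtain a b where "a \<in> S" "b \<in> S" "a \<le> i" "i \<le> b" by (auto simp: interval_hull_def)
  then show "i \<in> I" using assms unfolding nat_interval_def by (meson subsetD)
qed

lemma set_less_interval_hull:
  assumes "set_less S T" shows "set_less (interval_hull S) (interval_hull T)"
  unfolding set_less_def
proof (intro ballI)
  fix i j assume "i \<in> interval_hull S" "j \<in> interval_hull T"
  then obtain a b where ab: "a \<in> S" "i \<le> a" "b \<in> T" "b \<le> j" by (auto simp: interval_hull_def)
  then have "a < b" using assms by (auto simp: set_less_def)
  with ab show "i < j" by linarith
qed

lemma set_less_subset: "set_less S T \<Longrightarrow> S' \<subseteq> S \<Longrightarrow> T' \<subseteq> T \<Longrightarrow> set_less S' T'"
  unfolding set_less_def by blast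

text \<open>The properties shared by the norms of \<open>S\<close> and \<open>GM\<close>. They are
  restricted to intervals because only restrictions to intervals are built into the functionals of
  \<open>GM\<close>. Allowing fewer than \<open>q\<close> sets includes monotonicity, as the case
  \<open>q = 1\<close>.\<close>

locale averaging_seminorm =
  fixes p :: "c00 \<Rightarrow> real"
  assumes p_nonneg: "0 \<le> p x"
    and p_average: "length Es \<le> q \<Longrightarrow> 1 \<le> q \<Longrightarrow> sorted_wrt set_less Es \<Longrightarrow>
      (\<forall>E\<in>set Es. nat_interval E \<and> E \<subseteq> I) \<Longrightarrow> nat_interval I \<Longrightarrow>
      (\<Sum>E\<leftarrow>Es. p (proj E x)) \<le> logf (real q) * p (proj I x)"
    and p_coord: "\<bar>coord x n\<bar> \<le> p (proj {n} x)"
begin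

lemma p_mono: "nat_interval E \<Longrightarrow> nat_interval I \<Longrightarrow> E \<subseteq> I \<Longrightarrow> p (proj E x) \<le> p (proj I x)"
  using p_average[of "[E]" 1 I x] by simp

text \<open>Expresses, without naming functionals, that \<open>v\<close> is bounded by
  \<open>C\<close> times the value at \<open>x\<close> of a sum of at most \<open>k\<close>
  successive functionals of norm one living on \<open>I\<close>.\<close>

definition covers :: "c00 \<Rightarrow> real \<Rightarrow> nat \<Rightarrow> nat set \<Rightarrow> real \<Rightarrow> bool" where
  "covers x C k I v \<longleftrightarrow> (\<exists>Es. length Es \<le> k \<and> sorted_wrt set_less Es \<and>
     (\<forall>E\<in>set Es. nat_interval E \<and> E \<subseteq> I) \<and> v \<le> C * (\<Sum>E\<leftarrow>Es. p (proj E x)))"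

lemma covers_mono:
  assumes "covers x C k I v" "C \<le> C'" "k \<le> k'" "I \<subseteq> I'" "v' \<le> v"
  shows "covers x C' k' I' v'"
proof -
  obtain Es where Es: "length Es \<le> k" "sorted_wrt set_less Es" "\<forall>E\<in>set Es. nat_interval E \<and> E \<subseteq> I"
    "v \<le> C * (\<Sum>E\<leftarrow>Es. p (proj E x))" using assms(1) unfolding covers_def by blast
  have "0 \<le> (\<Sum>E\<leftarrow>Es. p (proj E x))" by (intro sum_list_nonneg) (auto simp: p_nonneg)
  then have "C * (\<Sum>E\<leftarrow>Es. p (proj E x)) \<le> C' * (\<Sum>E\<leftarrow>Es. p (proj E x))"
    using assms(2) by (rule mult_right_mono[rotated])
  then show ?thesis unfolding covers_def using Es assms by (intro exI[of _ Es]) auto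
qed

lemma covers_scale:
  assumes "covers x C k I v" "0 \<le> a" shows "covers x (a * C) k I (a * v)"
proof -
  obtain Es where Es: "length Es \<le> k" "sorted_wrt set_less Es" "\<forall>E\<in>set Es. nat_interval E \<and> E \<subseteq> I"
    "v \<le> C * (\<Sum>E\<leftarrow>Es. p (proj E x))" using assms(1) unfolding covers_def by blast
  have "a * v \<le> a * C * (\<Sum>E\<leftarrow>Es. p (proj E x))"
    using mult_left_mono[OF Es(4) assms(2)] by (simp add: mult.assoc)
  then show ?thesis unfolding covers_def using Es by blast
qed

lemma covers_zero: "v \<le> 0 \<Longrightarrow> covers x C k I v"
  unfolding covers_def by (rule exI[of _ "[]"]) simp

lemma covers_sum:
  assumes "sorted_wrt (\<lambda>a b. set_less (I a) (I b)) as" "\<forall>a\<in>set as. covers x C (k a) (I a) (v a)"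
  shows "covers x C (\<Sum>a\<leftarrow>as. k a) (\<Union>a\<in>set as. I a) (\<Sum>a\<leftarrow>as. v a)"
  using assms
proof (induction as)
  case (Cons a as)
  obtain Es where Es: "length Es \<le> k a" "sorted_wrt set_less Es" "\<forall>E\<in>set Es. nat_interval E \<and> E \<subseteq> I a"
    "v a \<le> C * (\<Sum>E\<leftarrow>Es. p (proj E x))" using Cons.prems unfolding covers_def by auto
  have "covers x C (\<Sum>a\<leftarrow>as. k a) (\<Union>a\<in>set as. I a) (\<Sum>a\<leftarrow>as. v a)" using Cons by simp
  then obtain Fs where Fs: "length Fs \<le> (\<Sum>a\<leftarrow>as. k a)" "sorted_wrt set_less Fs"
    "\<forall>E\<in>set Fs. nat_interval E \<and> E \<subseteq> (\<Union>a\<in>set as. I a)"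
    "(\<Sum>a\<leftarrow>as. v a) \<le> C * (\<Sum>E\<leftarrow>Fs. p (proj E x))" unfolding covers_def by blast
  have "set_less E F" if "E \<in> set Es" "F \<in> set Fs" for E F
  proof -
    have "set_less (I a) (\<Union>a\<in>set as. I a)" using Cons.prems(1) by (auto simp: set_less_def)
    then show ?thesis by (rule set_less_subset) (use Es(3) Fs(3) that in blast)+
  qed
  then have "sorted_wrt set_less (Es @ Fs)" using Es Fs by (simp add: sorted_wrt_append)
  moreover have "\<forall>E\<in>set (Es @ Fs). nat_interval E \<and> E \<subseteq> (\<Union>a\<in>set (a # as). I a)" using Es(3) Fs(3) by auto
  moreover have "length (Es @ Fs) \<le> (\<Sum>a\<leftarrow>a # as. k a)" using Es(1) Fs(1) by simp
  moreover have "(\<Sum>a\<leftarrow>a # as. v a) \<le> C * (\<Sum>E\<leftarrow>Es @ Fs. p (proj E x))"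
    using Es(4) Fs(4) by (simp add: distrib_left)
  ultimately show ?case unfolding covers_def by blast
qed (simp add: covers_zero)

lemma average_chunks:
  assumes "1 \<le> q" "length Es \<le> q * h" "sorted_wrt set_less Es" "\<forall>E\<in>set Es. nat_interval E"
  shows "\<exists>Fs. length Fs \<le> h \<and> sorted_wrt set_less Fs \<and>
    (\<forall>F\<in>set Fs. nat_interval F \<and> F \<subseteq> interval_hull (\<Union>(set Es))) \<and>
    (\<Sum>E\<leftarrow>Es. p (proj E x)) \<le> logf (real q) * (\<Sum>F\<leftarrow>Fs. p (proj F x))"
  using assms(2-)
proof (induction h arbitrary: Es)
  case 0
  then show ?case by (intro exI[of _ "[]"]) simp
next
  case (Suc h)
  let ?T = "take q Es" and ?R = "drop q Es"
  let ?F = "interval_hull (\<Union>(set ?T))"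
  have TR: "set Es = set ?T \<union> set ?R" by (metis append_take_drop_id set_append)
  have sT: "sorted_wrt set_less ?T" and sR: "sorted_wrt set_less ?R"
    and less: "\<And>E F. E \<in> set ?T \<Longrightarrow> F \<in> set ?R \<Longrightarrow> set_less E F"
    using Suc.prems(2) sorted_wrt_append[of set_less ?T ?R] by auto
  have "length ?R \<le> q * h" "\<forall>E\<in>set ?R. nat_interval E" using Suc.prems TR by auto
  from Suc.IH[OF this(1) sR this(2)] obtain Fs where Fs: "length Fs \<le> h" "sorted_wrt set_less Fs"
    "\<forall>F\<in>set Fs. nat_interval F \<and> F \<subseteq> interval_hull (\<Union>(set ?R))"
    "(\<Sum>E\<leftarrow>?R. p (proj E x)) \<le> logf (real q) * (\<Sum>F\<leftarrow>Fs. p (proj F x))" by blast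
  have "(\<Sum>E\<leftarrow>?T. p (proj E x)) \<le> logf (real q) * p (proj ?F x)"
  proof (rule p_average[OF _ assms(1) sT _ nat_interval_interval_hull])
    have "\<Union>(set ?T) \<subseteq> ?F" by (rule interval_hull_superset)
    then show "\<forall>E\<in>set ?T. nat_interval E \<and> E \<subseteq> ?F" using Suc.prems(3) TR by blast
  qed simp
  moreover have "(\<Sum>E\<leftarrow>Es. p (proj E x)) = (\<Sum>E\<leftarrow>?T. p (proj E x)) + (\<Sum>E\<leftarrow>?R. p (proj E x))"
    by (metis append_take_drop_id map_append sum_list_append)
  ultimately have "(\<Sum>E\<leftarrow>Es. p (proj E x)) \<le> logf (real q) * (\<Sum>F\<leftarrow>?F # Fs. p (proj F x))"
    using Fs(4) by (simp add: distrib_left)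
  moreover have "sorted_wrt set_less (?F # Fs)"
  proof -
    have "set_less (\<Union>(set ?T)) (\<Union>(set ?R))" using less unfolding set_less_def by blast
    then have "set_less ?F (interval_hull (\<Union>(set ?R)))" by (rule set_less_interval_hull)
    then show ?thesis using Fs(2,3) by (auto intro: set_less_subset)
  qed
  moreover have "\<forall>F\<in>set (?F # Fs). nat_interval F \<and> F \<subseteq> interval_hull (\<Union>(set Es))"
  proof -
    have "interval_hull S \<subseteq> interval_hull (\<Union>(set Es))" if "S \<subseteq> \<Union>(set Es)" for S
      by (rule interval_hull_least[OF nat_interval_interval_hull]) (use that interval_hull_superset in blast)
    from this[of "\<Union>(set ?T)"] this[of "\<Union>(set ?R)"] show ?thesis
      using Fs(3) nat_interval_interval_hull TR by auto
  qed
  ultimately show ?case using Fs(1) by (intro exI[of _ "?F # Fs"]) simp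
qed

text \<open>Trades the number of intervals for the constant: groups of \<open>q\<close> successive
  intervals are replaced by their hulls, at the price of the factor \<open>logf q\<close>.\<close>

lemma covers_chunk:
  assumes "covers x C k I v" "1 \<le> q" "k \<le> q * h" "nat_interval I" "0 \<le> C"
  shows "covers x (C * logf (real q)) h I v"
proof -
  obtain Es where Es: "length Es \<le> k" "sorted_wrt set_less Es" "\<forall>E\<in>set Es. nat_interval E \<and> E \<subseteq> I"
    "v \<le> C * (\<Sum>E\<leftarrow>Es. p (proj E x))" using assms(1) unfolding covers_def by blast
  have "length Es \<le> q * h" "\<forall>E\<in>set Es. nat_interval E" using Es assms by auto
  from average_chunks[OF assms(2) this(1) Es(2) this(2), where x = x] obtain Fs where
    Fs: "length Fs \<le> h" "sorted_wrt set_less Fs" "\<forall>F\<in>set Fs. nat_interval F \<and> F \<subseteq> interval_hull (\<Union>(set Es))"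
    "(\<Sum>E\<leftarrow>Es. p (proj E x)) \<le> logf (real q) * (\<Sum>F\<leftarrow>Fs. p (proj F x))" by blast
  have "interval_hull (\<Union>(set Es)) \<subseteq> I" using Es(3) assms(4) by (intro interval_hull_least) auto
  moreover have "v \<le> C * logf (real q) * (\<Sum>F\<leftarrow>Fs. p (proj F x))"
    using Es(4) mult_left_mono[OF Fs(4) assms(5)] by (simp add: mult.assoc)
  ultimately show ?thesis unfolding covers_def using Fs by blast
qed

text \<open>
  Items that are not \<open>light\<close> have no cover of their own. A maximal run of them is absorbed by one interval,
  so that the number of intervals does not depend on the number of such items.
\<close>

lemma covers_merge:
  assumes "sorted_wrt (\<lambda>a b. set_less (I a) (I b)) as"
    and "\<And>a. a \<in> set as \<Longrightarrow> light a \<Longrightarrow> covers x C (k a) (I a) (v a)"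
    and "\<And>a. a \<in> set as \<Longrightarrow> \<not> light a \<Longrightarrow> v a \<le> \<delta> a * p (proj (I a) x)"
    and "\<And>a. a \<in> set as \<Longrightarrow> nat_interval (I a) \<and> I a \<subseteq> J \<and> 0 \<le> \<delta> a"
    and J: "nat_interval J"
    and C: "0 \<le> C" "(\<Sum>a\<leftarrow>as. if light a then 0 else \<delta> a) \<le> C"
  shows "covers x C ((\<Sum>a\<leftarrow>as. if light a then Suc (k a) else 0) + 1) J (\<Sum>a\<leftarrow>as. v a)"
proof -
  let ?\<Delta> = "\<lambda>as. \<Sum>a\<leftarrow>as. if light a then 0 else \<delta> a"
  \<comment> \<open>The induction keeps a leading interval \<open>E\<close> that absorbs the current
    run of items, and its coefficient is only the sum of the \<open>\<delta>\<close> met so far.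
    When a light item is prepended, this interval is closed with the coefficient \<open>C\<close>
    and an empty leading interval is opened, which accounts for \<open>Suc (k a)\<close>.\<close>
  have "\<exists>E Es. sorted_wrt set_less (E # Es) \<and> length Es \<le> (\<Sum>a\<leftarrow>as. if light a then Suc (k a) else 0) \<and>
      (\<forall>F\<in>set (E # Es). nat_interval F \<and> F \<subseteq> interval_hull (\<Union>a\<in>set as. I a)) \<and>
      (\<Sum>a\<leftarrow>as. v a) \<le> ?\<Delta> as * p (proj E x) + C * (\<Sum>F\<leftarrow>Es. p (proj F x))"
    using assms(1-4) C(2)
  proof (induction as)
    case Nil
    show ?case by (rule exI[of _ "{}"], rule exI[of _ "[]"]) (simp add: nat_interval_def)
  next
    case (Cons a as)
    let ?U = "\<Union>a\<in>set as. I a" and ?V = "\<Union>a\<in>set (a # as). I a"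
    have Ia: "nat_interval (I a)" "0 \<le> \<delta> a" using Cons.prems(4)[of a] by auto
    have \<Delta>C: "?\<Delta> as \<le> C" using Cons.prems(5) Ia(2) by (auto split: if_splits)
    have "\<exists>E Es. sorted_wrt set_less (E # Es) \<and> length Es \<le> (\<Sum>a\<leftarrow>as. if light a then Suc (k a) else 0) \<and>
      (\<forall>F\<in>set (E # Es). nat_interval F \<and> F \<subseteq> interval_hull ?U) \<and>
      (\<Sum>a\<leftarrow>as. v a) \<le> ?\<Delta> as * p (proj E x) + C * (\<Sum>F\<leftarrow>Es. p (proj F x))"
    proof (rule Cons.IH)
      show "sorted_wrt (\<lambda>a b. set_less (I a) (I b)) as" using Cons.prems(1) by simp
    qed (use \<Delta>C in \<open>auto intro!: Cons.prems(2-4)\<close>)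
    then obtain E Es where E: "sorted_wrt set_less (E # Es)"
      "length Es \<le> (\<Sum>a\<leftarrow>as. if light a then Suc (k a) else 0)"
      "\<forall>F\<in>set (E # Es). nat_interval F \<and> F \<subseteq> interval_hull ?U"
      "(\<Sum>a\<leftarrow>as. v a) \<le> ?\<Delta> as * p (proj E x) + C * (\<Sum>F\<leftarrow>Es. p (proj F x))"
      by (elim exE conjE)
    have \<Delta>0: "0 \<le> ?\<Delta> as" using Cons.prems(4) by (intro sum_list_nonneg) auto
    have UV': "?U \<subseteq> interval_hull ?V" "I a \<subseteq> interval_hull ?V"
      using interval_hull_superset[of ?V] by auto
    then have UV: "interval_hull ?U \<subseteq> interval_hull ?V" "I a \<subseteq> interval_hull ?V"
      by (auto simp only: interval_hull_least[OF nat_interval_interval_hull])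
    have "set_less (I a) ?U" using Cons.prems(1) by (auto simp: set_less_def)
    then have "set_less (interval_hull (I a)) (interval_hull ?U)" by (rule set_less_interval_hull)
    then have aU: "set_less (I a) (interval_hull ?U)"
      using set_less_subset interval_hull_superset by blast
    show ?case
    proof (cases "light a")
      case True
      obtain Gs where Gs: "length Gs \<le> k a" "sorted_wrt set_less Gs" "\<forall>E\<in>set Gs. nat_interval E \<and> E \<subseteq> I a"
        "v a \<le> C * (\<Sum>E\<leftarrow>Gs. p (proj E x))" using Cons.prems(2)[of a] True unfolding covers_def by auto
      have "?\<Delta> as * p (proj E x) \<le> C * p (proj E x)" using \<Delta>C p_nonneg by (rule mult_right_mono)
      then have 1: "(\<Sum>a\<leftarrow>a # as. v a) \<le> C * (\<Sum>F\<leftarrow>Gs @ E # Es. p (proj F x))"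
        using Gs(4) E(4) by (simp add: distrib_left)
      moreover have "0 \<le> ?\<Delta> (a # as) * p (proj {} x)" using \<Delta>0 p_nonneg True by simp
      ultimately have "(\<Sum>a\<leftarrow>a # as. v a)
          \<le> ?\<Delta> (a # as) * p (proj {} x) + C * (\<Sum>F\<leftarrow>Gs @ E # Es. p (proj F x))" by linarith
      moreover have "sorted_wrt set_less ({} # Gs @ E # Es)"
      proof -
        have "set_less G F" if "G \<in> set Gs" "F \<in> set (E # Es)" for G F
          by (rule set_less_subset[OF aU]) (use Gs(3) E(3) that in blast)+
        then show ?thesis using Gs(2) E(1) by (auto simp: sorted_wrt_append set_less_def)
      qed
      moreover have "\<forall>F\<in>set ({} # Gs @ E # Es). nat_interval F \<and> F \<subseteq> interval_hull ?V"
      proof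
        fix F assume "F \<in> set ({} # Gs @ E # Es)"
        then consider "F = {}" | "F \<in> set Gs" | "F \<in> set (E # Es)" by auto
        then show "nat_interval F \<and> F \<subseteq> interval_hull ?V"
        proof cases
          case 1 then show ?thesis by (simp add: nat_interval_def)
        next
          case 2 then show ?thesis using Gs(3) UV(2) by blast
        next
          case 3 then show ?thesis using E(3) UV(1) by blast
        qed
      qed
      moreover have "length (Gs @ E # Es) \<le> (\<Sum>a\<leftarrow>a # as. if light a then Suc (k a) else 0)"
        using Gs(1) E(2) True by simp
      ultimately show ?thesis by blast
    next
      case False
      let ?E = "interval_hull (I a \<union> E)"
      have sub: "I a \<union> E \<subseteq> ?E" by (rule interval_hull_superset)
      have "v a \<le> \<delta> a * p (proj (I a) x)" using Cons.prems(3)[of a] False by simp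
      also have "\<dots> \<le> \<delta> a * p (proj ?E x)"
        using sub Ia by (intro mult_left_mono p_mono nat_interval_interval_hull) auto
      finally have va: "v a \<le> \<delta> a * p (proj ?E x)" .
      have "?\<Delta> as * p (proj E x) \<le> ?\<Delta> as * p (proj ?E x)"
        using sub E(3) \<Delta>0 by (intro mult_left_mono p_mono nat_interval_interval_hull) auto
      then have "(\<Sum>a\<leftarrow>a # as. v a) \<le> ?\<Delta> (a # as) * p (proj ?E x) + C * (\<Sum>F\<leftarrow>Es. p (proj F x))"
        using va E(4) False by (simp add: distrib_right)
      moreover have "sorted_wrt set_less (?E # Es)"
      proof -
        have "set_less ?E F" if F: "F \<in> set Es" for F
        proof -
          have "set_less (I a) F" by (rule set_less_subset[OF aU order_refl]) (use E(3) F in auto)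
          moreover have "set_less E F" using E(1) F by simp
          ultimately have "set_less (I a \<union> E) F" by (auto simp: set_less_def)
          then have "set_less ?E (interval_hull F)" by (rule set_less_interval_hull)
          then show ?thesis using set_less_subset interval_hull_superset by blast
        qed
        then show ?thesis using E(1) by simp
      qed
      moreover have "\<forall>F\<in>set (?E # Es). nat_interval F \<and> F \<subseteq> interval_hull ?V"
      proof -
        have "E \<subseteq> interval_hull ?U" using E(3) by simp
        then have "I a \<union> E \<subseteq> interval_hull ?V" using UV by blast
        then have "?E \<subseteq> interval_hull ?V" by (rule interval_hull_least[OF nat_interval_interval_hull])
        then have "nat_interval ?E \<and> ?E \<subseteq> interval_hull ?V" using nat_interval_interval_hull by blast
        moreover have "nat_interval F \<and> F \<subseteq> interval_hull ?V" if "F \<in> set Es" for F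
          using E(3) UV(1) that by (meson list.set_intros(2) order_trans)
        ultimately show ?thesis by simp
      qed
      moreover have "length Es \<le> (\<Sum>a\<leftarrow>a # as. if light a then Suc (k a) else 0)" using E(2) False by simp
      ultimately show ?thesis by blast
    qed
  qed
  then obtain E Es where E: "sorted_wrt set_less (E # Es)"
    "length Es \<le> (\<Sum>a\<leftarrow>as. if light a then Suc (k a) else 0)"
    "\<forall>F\<in>set (E # Es). nat_interval F \<and> F \<subseteq> interval_hull (\<Union>a\<in>set as. I a)"
    "(\<Sum>a\<leftarrow>as. v a) \<le> ?\<Delta> as * p (proj E x) + C * (\<Sum>F\<leftarrow>Es. p (proj F x))"
    by (elim exE conjE)
  have sub: "interval_hull (\<Union>a\<in>set as. I a) \<subseteq> J" using assms(4) J by (intro interval_hull_least) auto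
  have "?\<Delta> as * p (proj E x) \<le> C * p (proj E x)" using C(2) p_nonneg by (rule mult_right_mono)
  then have "(\<Sum>a\<leftarrow>as. v a) \<le> C * (\<Sum>F\<leftarrow>E # Es. p (proj F x))"
    using E(4) by (simp add: distrib_left)
  moreover have "\<forall>F\<in>set (E # Es). nat_interval F \<and> F \<subseteq> J" using E(3) sub by (meson order_trans)
  moreover have "length (E # Es) \<le> (\<Sum>a\<leftarrow>as. if light a then Suc (k a) else 0) + 1" using E(2) by simp
  ultimately show ?thesis unfolding covers_def using E(1) by blast
qed

end

section \<open>Functionals attached to subtrees\<close>

locale multiplier = tree + averaging_seminorm
begin

abbreviation "len n r \<equiv> length (ycoef n r)"

lemma len_pos: "1 \<le> len n r"
  using sum_list_ycoef_vcoef[of n r] by (cases "leaves n r") (auto simp: ycoef_def)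

lemma len_leaf: "n \<le> r \<Longrightarrow> len n r = 1"
  by (simp add: ycoef_leaf)

lemma len_node: "r < n \<Longrightarrow> len n r = (\<Sum>t<N r. len n (first_child r + t))"
  by (simp add: ycoef_node length_concat comp_def interv_sum_list_conv_sum_set_nat lessThan_atLeast0)

text \<open>The functional of the subtree below node \<open>r\<close> in the \<open>n\<close>-th
  tree, with its coefficients written on consecutive coordinates from \<open>s\<close> on. General
  \<open>r\<close> makes it possible to descend through the tree.\<close>

definition Y :: "nat \<Rightarrow> nat \<Rightarrow> nat \<Rightarrow> c00 \<Rightarrow> real" where
  "Y s n r x = ev (coord x) (place (\<lambda>i. s + i) (ycoef n r))"

text \<open>For \<open>n <= r\<close> the node is a leaf and has no successors; the value 0 keeps
  \<open>offset_le\<close> and \<open>spaced_child\<close> true for all \<open>n\<close>.\<close>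

definition offset :: "nat \<Rightarrow> nat \<Rightarrow> nat \<Rightarrow> nat" where
  "offset n r t = (if n \<le> r then 0 else \<Sum>t'<t. len n (first_child r + t'))"

lemma Y_node:
  assumes "r < n"
  shows "Y s n r x = 1 / f r * (\<Sum>t<N r. Y (s + offset n r t) n (first_child r + t) x)"
  using assms unfolding Y_def ycoef_node[OF assms] place_concat
  by (simp add: place_scale ev_sum ev_scaleR sum_distrib_left offset_def)

lemma offset_le:
  assumes "t < N r" shows "offset n r t + len n (first_child r + t) \<le> len n r"
proof (cases "n \<le> r")
  case True
  then have "n \<le> first_child r + t" using first_child_gt[of r] by simp
  then show ?thesis using True by (simp add: offset_def len_leaf)
next
  case False
  have "offset n r t + len n (first_child r + t) = (\<Sum>t'<Suc t. len n (first_child r + t'))"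
    using False by (simp add: offset_def)
  also have "\<dots> \<le> (\<Sum>t'<N r. len n (first_child r + t'))" using assms by (intro sum_mono2) auto
  finally show ?thesis using False by (simp add: len_node)
qed

lemma offset_less: "r < n \<Longrightarrow> t < t' \<Longrightarrow> offset n r t + len n (first_child r + t) \<le> offset n r t'"
proof -
  assume r: "r < n" and t: "t < t'"
  have "offset n r t + len n (first_child r + t) = (\<Sum>t'<Suc t. len n (first_child r + t'))"
    using r by (simp add: offset_def)
  also have "\<dots> \<le> (\<Sum>t'<t'. len n (first_child r + t'))" using t by (intro sum_mono2) auto
  finally show ?thesis using r by (simp add: offset_def)
qed

abbreviation block :: "nat \<Rightarrow> nat \<Rightarrow> nat \<Rightarrow> nat set" where
  "block s n r \<equiv> {s..<s + len n r}"

lemma nat_interval_ivl: "nat_interval {a..<b}"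
  by (auto simp: nat_interval_def)

lemma sorted_child_blocks:
  "r < n \<Longrightarrow> sorted_wrt set_less (map (\<lambda>t. block (s + offset n r t) n (first_child r + t)) [0..<N r])"
  unfolding sorted_wrt_iff_nth_less set_less_def by (fastforce dest: offset_less[of r n])

text \<open>The weight \<open>1 / f r\<close> of an expansion is exactly what
  \<open>p_average\<close> costs for \<open>N r\<close> successive blocks.\<close>

lemma abs_Y_le: "\<bar>Y s n r x\<bar> \<le> p (proj (block s n r) x)"
proof (induction n r arbitrary: s rule: leaves.induct)
  case (1 n r)
  show ?case
  proof (cases "n \<le> r")
    case True
    then have "block s n r = {s}" by (auto simp: len_leaf)
    then show ?thesis using True p_coord[of x s] by (simp add: Y_def ycoef_leaf)
  next
    case False
    then have rn: "r < n" by simp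
    let ?B = "\<lambda>t. block (s + offset n r t) n (first_child r + t)"
    have "\<bar>Y s n r x\<bar> \<le> 1 / f r * (\<Sum>t<N r. \<bar>Y (s + offset n r t) n (first_child r + t) x\<bar>)"
      unfolding Y_node[OF rn] abs_mult using f_ge_1[of r] sum_abs by (intro mult_mono) auto
    also have "\<dots> \<le> 1 / f r * (\<Sum>t<N r. p (proj (?B t) x))"
      using 1 False f_ge_1[of r] by (intro mult_left_mono sum_mono) auto
    finally have le: "\<bar>Y s n r x\<bar> \<le> 1 / f r * (\<Sum>t<N r. p (proj (?B t) x))" .
    have "(\<Sum>t<N r. p (proj (?B t) x)) = (\<Sum>E\<leftarrow>map ?B [0..<N r]. p (proj E x))"
      by (simp add: comp_def interv_sum_list_conv_sum_set_nat lessThan_atLeast0)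
    also have "\<dots> \<le> f r * p (proj (block s n r) x)"
    proof (rule p_average)
      show "1 \<le> N r" using N_ge[of r] by simp
      show "\<forall>E\<in>set (map ?B [0..<N r]). nat_interval E \<and> E \<subseteq> block s n r"
        using offset_le[of _ r n] by (fastforce simp: nat_interval_ivl)
    qed (use rn sorted_child_blocks nat_interval_ivl in auto)
    finally have "1 / f r * (\<Sum>t<N r. p (proj (?B t) x)) \<le> 1 / f r * (f r * p (proj (block s n r) x))"
      using f_ge_1[of r] by (intro mult_left_mono) auto
    then show ?thesis using le f_ge_1[of r] by simp
  qed
qed

definition spaced :: "nat \<Rightarrow> (nat \<Rightarrow> nat) \<Rightarrow> bool" where
  "spaced r pos \<longleftrightarrow> (\<forall>n. pos n + len n r \<le> pos (Suc n))"

lemma spaced_less: assumes "spaced r pos" "n < n'" shows "pos n + len n r \<le> pos n'"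
  using assms(2)
proof (induction n')
  case (Suc n')
  have "pos n' \<le> pos (Suc n')" "pos n + len n r \<le> pos (Suc n)" using assms(1) by (auto simp: spaced_def intro: le_trans[OF le_add1])
  then show ?case using Suc by (cases "n = n'") auto
qed simp

lemma spaced_child:
  assumes "spaced r pos" "t < N r" shows "spaced (first_child r + t) (\<lambda>n. pos n + offset n r t)"
  unfolding spaced_def
proof
  fix n
  have "pos n + offset n r t + len n (first_child r + t) \<le> pos n + len n r" using offset_le[OF assms(2), of n] by simp
  also have "\<dots> \<le> pos (Suc n)" using assms(1) by (simp add: spaced_def)
  finally show "pos n + offset n r t + len n (first_child r + t) \<le> pos (Suc n) + offset (Suc n) r t" by simp
qed

text \<open>The interval spanned by the blocks with index in \<open>S\<close>. Filling the gaps
  between the blocks is necessary because \<open>p\<close> is only compared along intervals.\<close>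

definition extent :: "nat \<Rightarrow> (nat \<Rightarrow> nat) \<Rightarrow> nat set \<Rightarrow> nat set" where
  "extent r pos S = {i. \<exists>n\<in>S. \<exists>n'\<in>S. pos n \<le> i \<and> i < pos n' + len n' r}"

lemma nat_interval_extent: "nat_interval (extent r pos S)"
  unfolding nat_interval_def extent_def by (blast intro: order_trans le_less_trans)

lemma extent_mono: "S \<subseteq> T \<Longrightarrow> extent r pos S \<subseteq> extent r pos T"
  unfolding extent_def by blast

lemma block_subset_extent: "n \<in> S \<Longrightarrow> block (pos n) n r \<subseteq> extent r pos S"
  unfolding extent_def by auto

lemma set_less_extent: assumes "spaced r pos" "set_less S T" shows "set_less (extent r pos S) (extent r pos T)"
  unfolding set_less_def
proof (intro ballI)
  fix i j assume "i \<in> extent r pos S" "j \<in> extent r pos T"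
  then obtain n' m where "n' \<in> S" "i < pos n' + len n' r" "m \<in> T" "pos m \<le> j" by (auto simp: extent_def)
  moreover have "n' < m" using calculation assms(2) by (auto simp: set_less_def)
  ultimately show "i < j" using spaced_less[OF assms(1), of n' m] by linarith
qed

lemma extent_child:
  assumes "t < N r"
  shows "extent (first_child r + t) (\<lambda>n. pos n + offset n r t) S \<subseteq> extent r pos S"
proof
  fix i assume "i \<in> extent (first_child r + t) (\<lambda>n. pos n + offset n r t) S"
  then obtain n n' where "n \<in> S" "n' \<in> S" "pos n + offset n r t \<le> i"
    "i < pos n' + offset n' r t + len n' (first_child r + t)" by (auto simp: extent_def)
  moreover have "offset n' r t + len n' (first_child r + t) \<le> len n' r" by (rule offset_le[OF assms])
  ultimately show "i \<in> extent r pos S" unfolding extent_def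
    by (intro CollectI bexI[of _ n] bexI[of _ n']) auto
qed

end

section \<open>Norming functionals composed with a multiplier\<close>

context multiplier
begin

definition multiplier_functional :: "(nat \<Rightarrow> real) \<Rightarrow> (nat \<Rightarrow> nat) \<Rightarrow> nat \<Rightarrow> c00 \<Rightarrow> c00 \<Rightarrow> real" where
  "multiplier_functional b pos r x z = ev (\<lambda>n. b n * Y (pos n) n r x) z"

abbreviation "\<Psi> \<equiv> multiplier_functional"

lemma \<Psi>_comb: "\<Psi> b pos r x (comb \<gamma>s zs) = (\<Sum>c<length zs. \<gamma>s ! c * \<Psi> b pos r x (zs ! c))"
  by (simp add: multiplier_functional_def ev_comb)

lemma \<Psi>_sum_list: "\<Psi> b pos r x (sum_list zs) = (\<Sum>z\<leftarrow>zs. \<Psi> b pos r x z)"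
  unfolding multiplier_functional_def by (rule ev_sum_list)

lemma \<Psi>_add_fun: "\<Psi> (\<lambda>n. b n + b' n) pos r x z = \<Psi> b pos r x z + \<Psi> b' pos r x z"
  by (simp add: multiplier_functional_def distrib_right ev_fun_add)

text \<open>
  The main estimate: up to the factor \<open>2 / f(N r)\<close>, the multiplier below node \<open>r\<close> maps \<open>z\<close> to a sum of
  only \<open>N r\<close> successive functionals of norm one.
\<close>

definition controlled :: "c00 \<Rightarrow> bool" where
  "controlled z \<longleftrightarrow> (\<forall>r b pos x. spaced r pos \<longrightarrow> (\<forall>n. \<bar>b n\<bar> \<le> 2) \<longrightarrow> (\<forall>n\<le>r. b n = 0) \<longrightarrow>
     covers x (2 / f r) (N r) (extent r pos (supp z)) \<bar>\<Psi> b pos r x z\<bar>)"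

lemma controlledD:
  "controlled z \<Longrightarrow> spaced r pos \<Longrightarrow> (\<And>n. \<bar>b n\<bar> \<le> 2) \<Longrightarrow> (\<And>n. n \<le> r \<Longrightarrow> b n = 0) \<Longrightarrow>
    covers x (2 / f r) (N r) (extent r pos (supp z)) \<bar>\<Psi> b pos r x z\<bar>"
  unfolding controlled_def by blast

definition stage :: "nat \<Rightarrow> nat" where "stage m = (LEAST r. m \<le> N r)"

lemma le_N_stage: "stage m \<le> r \<Longrightarrow> m \<le> N r"
proof -
  assume r: "stage m \<le> r"
  have "m \<le> N m" by (rule strict_mono_imp_increasing[OF strict_mono_N])
  then have "m \<le> N (stage m)" unfolding stage_def by (rule LeastI)
  also have "\<dots> \<le> N r" using r strict_mono_N by (simp add: strict_mono_less_eq)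
  finally show ?thesis .
qed

lemma N_less_of_less_stage: "r < stage m \<Longrightarrow> N r < m"
  unfolding stage_def by (meson not_le not_less_Least)

text \<open>The first term counts the indices \<open>n\<close> whose trees may fail to reach the
  relevant nodes, each contributing at most 2. In the second, the product counts the successors met
  when descending from the root to the nodes numbered from \<open>stage m\<close> on, and 4 is the
  bound obtained at each of those nodes.\<close>

definition stage_bound :: "nat \<Rightarrow> real" where
  "stage_bound m = 2 * real (first_child (stage m)) + 4 * real (\<Prod>i<stage m. N i)"

lemma stage_bound_nonneg: "0 \<le> stage_bound m"
  unfolding stage_bound_def by (intro add_nonneg_nonneg mult_nonneg_nonneg of_nat_0_le_iff) simp_all

text \<open>Let \<open>k\<close> be the node before \<open>stage m\<close>. Then
  \<open>l k <= N k < m\<close>, so the gap condition makes \<open>sqrt (logf m)\<close> at least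
  the fourth power of \<open>N k\<close>, while \<open>stage_bound m\<close> is at most
  \<open>8 * l k * N k\<close>. One power of \<open>N k\<close> is left for an additional factor
  \<open>f r\<close>, and a further one for the numerical constants.\<close>

lemma stage_bound_le:
  assumes m: "m \<in> L"
  shows "stage_bound m / logf (real m) \<le> (3 / 8) / sqrt (logf (real m))"
    and "N r < m \<Longrightarrow> stage_bound m / logf (real m) \<le> (3 / 8 / f r) / sqrt (logf (real m))"
proof -
  let ?F = "logf (real m)" and ?s = "stage m"
  have F: "256 \<le> ?F" by (rule L_large[OF m])
  have sqF: "sqrt ?F * sqrt ?F = ?F" using F by simp
  have s16: "16 \<le> sqrt ?F" using real_sqrt_le_mono[OF F] by (simp add: real_sqrt_eq_iff[symmetric] flip: real_sqrt_abs)
  have sF: "0 < sqrt ?F" using F by simp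
  have main: "stage_bound m * c \<le> 3 / 8 * sqrt ?F \<Longrightarrow> 0 < c \<Longrightarrow> stage_bound m / ?F \<le> (3 / 8 / c) / sqrt ?F" for c
  proof -
    assume c: "stage_bound m * c \<le> 3 / 8 * sqrt ?F" "0 < c"
    then have "stage_bound m \<le> 3 / 8 / c * sqrt ?F" by (simp add: field_simps)
    then have "stage_bound m / ?F \<le> (3 / 8 / c * sqrt ?F) / (sqrt ?F * sqrt ?F)"
      unfolding sqF using F by (intro divide_right_mono) auto
    also have "\<dots> = (3 / 8 / c) / sqrt ?F"
      using less_imp_neq[OF sF, symmetric] by (rule nonzero_mult_divide_mult_cancel_right)
    finally show ?thesis .
  qed
  have both: "stage_bound m * c \<le> 3 / 8 * sqrt ?F" if c: "1 \<le> c" "?s = 0 \<Longrightarrow> c = 1" "?s \<noteq> 0 \<Longrightarrow> c \<le> f (?s - 1)" for c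
  proof (cases ?s)
    case 0
    \<comment> \<open>Without earlier nodes the bound is \<open>2 + 4\<close>. Since
      \<open>sqrt (logf m) >= 16\<close>, this is the case that fixes the constant
      \<open>3 / 8\<close>.\<close>
    then have "stage_bound m * c = 6" using c by (simp add: stage_bound_def first_child_def)
    then show ?thesis using s16 by simp
  next
    case (Suc k)
    let ?l = "real (l k)" and ?N = "real (N k)"
    have lN: "?l \<le> ?N" "256 \<le> ?N" "256 \<le> ?l" using l_le_N[of k] N_ge[of k] L_ge[OF l_in_L[of k]] by auto
    have Nm: "N k < m" using N_less_of_less_stage[of k m] Suc by simp
    then have lm: "l k < m" using l_le_N[of k] by simp
    have "?N ^ 4 \<le> sqrt ?F"
    proof -
      have "(?N ^ 4)\<^sup>2 = 2 ^ (16 * l k ^ 4)"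
      proof -
        have "?N = 2 ^ (2 * l k ^ 4)" by (simp add: N_eq power_mult)
        then show ?thesis by (simp add: power_mult[symmetric] mult.commute mult.assoc)
      qed
      also have "\<dots> \<le> ?F" by (rule L_gap[OF l_in_L m lm])
      finally show ?thesis by (rule real_le_rsqrt)
    qed
    have "stage_bound m \<le> 8 * ?l * ?N"
    proof -
      have "stage_bound m = 2 * (1 + real (\<Sum>i<k. N i) + ?N) + 4 * (real (\<Prod>i<k. N i) * ?N)"
        using Suc by (simp add: stage_bound_def first_child_def)
      also have "\<dots> \<le> 2 * (?l + ?N) + 4 * (?l * ?N)"
      proof -
        have "real (\<Sum>i<k. N i) + 1 \<le> ?l" using sum_N_less_l[of k] by linarith
        moreover have "real (\<Prod>i<k. N i) * ?N \<le> ?l * ?N"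
          using prod_N_le_l[of k] by (intro mult_right_mono) (simp_all only: of_nat_le_iff of_nat_0_le_iff)
        ultimately show ?thesis by simp
      qed
      also have "?l + ?N \<le> 2 * (?l * ?N)"
      proof -
        have "1 * ?N \<le> ?l * ?N" "?l * 1 \<le> ?l * ?N"
          using lN by (intro mult_right_mono mult_left_mono; linarith)+
        then show ?thesis by linarith
      qed
      finally show ?thesis by (simp add: mult_ac)
    qed
    moreover have "c \<le> ?N" using c(3) Suc logf_le_of_nat[of "N k"] by simp
    ultimately have "stage_bound m * c \<le> 8 * ?l * ?N * ?N"
      using c(1) stage_bound_nonneg[of m] by (intro mult_mono) auto
    also have "\<dots> \<le> 8 * ?N * ?N * ?N" using lN by (intro mult_right_mono mult_left_mono) auto
    also have "\<dots> \<le> 3 / 8 * ?N * ?N * ?N * ?N"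
    proof -
      have "8 * (?N * ?N * ?N) \<le> (3 / 8 * ?N) * (?N * ?N * ?N)" using lN by (intro mult_right_mono) auto
      then show ?thesis by (simp add: mult_ac)
    qed
    also have "\<dots> = 3 / 8 * ?N ^ 4" by (simp add: eval_nat_numeral)
    also have "\<dots> \<le> 3 / 8 * sqrt ?F" using \<open>?N ^ 4 \<le> sqrt ?F\<close> by simp
    finally show ?thesis .
  qed
  show "stage_bound m / ?F \<le> (3 / 8) / sqrt ?F"
    using main[of 1] both[of 1] f_ge_1 by simp
  show "stage_bound m / ?F \<le> (3 / 8 / f r) / sqrt ?F" if r: "N r < m"
  proof (rule main[OF both])
    have rs: "r < ?s" using r le_N_stage[of m r] by (meson not_le)
    show "f r \<le> f (?s - 1)" if "?s \<noteq> 0"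
      using rs strict_mono_N by (intro logf_mono) (auto simp: strict_mono_less_eq)
    show "?s = 0 \<Longrightarrow> f r = 1" using rs by simp
    show "1 \<le> f r" "0 < f r" using f_ge_1[of r] by auto
  qed
qed

lemma prod_N_mono:
  assumes "finite B" "A \<subseteq> B" shows "prod N A \<le> prod N B"
proof -
  have "0 < N i" for i using N_ge[of i] by simp
  then have "0 < prod N (B - A)" by (simp add: prod_pos)
  then have "1 * prod N A \<le> prod N (B - A) * prod N A" by (intro mult_right_mono) auto
  then show ?thesis by (simp add: prod.subset_diff[OF assms(2,1)])
qed

lemma abs_coord_sum_list_le:
  assumes "sorted_wrt supp_less zs" "\<forall>z\<in>set zs. z \<in> K" shows "\<bar>coord (sum_list zs) n\<bar> \<le> 1"
proof -
  let ?o = "replicate (length zs) 1"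
  have "sum_list zs = comb ?o zs" by (simp add: comb_def sum_list_sum_nth atLeast0LessThan)
  moreover have "\<bar>coord (comb ?o zs) n\<bar> \<le> 1"
    by (rule coord_comb_cases[OF assms(1), of ?o n]) (use assms(2) abs_coord_K_le in auto)
  ultimately show ?thesis by simp
qed

lemma sorted_extents:
  assumes "spaced r pos" "sorted_wrt supp_less zs"
  shows "sorted_wrt (\<lambda>y z. set_less (extent r pos (supp y)) (extent r pos (supp z))) zs"
  by (rule sorted_wrt_mono_rel[OF _ assms(2)]) (auto simp: supp_less_def intro: set_less_extent[OF assms(1)])

text \<open>At nodes from \<open>stage m\<close> on, the constants multiply as
  \<open>2 / f r * logf (N r * N r) <= 4\<close>. At an earlier node the value is split among the
  \<open>N r\<close> successors and the gain \<open>1 / f r\<close> is given away, so only the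
  product of the lengths accumulates. All nodes met are numbered below
  \<open>first_child (stage m)\<close>; as \<open>b\<close> vanishes below that number, they are
  expanded in every tree that matters.\<close>

lemma heavy_tail:
  assumes zs: "sorted_wrt supp_less zs" "\<forall>z\<in>set zs. controlled z" and m: "length zs = m"
    and b: "\<And>n. \<bar>b n\<bar> \<le> 2" "\<And>n. n < first_child (stage m) \<Longrightarrow> b n = 0"
  shows "spaced r pos \<Longrightarrow> r < first_child (stage m) \<Longrightarrow>
    \<bar>\<Psi> b pos r x (sum_list zs)\<bar> \<le> 4 * real (\<Prod>i\<in>{r..<stage m}. N i) * p (proj (extent r pos (\<Union>z\<in>set zs. supp z)) x)"
proof (induction "stage m - r" arbitrary: r pos rule: less_induct)
  case less
  let ?s = "stage m" and ?U = "\<Union>z\<in>set zs. supp z"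
  let ?P = "p (proj (extent r pos ?U) x)"
  show ?case
  proof (cases "?s \<le> r")
    case True
    then have mN: "m \<le> N r" by (rule le_N_stage)
    have "covers x (2 / f r) (N r) (extent r pos (supp z)) \<bar>\<Psi> b pos r x z\<bar>" if "z \<in> set zs" for z
      using zs(2) that b less.prems by (intro controlledD) auto
    then have "covers x (2 / f r) (\<Sum>z\<leftarrow>zs. N r) (\<Union>z\<in>set zs. extent r pos (supp z)) (\<Sum>z\<leftarrow>zs. \<bar>\<Psi> b pos r x z\<bar>)"
      using sorted_extents[OF less.prems(1) zs(1)] by (intro covers_sum) auto
    then have "covers x (2 / f r) (N r * N r) (extent r pos ?U) \<bar>\<Psi> b pos r x (sum_list zs)\<bar>"
    proof (rule covers_mono)
      show "(\<Sum>z\<leftarrow>zs. N r) \<le> N r * N r" using mN m by (simp add: sum_list_triv)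
      show "(\<Union>z\<in>set zs. extent r pos (supp z)) \<subseteq> extent r pos ?U" by (intro UN_least extent_mono) auto
      show "\<bar>\<Psi> b pos r x (sum_list zs)\<bar> \<le> (\<Sum>z\<leftarrow>zs. \<bar>\<Psi> b pos r x z\<bar>)"
        unfolding \<Psi>_sum_list by (induction zs) auto
    qed simp
    then obtain Es where Es: "length Es \<le> N r * N r" "sorted_wrt set_less Es"
      "\<forall>E\<in>set Es. nat_interval E \<and> E \<subseteq> extent r pos ?U"
      "\<bar>\<Psi> b pos r x (sum_list zs)\<bar> \<le> 2 / f r * (\<Sum>E\<leftarrow>Es. p (proj E x))" unfolding covers_def by blast
    have N1: "1 \<le> real (N r)" using N_ge[of r] by simp
    have "(\<Sum>E\<leftarrow>Es. p (proj E x)) \<le> logf (real (N r * N r)) * ?P"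
      by (rule p_average[OF Es(1) _ Es(2,3) nat_interval_extent]) (use N_ge[of r] in simp)
    also have "\<dots> \<le> (2 * f r) * ?P"
      using logf_mult_le[OF N1 N1] by (intro mult_right_mono p_nonneg) simp
    finally have "2 / f r * (\<Sum>E\<leftarrow>Es. p (proj E x)) \<le> 2 / f r * (2 * f r * ?P)"
      using f_ge_1[of r] by (intro mult_left_mono) auto
    also have "\<dots> = 4 * ?P" using f_ge_1[of r] by simp
    finally show ?thesis using Es(4) True by simp
  next
    case False
    then have rs: "r < ?s" by simp
    let ?pos = "\<lambda>t n. pos n + offset n r t"
    have bn: "b n * Y (pos n) n r x = (\<Sum>t<N r. 1 / f r * (b n * Y (?pos t n) n (first_child r + t) x))" for n
    proof (cases "r < n")
      case True
      then show ?thesis by (simp add: Y_node sum_distrib_left mult_ac)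
    next
      case False
      then have "b n = 0" using rs first_child_gt[of ?s] by (intro b(2)) simp
      then show ?thesis by simp
    qed
    have eq: "\<Psi> b pos r x (sum_list zs) = (\<Sum>t<N r. 1 / f r * \<Psi> b (?pos t) (first_child r + t) x (sum_list zs))"
      unfolding multiplier_functional_def bn by (simp only: ev_fun_sum ev_fun_scale)
    have "\<bar>\<Psi> b pos r x (sum_list zs)\<bar>
        \<le> (\<Sum>t<N r. \<bar>1 / f r * \<Psi> b (?pos t) (first_child r + t) x (sum_list zs)\<bar>)"
      unfolding eq by (rule sum_abs)
    also have "\<dots> \<le> (\<Sum>t<N r. 4 * real (\<Prod>i\<in>{Suc r..<?s}. N i) * ?P)"
    proof (rule sum_mono)
      fix t assume "t \<in> {..<N r}"
      then have t: "t < N r" by simp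
      let ?r = "first_child r + t"
      have r': "Suc r \<le> ?r" using first_child_gt[of r] by simp
      have "?r < first_child (Suc r)" using t by (simp add: first_child_Suc)
      also have "\<dots> \<le> first_child ?s" using rs by (intro first_child_mono) simp
      finally have "\<bar>\<Psi> b (?pos t) ?r x (sum_list zs)\<bar>
          \<le> 4 * real (\<Prod>i\<in>{?r..<?s}. N i) * p (proj (extent ?r (?pos t) ?U) x)"
        using r' rs by (intro less.hyps spaced_child less.prems t) auto
      also have "\<dots> \<le> 4 * real (\<Prod>i\<in>{Suc r..<?s}. N i) * ?P"
      proof (intro mult_mono)
        show "p (proj (extent ?r (?pos t) ?U) x) \<le> ?P"
          by (intro p_mono nat_interval_extent extent_child t)
        have "(\<Prod>i\<in>{?r..<?s}. N i) \<le> (\<Prod>i\<in>{Suc r..<?s}. N i)"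
          using r' by (intro prod_N_mono) auto
        then show "real (\<Prod>i\<in>{?r..<?s}. N i) \<le> real (\<Prod>i\<in>{Suc r..<?s}. N i)" by (simp only: of_nat_le_iff)
      qed (auto simp: p_nonneg intro!: prod_nonneg)
      finally have B: "\<bar>\<Psi> b (?pos t) ?r x (sum_list zs)\<bar> \<le> 4 * real (\<Prod>i\<in>{Suc r..<?s}. N i) * ?P" .
      have "\<bar>1 / f r * \<Psi> b (?pos t) ?r x (sum_list zs)\<bar> \<le> 1 * \<bar>\<Psi> b (?pos t) ?r x (sum_list zs)\<bar>"
        unfolding abs_mult using f_ge_1[of r] by (intro mult_right_mono) auto
      then show "\<bar>1 / f r * \<Psi> b (?pos t) ?r x (sum_list zs)\<bar> \<le> 4 * real (\<Prod>i\<in>{Suc r..<?s}. N i) * ?P"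
        using B by simp
    qed
    also have "\<dots> = 4 * real (\<Prod>i\<in>{r..<?s}. N i) * ?P"
      using rs by (simp add: prod.atLeast_Suc_lessThan mult_ac)
    finally show ?thesis .
  qed
qed

text \<open>The sequence \<open>b\<close> is cut at \<open>first_child (stage m)\<close>. The finite
  head is estimated coordinate by coordinate, using that the sum of the functionals still has
  coordinates at most 1; the rest is \<open>heavy_tail\<close>.\<close>

lemma heavy_block:
  assumes zs: "sorted_wrt supp_less zs" "\<forall>z\<in>set zs. z \<in> K \<and> controlled z" and m: "length zs = m"
    and b: "\<And>n. \<bar>b n\<bar> \<le> 2" and r: "r < first_child (stage m)" and pos: "spaced r pos"
  shows "\<bar>\<Psi> b pos r x (sum_list zs)\<bar> \<le> stage_bound m * p (proj (extent r pos (\<Union>z\<in>set zs. supp z)) x)"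
proof -
  let ?c = "first_child (stage m)" and ?U = "\<Union>z\<in>set zs. supp z"
  let ?P = "p (proj (extent r pos ?U) x)"
  define b1 where "b1 n = (if n < ?c then b n else 0)" for n
  define b2 where "b2 n = (if n < ?c then 0 else b n)" for n
  have "\<Psi> b pos r x (sum_list zs) = \<Psi> b1 pos r x (sum_list zs) + \<Psi> b2 pos r x (sum_list zs)"
    unfolding \<Psi>_add_fun[symmetric] by (rule arg_cong[of _ _ "\<lambda>b. \<Psi> b pos r x (sum_list zs)"]) (auto simp: b1_def b2_def)
  moreover have "\<bar>\<Psi> b1 pos r x (sum_list zs)\<bar> \<le> 2 * real ?c * ?P"
  proof -
    let ?S = "supp (sum_list zs)"
    have "\<Psi> b1 pos r x (sum_list zs) = (\<Sum>n\<in>?S \<inter> {..<?c}. coord (sum_list zs) n * (b1 n * Y (pos n) n r x))"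
      unfolding multiplier_functional_def ev_def
      by (rule sum.mono_neutral_right) (auto simp: b1_def)
    also have "\<bar>\<dots>\<bar> \<le> (\<Sum>n\<in>?S \<inter> {..<?c}. 2 * ?P)"
    proof (rule order_trans[OF sum_abs sum_mono])
      fix n assume n: "n \<in> ?S \<inter> {..<?c}"
      then have "n \<in> ?U" using supp_sum_list[of zs] by blast
      then have "p (proj (block (pos n) n r) x) \<le> ?P"
        by (intro p_mono nat_interval_ivl nat_interval_extent block_subset_extent)
      then have "\<bar>Y (pos n) n r x\<bar> \<le> ?P" using abs_Y_le[of "pos n" n r x] by linarith
      moreover have "\<bar>b1 n\<bar> \<le> 2" using b by (simp add: b1_def)
      moreover have "\<bar>coord (sum_list zs) n\<bar> \<le> 1" using zs by (intro abs_coord_sum_list_le) auto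
      ultimately have "\<bar>coord (sum_list zs) n\<bar> * (\<bar>b1 n\<bar> * \<bar>Y (pos n) n r x\<bar>) \<le> 1 * (2 * ?P)"
        by (intro mult_mono) auto
      then show "\<bar>coord (sum_list zs) n * (b1 n * Y (pos n) n r x)\<bar> \<le> 2 * ?P" by (simp add: abs_mult)
    qed
    also have "\<dots> = real (card (?S \<inter> {..<?c})) * (2 * ?P)" by simp
    also have "\<dots> \<le> real ?c * (2 * ?P)"
      using card_mono[of "{..<?c}" "?S \<inter> {..<?c}"] p_nonneg by (intro mult_right_mono) auto
    finally show ?thesis by (simp add: mult_ac)
  qed
  moreover have "\<bar>\<Psi> b2 pos r x (sum_list zs)\<bar> \<le> 4 * real (\<Prod>i<stage m. N i) * ?P"
  proof -
    have "\<bar>\<Psi> b2 pos r x (sum_list zs)\<bar> \<le> 4 * real (\<Prod>i\<in>{r..<stage m}. N i) * ?P"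
      by (rule heavy_tail[OF zs(1) _ m _ _ pos r]) (use zs b in \<open>auto simp: b2_def\<close>)
    also have "\<dots> \<le> 4 * real (\<Prod>i<stage m. N i) * ?P"
    proof (intro mult_right_mono mult_left_mono p_nonneg)
      have "(\<Prod>i\<in>{r..<stage m}. N i) \<le> (\<Prod>i<stage m. N i)"
        by (intro prod_N_mono) auto
      then show "real (\<Prod>i\<in>{r..<stage m}. N i) \<le> real (\<Prod>i<stage m. N i)" by (simp only: of_nat_le_iff)
    qed simp
    finally show ?thesis .
  qed
  ultimately have "\<bar>\<Psi> b pos r x (sum_list zs)\<bar> \<le> 2 * real ?c * ?P + 4 * real (\<Prod>i<stage m. N i) * ?P" by linarith
  then show ?thesis by (simp add: stage_bound_def distrib_right)
qed

lemma heavy_average: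
  assumes zs: "sorted_wrt supp_less zs" "\<forall>z\<in>set zs. z \<in> K \<and> controlled z" and m: "length zs = m" "m \<in> L"
    and b: "\<And>n. \<bar>b n\<bar> \<le> 2" and r: "r < first_child (stage m)" and pos: "spaced r pos"
  shows "4 / 5 / logf (real m) * \<bar>\<Sum>z\<leftarrow>zs. \<Psi> b pos r x z\<bar>
    \<le> stage_bound m / logf (real m) * p (proj (extent r pos (\<Union>z\<in>set zs. supp z)) x)"
proof -
  let ?P = "p (proj (extent r pos (\<Union>z\<in>set zs. supp z)) x)"
  have F: "256 \<le> logf (real m)" by (rule L_large[OF m(2)])
  have "4 / 5 / logf (real m) * \<bar>\<Sum>z\<leftarrow>zs. \<Psi> b pos r x z\<bar> \<le> 1 / logf (real m) * (stage_bound m * ?P)"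
    using heavy_block[OF zs m(1) b r pos, where x = x] F
    by (intro mult_mono) (auto simp: \<Psi>_sum_list field_simps)
  then show ?thesis by simp
qed

lemma sorted_wrt_concat:
  "sorted_wrt P (concat xss) \<Longrightarrow>
    (\<forall>xs\<in>set xss. sorted_wrt P xs) \<and> sorted_wrt (\<lambda>xs ys. \<forall>x\<in>set xs. \<forall>y\<in>set ys. P x y) xss"
  by (induction xss) (auto simp: sorted_wrt_append)

text \<open>Each functional brings \<open>N r\<close> intervals of its own; regrouping them reduces
  their number to \<open>h\<close>.\<close>

lemma average_cover:
  assumes zs: "sorted_wrt supp_less zs" "\<forall>z\<in>set zs. controlled z" and pos: "spaced r pos"
    and b: "\<And>n. \<bar>b n\<bar> \<le> 2" "\<And>n. n \<le> r \<Longrightarrow> b n = 0" and q: "1 \<le> q" "length zs * N r \<le> q * h"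
  shows "covers x (2 / f r * logf (real q)) h (extent r pos (\<Union>z\<in>set zs. supp z)) (\<Sum>z\<leftarrow>zs. \<bar>\<Psi> b pos r x z\<bar>)"
proof (rule covers_chunk[OF _ q nat_interval_extent])
  have "covers x (2 / f r) (\<Sum>z\<leftarrow>zs. N r) (\<Union>z\<in>set zs. extent r pos (supp z)) (\<Sum>z\<leftarrow>zs. \<bar>\<Psi> b pos r x z\<bar>)"
    using zs(2) b by (intro covers_sum sorted_extents[OF pos zs(1)]) (auto intro!: controlledD pos)
  then show "covers x (2 / f r) (length zs * N r) (extent r pos (\<Union>z\<in>set zs. supp z)) (\<Sum>z\<leftarrow>zs. \<bar>\<Psi> b pos r x z\<bar>)"
  proof (rule covers_mono)
    show "(\<Union>z\<in>set zs. extent r pos (supp z)) \<subseteq> extent r pos (\<Union>z\<in>set zs. supp z)"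
      by (intro UN_least extent_mono) auto
  qed (simp_all add: sum_list_triv)
qed (use f_ge_1[of r] in simp)

lemma extent_blocks:
  assumes "sorted_wrt supp_less (concat zss)" "spaced r pos"
  shows "sorted_wrt (\<lambda>ys zs. set_less (extent r pos (\<Union>y\<in>set ys. supp y)) (extent r pos (\<Union>z\<in>set zs. supp z))) zss"
proof (rule sorted_wrt_mono_rel[OF _ sorted_wrt_concat[OF assms(1), THEN conjunct2]])
  fix ys zs :: "c00 list" assume less: "\<forall>x\<in>set ys. \<forall>y\<in>set zs. supp_less x y"
  have "set_less (\<Union>y\<in>set ys. supp y) (\<Union>z\<in>set zs. supp z)"
    unfolding set_less_def
  proof (intro ballI)
    fix i j assume "i \<in> (\<Union>y\<in>set ys. supp y)" "j \<in> (\<Union>z\<in>set zs. supp z)"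
    then obtain y z where yz: "y \<in> set ys" "i \<in> supp y" "z \<in> set zs" "j \<in> supp z" by (elim UN_E)
    have "set_less (supp y) (supp z)" using bspec[OF bspec[OF less yz(1)] yz(3)] by (simp only: supp_less_def)
    then show "i < j" using yz(2,4) by (simp add: set_less_def)
  qed
  then show "set_less (extent r pos (\<Union>y\<in>set ys. supp y)) (extent r pos (\<Union>z\<in>set zs. supp z))"
    by (rule set_less_extent[OF assms(2)])
qed

text \<open>A block of length \<open>m <= N r\<close> is regrouped in groups of size
  \<open>B m * m\<close> instead of \<open>m\<close>. The cost
  \<open>logf (B m * m) <= 5 / 4 * logf m\<close> is balanced by the weight \<open>4 / 5\<close>,
  and only about \<open>N r / logf m\<close> intervals remain, so that the total over all lengths
  fits into \<open>N r\<close>. Longer blocks are handed to \<open>covers_merge\<close> with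
  coefficients whose sum is below \<open>2 / f r\<close>.\<close>

lemma blocks_cover:
  assumes ok: "lengths_ok (map length zss)" and zs: "sorted_wrt supp_less (concat zss)"
    and K: "\<forall>z\<in>set (concat zss). z \<in> K \<and> controlled z" and pos: "spaced r pos"
    and b: "\<And>n. \<bar>b n\<bar> \<le> 2" "\<And>n. n \<le> r \<Longrightarrow> b n = 0"
  shows "covers x (2 / f r) (N r) (extent r pos (\<Union>z\<in>set (concat zss). supp z))
    (\<Sum>ys\<leftarrow>zss. 4 / 5 / logf (real (length ys)) * \<bar>\<Sum>y\<leftarrow>ys. \<Psi> b pos r x y\<bar>)"
proof -
  \<comment> \<open>Rounding up makes the group size a natural number, and \<open>B m\<close> is
    still so small that its logarithm is at most a ninth of \<open>logf m\<close>.\<close>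
  define B where "B m = nat \<lceil>logf (real m)\<rceil>" for m
  define k where "k m = N r div B m + 1" for m
  let ?light = "\<lambda>ys. length ys \<le> N r"
  let ?I = "\<lambda>ys. extent r pos (\<Union>y\<in>set ys. supp y)"
  let ?v = "\<lambda>ys. 4 / 5 / logf (real (length ys)) * \<bar>\<Sum>y\<leftarrow>ys. \<Psi> b pos r x y\<bar>"
  let ?\<delta> = "\<lambda>ys. stage_bound (length ys) / logf (real (length ys))"
  let ?J = "extent r pos (\<Union>z\<in>set (concat zss). supp z)"
  have mL: "length ys \<in> L" if "ys \<in> set zss" for ys using ok that by (auto simp: lengths_ok_def)
  have ys: "sorted_wrt supp_less ys" "\<forall>z\<in>set ys. z \<in> K \<and> controlled z" if "ys \<in> set zss" for ys
    using sorted_wrt_concat[OF zs] K that by auto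
  have B: "logf (real m) \<le> real (B m)" "real (B m) \<le> logf (real m) + 1" "1 \<le> B m"
    if "m \<in> L" for m
    using L_large[OF that] unfolding B_def by linarith+
  have "covers x (2 / f r) ((\<Sum>ys\<leftarrow>zss. if ?light ys then Suc (k (length ys)) else 0) + 1) ?J (\<Sum>ys\<leftarrow>zss. ?v ys)"
  proof (rule covers_merge[where I = ?I and \<delta> = ?\<delta>])
    show "sorted_wrt (\<lambda>ys zs. set_less (?I ys) (?I zs)) zss" by (rule extent_blocks[OF zs pos])
  next
    fix as assume as: "as \<in> set zss" and "?light as"
    let ?m = "length as"
    have F: "256 \<le> logf (real ?m)" and m1: "256 \<le> ?m" using L_large L_ge mL[OF as] by auto
    note B = B[OF mL[OF as]]
    have "covers x (2 / f r * logf (real (B ?m * ?m))) (k ?m) (?I as) (\<Sum>z\<leftarrow>as. \<bar>\<Psi> b pos r x z\<bar>)"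
    proof (rule average_cover[OF ys(1)[OF as] _ pos b])
      show "\<forall>z\<in>set as. controlled z" using ys(2)[OF as] by simp
      have "0 < B ?m * ?m" using B(3) m1 by (simp only: nat_0_less_mult_iff) linarith
      then show "1 \<le> B ?m * ?m" by linarith
      have "N r \<le> B ?m * k ?m"
        unfolding k_def using B(3) by (metis Suc_eq_plus1 dividend_less_times_div le_less less_eq_Suc_le mult_Suc_right zero_less_one order_less_le_trans add.commute)
      then show "?m * N r \<le> B ?m * ?m * k ?m" by (simp add: mult_ac)
    qed
    then have "covers x (4 / 5 / logf (real ?m) * (2 / f r * logf (real (B ?m * ?m)))) (k ?m) (?I as)
        (4 / 5 / logf (real ?m) * (\<Sum>z\<leftarrow>as. \<bar>\<Psi> b pos r x z\<bar>))"
      using F by (intro covers_scale) auto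
    then show "covers x (2 / f r) (k ?m) (?I as) (?v as)"
    proof (rule covers_mono)
      have "logf (real (B ?m)) \<le> logf (10 * (logf (real ?m))\<^sup>2)"
      proof (rule logf_mono)
        have "logf (real ?m) * 1 \<le> logf (real ?m) * logf (real ?m)" using F by (intro mult_left_mono) auto
        then show "real (B ?m) \<le> 10 * (logf (real ?m))\<^sup>2" unfolding power2_eq_square using B(2) F by linarith
      qed simp
      also have "\<dots> \<le> logf (real ?m) / 9" by (rule logf_square_le[OF F])
      finally have "logf (real (B ?m * ?m)) \<le> 5 / 4 * logf (real ?m)"
        using logf_mult_le[of "real (B ?m)" "real ?m"] B(3) m1 F by simp
      then have "4 / 5 / logf (real ?m) * (2 / f r * logf (real (B ?m * ?m)))
          \<le> 4 / 5 / logf (real ?m) * (2 / f r * (5 / 4 * logf (real ?m)))"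
        using F f_ge_1[of r] by (intro mult_left_mono) auto
      then show "4 / 5 / logf (real ?m) * (2 / f r * logf (real (B ?m * ?m))) \<le> 2 / f r" using F by simp
      have "\<bar>\<Sum>y\<leftarrow>as. \<Psi> b pos r x y\<bar> \<le> (\<Sum>z\<leftarrow>as. \<bar>\<Psi> b pos r x z\<bar>)" by (induction as) auto
      then show "?v as \<le> 4 / 5 / logf (real ?m) * (\<Sum>z\<leftarrow>as. \<bar>\<Psi> b pos r x z\<bar>)"
        using F by (intro mult_left_mono) auto
    qed simp_all
  next
    fix as assume as: "as \<in> set zss" and "\<not> ?light as"
    then have "r < stage (length as)" using le_N_stage[of "length as" r] by linarith
    then have "r < first_child (stage (length as))" using first_child_gt[of "stage (length as)"] by simp
    then show "?v as \<le> ?\<delta> as * p (proj (?I as) x)"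
      using ys[OF as] mL[OF as] b(1) pos by (intro heavy_average) auto
  next
    fix as assume as: "as \<in> set zss"
    have "?I as \<subseteq> ?J" using as by (intro extent_mono) auto
    then show "nat_interval (?I as) \<and> ?I as \<subseteq> ?J \<and> 0 \<le> ?\<delta> as"
      by (simp add: nat_interval_extent stage_bound_nonneg logf_nonneg)
  next
    show "nat_interval ?J" by (rule nat_interval_extent)
    show "0 \<le> 2 / f r" using f_ge_1[of r] by simp
    have "(\<Sum>as\<leftarrow>zss. if ?light as then 0 else ?\<delta> as)
        = (\<Sum>m\<leftarrow>map length zss. if m \<le> N r then 0 else stage_bound m / logf (real m))"
      by (simp add: comp_def)
    also have "\<dots> \<le> (3 / 8 / f r) / 4"
    proof (rule sum_list_lengths_ok[OF ok])
      fix m assume m: "m \<in> L"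
      show "0 \<le> (if m \<le> N r then 0 else stage_bound m / logf (real m))"
        by (simp add: stage_bound_nonneg logf_nonneg)
      show "(if m \<le> N r then 0 else stage_bound m / logf (real m)) \<le> 3 / 8 / f r / sqrt (logf (real m))"
        using stage_bound_le(2)[OF m, of r] f_ge_1[of r] L_large[OF m] by auto
    qed (use f_ge_1[of r] in simp)
    also have "\<dots> \<le> 2 / f r" using f_ge_1[of r] by (simp add: divide_simps)
    finally show "(\<Sum>as\<leftarrow>zss. if ?light as then 0 else ?\<delta> as) \<le> 2 / f r" .
  qed
  then show ?thesis
  proof (rule covers_mono)
    let ?N = "real (N r)"
    have N: "256 \<le> ?N" using N_ge[of r] by simp
    have "real (\<Sum>ys\<leftarrow>zss. if ?light ys then Suc (k (length ys)) else 0)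
        = (\<Sum>ys\<leftarrow>zss. if ?light ys then real (k (length ys)) + 1 else 0)"
      by (induction zss) auto
    also have "\<dots> \<le> (\<Sum>ys\<leftarrow>zss. ?N * (1 / logf (real (length ys))) + (if ?light ys then 2 else 0))"
    proof (rule sum_list_mono)
      fix ys assume "ys \<in> set zss"
      note m = mL[OF this]
      have F: "256 \<le> logf (real (length ys))" by (rule L_large[OF m])
      have "real (N r div B (length ys)) \<le> ?N / real (B (length ys))" by (rule of_nat_div_le_of_nat)
      also have "\<dots> \<le> ?N / logf (real (length ys))" using B[OF m] F by (intro divide_left_mono) auto
      finally have "real (k (length ys)) \<le> ?N / logf (real (length ys)) + 1" by (simp add: k_def)
      then show "(if ?light ys then real (k (length ys)) + 1 else 0)
          \<le> ?N * (1 / logf (real (length ys))) + (if ?light ys then 2 else 0)"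
        using F by auto
    qed
    also have "\<dots> = ?N * (\<Sum>m\<leftarrow>map length zss. 1 / logf (real m)) + 2 * real (length (filter ?light zss))"
      by (induction zss) (auto simp: algebra_simps)
    also have "\<dots> \<le> ?N * (1 / 16 / 4) + 2 * (sqrt (f r) / 4)"
    proof (intro add_mono mult_left_mono)
      show "(\<Sum>m\<leftarrow>map length zss. 1 / logf (real m)) \<le> 1 / 16 / 4"
      proof (rule sum_list_lengths_ok[OF ok])
        fix m assume "m \<in> L"
        then have F: "256 \<le> logf (real m)" by (rule L_large)
        then show "0 \<le> 1 / logf (real m)" by simp
        have "16 * sqrt (logf (real m)) \<le> sqrt (logf (real m)) * sqrt (logf (real m))"
        proof (rule mult_right_mono)
          show "16 \<le> sqrt (logf (real m))" using F by (intro real_le_rsqrt) simp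
        qed (use F in simp)
        then show "1 / logf (real m) \<le> 1 / 16 / sqrt (logf (real m))" using F by (simp add: field_simps)
      qed simp
      show "real (length (filter ?light zss)) \<le> sqrt (f r) / 4"
        using N_ge[of r] by (intro block_count_le[OF ok]) simp
    qed simp_all
    also have "sqrt (f r) \<le> ?N"
    proof -
      have "f r * 1 \<le> f r * f r" using f_ge_1[of r] by (intro mult_left_mono) auto
      then have "sqrt (f r) \<le> sqrt (f r * f r)" by (intro real_sqrt_le_mono) simp
      also have "\<dots> = f r" using f_ge_1[of r] by simp
      also have "\<dots> \<le> ?N" by (rule logf_le_of_nat)
      finally show ?thesis .
    qed
    finally have "real ((\<Sum>ys\<leftarrow>zss. if ?light ys then Suc (k (length ys)) else 0) + 1) \<le> ?N"
      using N by simp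
    then show "(\<Sum>ys\<leftarrow>zss. if ?light ys then Suc (k (length ys)) else 0) + 1 \<le> N r" by (simp only: of_nat_le_iff)
  qed simp_all
qed

text \<open>An average of length \<open>q\<close> would have \<open>q * N r\<close> intervals;
  grouping them by \<open>q\<close> restores the number \<open>N r\<close>, and the cost
  \<open>logf q\<close> cancels the weight of the average. Special functionals are the subject of
  \<open>blocks_cover\<close>.\<close>

lemma controlled_K: "z \<in> K \<Longrightarrow> controlled z"
proof (induction rule: K.induct)
  case (leaf a n)
  show ?case
    unfolding controlled_def
  proof (intro allI impI)
    fix r pos x and b :: "nat \<Rightarrow> real" assume pos: "spaced r pos" and b: "\<forall>n. \<bar>b n\<bar> \<le> 2" "\<forall>n\<le>r. b n = 0"
    let ?z = "Poly_Mapping.single n a"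
    have \<Psi>: "\<Psi> b pos r x ?z = a * (b n * Y (pos n) n r x)" by (simp add: multiplier_functional_def)
    show "covers x (2 / f r) (N r) (extent r pos (supp ?z)) \<bar>\<Psi> b pos r x ?z\<bar>"
    \<comment> \<open>For \<open>n <= r\<close> the node \<open>r\<close> is not expanded and
      provides no average to exploit; such \<open>n\<close> are excluded by the hypothesis that
      \<open>b\<close> vanishes there.\<close>
    proof (cases "a = 0 \<or> n \<le> r")
      case True
      then show ?thesis using b by (intro covers_zero) (auto simp: \<Psi>)
    next
      case False
      then have rn: "r < n" and supp: "supp ?z = {n}" by auto
      let ?B = "\<lambda>t. block (pos n + offset n r t) n (first_child r + t)"
      let ?Es = "map ?B [0..<N r]"
      have "\<bar>\<Psi> b pos r x ?z\<bar> \<le> 1 * (2 * (1 / f r * (\<Sum>t<N r. p (proj (?B t) x))))"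
        unfolding \<Psi> Y_node[OF rn] abs_mult
        using leaf b f_ge_1[of r] by (intro mult_mono order_trans[OF sum_abs] sum_mono abs_Y_le) (auto intro!: mult_nonneg_nonneg sum_nonneg p_nonneg)
      also have "\<dots> = 2 / f r * (\<Sum>E\<leftarrow>?Es. p (proj E x))"
        by (simp add: comp_def interv_sum_list_conv_sum_set_nat lessThan_atLeast0)
      finally have "\<bar>\<Psi> b pos r x ?z\<bar> \<le> 2 / f r * (\<Sum>E\<leftarrow>?Es. p (proj E x))" .
      moreover have "\<forall>E\<in>set ?Es. nat_interval E \<and> E \<subseteq> extent r pos (supp ?z)"
      proof
        fix E assume "E \<in> set ?Es"
        then obtain t where t: "t < N r" "E = ?B t" by auto
        have "E \<subseteq> block (pos n) n r" using offset_le[OF t(1), of n] unfolding t(2) by auto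
        also have "\<dots> \<subseteq> extent r pos (supp ?z)" using False by (intro block_subset_extent) simp
        finally show "nat_interval E \<and> E \<subseteq> extent r pos (supp ?z)" by (simp add: t(2) nat_interval_ivl)
      qed
      ultimately show ?thesis unfolding covers_def
        using sorted_child_blocks[OF rn, of "pos n"] by (intro exI[of _ ?Es]) simp
    qed
  qed
next
  case (node \<gamma>s zs)
  let ?z = "comb \<gamma>s zs"
  have w: "0 < \<gamma>s ! c" if "c < length zs" for c using adm_weight[OF node(1), of c] that node(2) by simp
  have supp: "supp ?z = (\<Union>z\<in>set zs. supp z)" using w by (intro supp_comb[OF node(3)]) force
  show ?case
    unfolding controlled_def
  proof (intro allI impI)
    fix r pos x and b :: "nat \<Rightarrow> real" assume pos: "spaced r pos" and b: "\<forall>n. \<bar>b n\<bar> \<le> 2" "\<forall>n\<le>r. b n = 0"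
    show "covers x (2 / f r) (N r) (extent r pos (supp ?z)) \<bar>\<Psi> b pos r x ?z\<bar>"
      using node(1,2)
    proof (cases rule: comb_adm_cases)
      case (average q)
      have Fq: "1 \<le> logf (real q)" using average(1) by (intro logf_ge_1) simp
      have "covers x (2 / f r * logf (real q)) (N r) (extent r pos (supp ?z)) (\<Sum>z\<leftarrow>zs. \<bar>\<Psi> b pos r x z\<bar>)"
        unfolding supp using average node(3,4) b by (intro average_cover pos) auto
      then have "covers x (1 / logf (real q) * (2 / f r * logf (real q))) (N r) (extent r pos (supp ?z))
          (1 / logf (real q) * (\<Sum>z\<leftarrow>zs. \<bar>\<Psi> b pos r x z\<bar>))"
        using Fq by (intro covers_scale) auto
      then show ?thesis
      proof (rule covers_mono)
        have "\<bar>\<Psi> b pos r x ?z\<bar> \<le> (\<Sum>c<length zs. \<bar>\<gamma>s ! c * \<Psi> b pos r x (zs ! c)\<bar>)"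
          unfolding \<Psi>_comb by (rule sum_abs)
        also have "\<dots> = 1 / logf (real q) * (\<Sum>z\<leftarrow>zs. \<bar>\<Psi> b pos r x z\<bar>)"
          using average Fq by (simp add: abs_mult sum_list_sum_nth atLeast0LessThan sum_divide_distrib)
        finally show "\<bar>\<Psi> b pos r x ?z\<bar> \<le> 1 / logf (real q) * (\<Sum>z\<leftarrow>zs. \<bar>\<Psi> b pos r x z\<bar>)" .
      qed (use Fq in auto)
    next
      case (blocks zss)
      have "covers x (2 / f r) (N r) (extent r pos (\<Union>z\<in>set (concat zss). supp z))
          (\<Sum>ys\<leftarrow>zss. 4 / 5 / logf (real (length ys)) * \<bar>\<Sum>y\<leftarrow>ys. \<Psi> b pos r x y\<bar>)"
        using blocks(1,2) node(3,4) b by (intro blocks_cover pos) auto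
      then show ?thesis
      proof (rule covers_mono)
        show "extent r pos (\<Union>z\<in>set (concat zss). supp z) \<subseteq> extent r pos (supp ?z)"
          unfolding supp using blocks(1) by simp
        have "\<bar>\<Sum>ys\<leftarrow>zss. h ys\<bar> \<le> (\<Sum>ys\<leftarrow>zss. \<bar>h ys\<bar>)" for h :: "c00 list \<Rightarrow> real"
          by (induction zss) auto
        then have "\<bar>\<Psi> b pos r x ?z\<bar> \<le> (\<Sum>ys\<leftarrow>zss. \<bar>4 / 5 / logf (real (length ys)) * (\<Sum>y\<leftarrow>ys. \<Psi> b pos r x y)\<bar>)"
          unfolding \<Psi>_comb blocks(3)[of "\<Psi> b pos r x"] by blast
        then show "\<bar>\<Psi> b pos r x ?z\<bar> \<le> (\<Sum>ys\<leftarrow>zss. 4 / 5 / logf (real (length ys)) * \<bar>\<Sum>y\<leftarrow>ys. \<Psi> b pos r x y\<bar>)"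
          by (simp only: abs_mult) (simp add: logf_nonneg)
      qed simp_all
    qed
  qed
qed

text \<open>At the root the constant is 1: averages reproduce the bound exactly, and special
  functionals contribute less than it. The bounds for \<open>b\<close> and for
  \<open>b n * Y\<close> are separate because coefficients up to 2 occur when functionals of norm
  less than one are rescaled.\<close>

theorem \<Psi>_le:
  assumes z: "z \<in> K" and b: "\<And>n. \<bar>b n\<bar> \<le> 2" and pos: "spaced 0 pos"
    and bY: "\<And>n x. \<bar>b n * Y (pos n) n 0 x\<bar> \<le> p (proj (block (pos n) n 0) x)"
  shows "\<bar>\<Psi> b pos 0 x z\<bar> \<le> p (proj (extent 0 pos (supp z)) x)"
  using z
proof (induction rule: K.induct)
  case (leaf a n)
  show ?case
  proof (cases "a = 0")
    case False
    then have supp: "supp (Poly_Mapping.single n a) = {n}" by simp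
    have "\<bar>\<Psi> b pos 0 x (Poly_Mapping.single n a)\<bar> = \<bar>a\<bar> * \<bar>b n * Y (pos n) n 0 x\<bar>"
      by (simp add: multiplier_functional_def abs_mult)
    also have "\<dots> \<le> 1 * p (proj (block (pos n) n 0) x)" using leaf by (intro mult_mono bY) auto
    also have "\<dots> \<le> p (proj (extent 0 pos (supp (Poly_Mapping.single n a))) x)"
      unfolding supp mult_1 by (intro p_mono nat_interval_ivl nat_interval_extent block_subset_extent) simp
    finally show ?thesis .
  qed (simp add: multiplier_functional_def p_nonneg)
next
  case (node \<gamma>s zs)
  let ?z = "comb \<gamma>s zs"
  let ?P = "p (proj (extent 0 pos (supp ?z)) x)"
  have w: "0 < \<gamma>s ! c" if "c < length zs" for c using adm_weight[OF node(1), of c] that node(2) by simp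
  have supp: "supp ?z = (\<Union>z\<in>set zs. supp z)" using w by (intro supp_comb[OF node(3)]) force
  show ?case
    using node(1,2)
  proof (cases rule: comb_adm_cases)
    case (average q)
    have Fq: "1 \<le> logf (real q)" using average(1) by (intro logf_ge_1) simp
    have "\<bar>\<Psi> b pos 0 x ?z\<bar> \<le> (\<Sum>c<length zs. \<bar>\<gamma>s ! c * \<Psi> b pos 0 x (zs ! c)\<bar>)"
      unfolding \<Psi>_comb by (rule sum_abs)
    also have "\<dots> = 1 / logf (real q) * (\<Sum>z\<leftarrow>zs. \<bar>\<Psi> b pos 0 x z\<bar>)"
      using average Fq by (simp add: abs_mult sum_list_sum_nth atLeast0LessThan sum_divide_distrib)
    finally have 1: "\<bar>\<Psi> b pos 0 x ?z\<bar> \<le> 1 / logf (real q) * (\<Sum>z\<leftarrow>zs. \<bar>\<Psi> b pos 0 x z\<bar>)" .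
    have "(\<Sum>z\<leftarrow>zs. \<bar>\<Psi> b pos 0 x z\<bar>) \<le> (\<Sum>z\<leftarrow>zs. p (proj (extent 0 pos (supp z)) x))"
      using node(4) by (intro sum_list_mono) auto
    also have "\<dots> = (\<Sum>E\<leftarrow>map (\<lambda>z. extent 0 pos (supp z)) zs. p (proj E x))" by (simp add: comp_def)
    also have "\<dots> \<le> logf (real q) * ?P"
    proof (rule p_average)
      show "sorted_wrt set_less (map (\<lambda>z. extent 0 pos (supp z)) zs)"
        using sorted_extents[OF pos node(3)] by (simp add: sorted_wrt_map)
      show "\<forall>E\<in>set (map (\<lambda>z. extent 0 pos (supp z)) zs). nat_interval E \<and> E \<subseteq> extent 0 pos (supp ?z)"
      proof
        fix E assume "E \<in> set (map (\<lambda>z. extent 0 pos (supp z)) zs)"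
        then obtain y where y: "y \<in> set zs" "E = extent 0 pos (supp y)" by auto
        have "E \<subseteq> extent 0 pos (supp ?z)" unfolding y(2) supp using y(1) by (intro extent_mono) auto
        then show "nat_interval E \<and> E \<subseteq> extent 0 pos (supp ?z)" by (simp add: y(2) nat_interval_extent)
      qed
    qed (use average nat_interval_extent in auto)
    finally have "1 / logf (real q) * (\<Sum>z\<leftarrow>zs. \<bar>\<Psi> b pos 0 x z\<bar>) \<le> 1 / logf (real q) * (logf (real q) * ?P)"
      using Fq by (intro mult_left_mono) auto
    then show ?thesis using 1 Fq by simp
  next
    case (blocks zss)
    have "\<bar>\<Sum>ys\<leftarrow>zss. h ys\<bar> \<le> (\<Sum>ys\<leftarrow>zss. \<bar>h ys\<bar>)" for h :: "c00 list \<Rightarrow> real"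
      by (induction zss) auto
    then have "\<bar>\<Psi> b pos 0 x ?z\<bar> \<le> (\<Sum>ys\<leftarrow>zss. \<bar>4 / 5 / logf (real (length ys)) * (\<Sum>y\<leftarrow>ys. \<Psi> b pos 0 x y)\<bar>)"
      unfolding \<Psi>_comb blocks(3)[of "\<Psi> b pos 0 x"] by blast
    \<comment> \<open>At the root every block may be treated as a long one, because 0 is below
      \<open>first_child (stage m)\<close> for every \<open>m\<close>.\<close>
    also have "\<dots> \<le> (\<Sum>ys\<leftarrow>zss. stage_bound (length ys) / logf (real (length ys)) * ?P)"
    proof (rule sum_list_mono)
      fix ys assume ys: "ys \<in> set zss"
      have mL: "length ys \<in> L" using blocks(2) ys by (auto simp: lengths_ok_def)
      have "4 / 5 / logf (real (length ys)) * \<bar>\<Sum>y\<leftarrow>ys. \<Psi> b pos 0 x y\<bar>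
          \<le> stage_bound (length ys) / logf (real (length ys)) * p (proj (extent 0 pos (\<Union>y\<in>set ys. supp y)) x)"
      proof (rule heavy_average[OF _ _ refl mL b _ pos])
        show "sorted_wrt supp_less ys" using sorted_wrt_concat node(3) ys unfolding blocks(1) by blast
        show "\<forall>z\<in>set ys. z \<in> K \<and> controlled z" using node(4) ys controlled_K unfolding blocks(1) by auto
        show "0 < first_child (stage (length ys))" by (simp add: first_child_def)
      qed
      also have "\<dots> \<le> stage_bound (length ys) / logf (real (length ys)) * ?P"
      proof (intro mult_left_mono p_mono nat_interval_extent extent_mono)
        show "(\<Union>y\<in>set ys. supp y) \<subseteq> supp ?z" unfolding supp using ys blocks(1) by auto
      qed (simp add: stage_bound_nonneg logf_nonneg)
      finally show "\<bar>4 / 5 / logf (real (length ys)) * (\<Sum>y\<leftarrow>ys. \<Psi> b pos 0 x y)\<bar>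
          \<le> stage_bound (length ys) / logf (real (length ys)) * ?P"
        by (simp only: abs_mult) (simp add: logf_nonneg)
    qed
    also have "\<dots> = (\<Sum>m\<leftarrow>map length zss. stage_bound m / logf (real m)) * ?P"
      by (simp only: sum_list_mult_const map_map comp_def)
    also have "\<dots> \<le> (3 / 8 / 4) * ?P"
    proof (intro mult_right_mono p_nonneg sum_list_lengths_ok[OF blocks(2)])
      fix m assume m: "m \<in> L"
      show "0 \<le> stage_bound m / logf (real m)" by (simp add: stage_bound_nonneg logf_nonneg)
      show "stage_bound m / logf (real m) \<le> 3 / 8 / sqrt (logf (real m))" by (rule stage_bound_le(1)[OF m])
    qed simp
    also have "\<dots> \<le> 1 * ?P" by (intro mult_right_mono p_nonneg) simp
    finally show ?thesis by simp
  qed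
qed

end

section \<open>The norms of \<open>GM\<close> and \<open>S\<close>\<close>

lemma square_le_exp: "0 \<le> y \<Longrightarrow> y\<^sup>2 \<le> exp (y::real)"
proof -
  assume y: "0 \<le> y"
  have "y \<le> (1 + y / 4)\<^sup>2"
    using zero_le_power2[of "y / 4 - 1"] by (simp add: power2_eq_square algebra_simps)
  then have "y\<^sup>2 \<le> ((1 + y / 4)\<^sup>2)\<^sup>2" using y by (intro power_mono) auto
  also have "\<dots> = (1 + y / 4) ^ 4" by simp
  also have "\<dots> \<le> exp (y / 4) ^ 4" using y by (intro power_mono exp_ge_add_one_self) auto
  also have "\<dots> = exp y" by (simp flip: exp_of_nat_mult)
  finally show ?thesis .
qed

text \<open>With \<open>y = 4 * n ^ 2\<close> the exponent \<open>16 * n ^ 4\<close> is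
  \<open>y ^ 2\<close>, which is at most \<open>exp y\<close>; two of the three logarithms in the
  gap condition are thereby used up.\<close>

lemma two_power_le_logf:
  assumes m: "256 \<le> logf (real m)" and gap: "4 * (real n)\<^sup>2 \<le> ln (ln (ln (real m)))"
  shows "2 ^ (16 * n ^ 4) \<le> logf (real m)"
proof -
  have m256: "256 \<le> real m" using m logf_le_of_nat[of m] by linarith
  have "ln (1 / 2) \<le> 1 / 2 - (1::real)" by (intro ln_le_minus_one) simp
  then have ln2: "1 / 2 \<le> ln (2::real)" by (simp add: ln_div)
  have "ln (2 ^ 8) = real 8 * ln (2::real)" by (rule ln_realpow)
  moreover have "ln (2 ^ 8) \<le> ln (real m)" using m256 by (subst ln_le_cancel_iff) auto
  ultimately have "4 \<le> ln (real m)" using ln2 by linarith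
  then have "ln 2 \<le> ln (ln (real m))" "0 < ln (real m)" by auto
  then have pos: "0 < ln (ln (real m))" "0 < ln (real m)" using ln2 by auto
  let ?y = "4 * (real n)\<^sup>2"
  have "2 ^ (16 * n ^ 4) = exp (real (16 * n ^ 4) * ln 2)"
    by (subst exp_of_nat_mult) simp
  also have "\<dots> \<le> exp (real (16 * n ^ 4) * 1)"
    using ln_le_minus_one[of 2] by (simp only: exp_le_cancel_iff) (intro mult_left_mono, auto)
  also have "real (16 * n ^ 4) * 1 = ?y\<^sup>2" by (simp add: power_mult_distrib)
  also have "exp (?y\<^sup>2) \<le> exp (exp ?y)" by (simp only: exp_le_cancel_iff) (intro square_le_exp, simp)
  also have "\<dots> \<le> exp (exp (ln (ln (ln (real m)))))" using gap by (simp only: exp_le_cancel_iff)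
  also have "\<dots> = ln (real m)" using pos by simp
  also have "\<dots> \<le> ln (real m + 1)" using m256 by simp
  also have "\<dots> \<le> ln (real m + 1) / ln 2"
    using ln_le_minus_one[of 2] ln2 m256 by (simp add: le_divide_eq mult_left_le)
  finally show ?thesis by (simp add: logf_def log_def)
qed

lemma L_set_subset: "infinite J \<Longrightarrow> L_set J \<subseteq> J"
  by (auto simp: L_set_def j_seq_def enumerate_in_set)

lemma lacunary_L_set:
  assumes "GM_parameters J \<sigma>" shows "lacunary (L_set J)"
proof
  have J: "infinite J" "\<And>n m. n \<in> J \<Longrightarrow> m \<in> J \<Longrightarrow> n < m \<Longrightarrow> 4 * (real n)\<^sup>2 \<le> ln (ln (ln (real m)))"
    "256 \<le> logf (real (Inf J))"
    using assms by (auto simp: GM_parameters_def)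
  have large: "256 \<le> logf (real m)" if "m \<in> J" for m
  proof -
    have "Inf J \<le> m" using that by (intro cInf_lower) auto
    then show ?thesis using J(3) logf_mono[of "real (Inf J)" "real m"] by simp
  qed
  have "inj_on (\<lambda>k. j_seq J (2 * k)) {1..}"
    unfolding inj_on_def j_seq_def using strict_mono_enumerate[OF J(1)] by (auto simp: strict_mono_eq)
  then have "infinite ((\<lambda>k. j_seq J (2 * k)) ` {1..})" by (simp add: finite_image_iff infinite_Ici)
  moreover have "(\<lambda>k. j_seq J (2 * k)) ` {1..} = L_set J" by (auto simp: L_set_def)
  ultimately show "infinite (L_set J)" by simp
  show "256 \<le> logf (real m)" if "m \<in> L_set J" for m using large L_set_subset[OF J(1)] that by blast
  fix n m assume "n \<in> L_set J" "m \<in> L_set J" "n < m"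
  then show "2 ^ (16 * n ^ 4) \<le> logf (real m)"
    using L_set_subset[OF J(1)] by (intro two_power_le_logf large J(2)) auto
qed

lemma sorted_wrt_concatI:
  assumes "\<And>xs. xs \<in> set xss \<Longrightarrow> sorted_wrt P xs" "sorted_wrt (\<lambda>xs ys. \<forall>x\<in>set xs. \<forall>y\<in>set ys. P x y) xss"
  shows "sorted_wrt P (concat xss)"
  using assms by (induction xss) (auto simp: sorted_wrt_append)

text \<open>A list has only one decomposition into blocks of prescribed lengths, so the blocks found
  by \<open>sum_block_weights\<close> are the given ones.\<close>

lemma sum_block_weights_concat:
  fixes h :: "'b \<Rightarrow> 'a::real_vector"
  shows "(\<Sum>c<length (concat zss). (concat (map (\<lambda>m. replicate m (w m)) (map length zss)) ! c) *\<^sub>R h (concat zss ! c))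
    = (\<Sum>ys\<leftarrow>zss. w (length ys) *\<^sub>R (\<Sum>y\<leftarrow>ys. h y))"
proof -
  have "length (concat zss) = sum_list (map length zss)" by (rule length_concat)
  from sum_block_weights[where 'a = 'a, OF this, of w] obtain zss' where zss': "concat zss = concat zss'"
    "map length zss' = map length zss"
    "\<And>h :: 'b \<Rightarrow> 'a. (\<Sum>c<length (concat zss). (concat (map (\<lambda>m. replicate m (w m)) (map length zss)) ! c) *\<^sub>R h (concat zss ! c))
      = (\<Sum>ys\<leftarrow>zss'. w (length ys) *\<^sub>R (\<Sum>y\<leftarrow>ys. h y))" by blast
  have len: "length zss' = length zss" using zss'(2) by (metis length_map)
  have "zss' = zss"
  proof (rule concat_injective)
    have "length (zss' ! i) = length (zss ! i)" if "i < length zss" for i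
      using arg_cong[OF zss'(2), of "\<lambda>xs. xs ! i"] that len by simp
    then show "\<forall>(x, y)\<in>set (zip zss' zss). length x = length y" by (auto simp: set_zip len)
  qed (use zss'(1) len in auto)
  then show ?thesis using zss'(3) by blast
qed

context lacunary
begin

text \<open>The functionals combined need only be dominated by \<open>NK\<close>. This form of
  closure is compatible with convex combinations and therefore serves the induction over the levels
  of \<open>GM_star\<close>.\<close>

lemma ev_comb_le_NK:
  assumes "adm \<gamma>s" "length zs = length \<gamma>s" "sorted_wrt supp_less zs"
    and "\<And>z y. z \<in> set zs \<Longrightarrow> ev (coord y) z \<le> NK y"
  shows "ev (coord x) (comb \<gamma>s zs) \<le> NK x"
proof -
  let ?xs = "map (\<lambda>z. proj (supp z) x) zs"
  have sorted: "sorted_wrt supp_less ?xs"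
    unfolding sorted_wrt_map
    by (rule sorted_wrt_mono_rel[OF _ assms(3)]) (auto intro: supp_less_subset simp: keys_proj)
  have "ev (coord x) (comb \<gamma>s zs) \<le> (\<Sum>c<length zs. \<gamma>s ! c * NK (?xs ! c))"
    unfolding ev_comb
  proof (intro sum_mono mult_left_mono)
    fix c assume "c \<in> {..<length zs}"
    then have c: "c < length zs" by simp
    have "ev (coord x) (zs ! c) = ev (coord (?xs ! c)) (zs ! c)"
      using c by (intro ev_cong) (simp add: proj.rep_eq)
    also have "\<dots> \<le> NK (?xs ! c)" using c by (intro assms(4)) auto
    finally show "ev (coord x) (zs ! c) \<le> NK (?xs ! c)" .
    show "0 \<le> \<gamma>s ! c" using adm_weight[OF assms(1), of c] c assms(2) by simp
  qed
  also have "\<dots> \<le> NK (sum_list ?xs)" using NK_adm[OF assms(1) _ sorted] assms(2) by simp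
  also have "\<dots> \<le> NK x" by (simp add: sum_list_proj_supp[OF assms(3)] NK_proj_le)
  finally show ?thesis .
qed

lemma ev_average_le_NK:
  assumes "sorted_wrt supp_less zs" "\<And>z y. z \<in> set zs \<Longrightarrow> ev (coord y) z \<le> NK y"
  shows "ev (coord x) ((1 / logf (real (length zs))) *\<^sub>R sum_list zs) \<le> NK x"
proof (cases "zs = []")
  case False
  let ?g = "replicate (length zs) (1 / logf (real (length zs)))"
  have "comb ?g zs = (1 / logf (real (length zs))) *\<^sub>R sum_list zs"
    by (simp add: comb_def sum_list_sum_nth atLeast0LessThan scaleR_sum_right)
  moreover have "adm ?g" using False by (intro adm_replicate) (simp add: Suc_leI)
  ultimately show ?thesis using ev_comb_le_NK[of ?g zs x] assms by simp
qed (simp add: NK_nonneg)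

lemma abs_ev_le_NK:
  assumes "\<And>y. ev (coord y) z \<le> NK y" shows "\<bar>ev (coord x) z\<bar> \<le> NK x"
proof -
  have "ev (coord (- x)) z = - ev (coord x) z"
    using ev_coord_add[of x "- x" z] by (simp add: ev_def)
  then show ?thesis using assms[of x] assms[of "- x"] NK_uminus[of x] by simp
qed

text \<open>Admissible combinations carry the weight \<open>4 / 5\<close>; smaller weights
  \<open>t\<close>, such as \<open>1 / sqrt (logf l)\<close> for \<open>l >= 2\<close>, result from
  scaling by \<open>5 / 4 * t <= 1\<close>.\<close>

lemma ev_blocks_le_NK:
  assumes "lengths_ok (map length zss)" "sorted_wrt supp_less (concat zss)"
    and "\<And>z y. z \<in> set (concat zss) \<Longrightarrow> ev (coord y) z \<le> NK y"
    and t: "0 \<le> t" "t \<le> 4 / 5"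
  shows "ev (coord x) (t *\<^sub>R (\<Sum>zs\<leftarrow>zss. (1 / logf (real (length zs))) *\<^sub>R sum_list zs)) \<le> NK x"
proof -
  let ?g = "concat (map (\<lambda>m. replicate m (4 / 5 / logf (real m))) (map length zss))"
  let ?c = "comb ?g (concat zss)"
  have "?c = (\<Sum>zs\<leftarrow>zss. (4 / 5 / logf (real (length zs))) *\<^sub>R (\<Sum>z\<leftarrow>zs. z))"
    unfolding comb_def by (rule sum_block_weights_concat)
  also have "\<dots> = (4 / 5) *\<^sub>R (\<Sum>zs\<leftarrow>zss. (1 / logf (real (length zs))) *\<^sub>R sum_list zs)"
    by (induction zss) (auto simp: scaleR_add_right)
  finally have eq: "t *\<^sub>R (\<Sum>zs\<leftarrow>zss. (1 / logf (real (length zs))) *\<^sub>R sum_list zs) = (5 / 4 * t) *\<^sub>R ?c"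
    by simp
  have "adm ?g" unfolding adm_def using assms(1) by blast
  moreover have "length (concat zss) = length ?g" by (simp add: length_concat comp_def)
  ultimately have "ev (coord x) ?c \<le> NK x" using assms(2,3) by (intro ev_comb_le_NK)
  then have "5 / 4 * t * ev (coord x) ?c \<le> 5 / 4 * t * NK x" using t by (intro mult_left_mono) auto
  also have "\<dots> \<le> 1 * NK x" using t NK_nonneg by (intro mult_right_mono) auto
  finally show ?thesis by (simp add: eq ev_scaleR)
qed

end

lemma ev_GM_star_le_NK:
  assumes par: "GM_parameters J \<sigma>"
  shows "z \<in> GM_star J \<sigma> k \<Longrightarrow> ev (coord x) z \<le> lacunary.NK (L_set J) x"
proof (induction k arbitrary: z x)
  interpret lacunary "L_set J" by (rule lacunary_L_set[OF par])
  case 0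
  then show ?case by (auto intro!: NK_upper K.leaf)
next
  interpret lacunary "L_set J" by (rule lacunary_L_set[OF par])
  case (Suc k)
  let ?G = "GM_star J \<sigma> k"
  from Suc.prems obtain E w where z: "z = proj E w" and w: "GM_form1 ?G w \<or> GM_form2 ?G w \<or> GM_form3 J \<sigma> ?G w"
    by auto
  have "ev (coord y) w \<le> NK y" for y
    using w
  proof (elim disjE)
    assume "GM_form1 ?G w"
    then obtain l :: nat and \<alpha> zs where \<alpha>: "(\<Sum>i=1..l. \<bar>\<alpha> i\<bar>) \<le> 1" "\<forall>i\<in>{1..l}. zs i \<in> ?G"
      "w = (\<Sum>i=1..l. \<alpha> i *\<^sub>R zs i)" unfolding GM_form1_def by blast
    have "ev (coord y) w \<le> (\<Sum>i=1..l. \<bar>\<alpha> i\<bar> * NK y)"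
      unfolding \<alpha>(3) ev_sum ev_scaleR
    proof (rule sum_mono)
      fix i assume i: "i \<in> {1..l}"
      have "\<bar>ev (coord y) (zs i)\<bar> \<le> NK y" using Suc.IH \<alpha>(2) i by (intro abs_ev_le_NK) auto
      then have "\<bar>\<alpha> i\<bar> * \<bar>ev (coord y) (zs i)\<bar> \<le> \<bar>\<alpha> i\<bar> * NK y" by (intro mult_left_mono) auto
      then show "\<alpha> i * ev (coord y) (zs i) \<le> \<bar>\<alpha> i\<bar> * NK y" by (simp flip: abs_mult)
    qed
    also have "\<dots> \<le> 1 * NK y"
      unfolding sum_distrib_right[symmetric] using \<alpha>(1) NK_nonneg by (rule mult_right_mono)
    finally show ?thesis by simp
  next
    assume "GM_form2 ?G w"
    then obtain l :: nat and zs where l: "\<forall>i\<in>{1..l}. zs i \<in> ?G"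
      "\<forall>i\<in>{1..l}. \<forall>j\<in>{1..l}. i < j \<longrightarrow> supp_less (zs i) (zs j)"
      "w = (1 / logf (real l)) *\<^sub>R (\<Sum>i=1..l. zs i)" unfolding GM_form2_def by blast
    let ?zs = "map zs [1..<Suc l]"
    have "w = (1 / logf (real (length ?zs))) *\<^sub>R sum_list ?zs"
      by (simp add: l(3) interv_sum_list_conv_sum_set_nat atLeastLessThanSuc_atLeastAtMost del: upt_Suc)
    moreover have "sorted_wrt supp_less ?zs"
      using l(2) by (simp add: sorted_wrt_iff_nth_less del: upt_Suc)
    moreover have "ev (coord y) z \<le> NK y" if "z \<in> set ?zs" for z y
      using that l(1) by (intro Suc.IH) (auto simp del: upt_Suc)
    ultimately show ?thesis using ev_average_le_NK[of ?zs y] by (simp only:)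
  next
    assume "GM_form3 J \<sigma> ?G w"
    then obtain l :: nat and m zs and zz :: "nat \<Rightarrow> nat \<Rightarrow> c00" where l1: "1 \<le> l"
      and zs: "\<forall>i\<in>{1..l}. zs i = (1 / logf (real (m i))) *\<^sub>R (\<Sum>j=1..m i. zz i j)"
      and zz: "\<forall>i\<in>{1..l}. \<forall>j\<in>{1..m i}. zz i j \<in> ?G"
      and less: "\<forall>i\<in>{1..l}. \<forall>j\<in>{1..m i}. \<forall>i'\<in>{1..l}. \<forall>j'\<in>{1..m i'}.
           i < i' \<or> i = i' \<and> j < j' \<longrightarrow> supp_less (zz i j) (zz i' j')"
      and m1: "m 1 = j_seq J (2 * l)"
      and rat: "\<forall>i\<in>{1..l}. \<forall>k. coord (zs i) k \<in> \<rat>"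
      and m: "\<forall>i\<in>{1..<l}. m (i + 1) = \<sigma> (map zs [1..<i + 1])"
      and w: "w = (1 / sqrt (logf (real l))) *\<^sub>R (\<Sum>i=1..l. zs i)" unfolding GM_form3_def by blast
    let ?zz = "\<lambda>i. map (zz i) [1..<Suc (m i)]"
    have zs_eq: "zs i = (1 / logf (real (length (?zz i)))) *\<^sub>R sum_list (?zz i)" if "i \<in> {1..l}" for i
      using zs that by (simp add: interv_sum_list_conv_sum_set_nat atLeastLessThanSuc_atLeastAtMost del: upt_Suc)
    have sorted: "sorted_wrt supp_less (?zz i)" if "i \<in> {1..l}" for i
      using less that by (simp add: sorted_wrt_iff_nth_less del: upt_Suc)
    have zz_le: "ev (coord y) z \<le> NK y" if "i \<in> {1..l}" "z \<in> set (?zz i)" for i z y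
      using zz that by (intro Suc.IH) (auto simp del: upt_Suc)
    have zs_le: "ev (coord y) (zs i) \<le> NK y" if "i \<in> {1..l}" for i y
      unfolding zs_eq[OF that] by (rule ev_average_le_NK[OF sorted[OF that] zz_le[OF that]])
    \<comment> \<open>The conditions on \<open>\<sigma>\<close> concern only sequences from
      \<open>Q_set\<close>. Rationality is part of form (3), and the bound on the coordinates holds
      because coordinate vectors have \<open>NK\<close>-norm at most 1.\<close>
    have Q: "zs i \<in> Q_set" if i: "i \<in> {1..l}" for i
    proof -
      have "\<bar>coord (zs i) n\<bar> \<le> 1" for n
      proof -
        have "\<bar>ev (coord (Poly_Mapping.single n 1)) (zs i)\<bar> \<le> NK (Poly_Mapping.single n 1)"
          using zs_le[OF i] by (rule abs_ev_le_NK)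
        also have "\<dots> \<le> 1" using NK_le_norm[of "Poly_Mapping.single n 1"] by (simp add: norm_single_c00)
        finally show ?thesis by (simp add: ev_coord_commute[of "Poly_Mapping.single _ _"])
      qed
      then show ?thesis using rat i by (simp add: Q_set_def)
    qed
    have seqs: "map zs [1..<i + 1] \<in> Q_seqs" if "i \<in> {1..<l}" for i
      using Q that by (auto simp: Q_seqs_def simp del: upt_Suc)
    have \<sigma>: "\<sigma> ` Q_seqs \<subseteq> L_set J" "inj_on \<sigma> Q_seqs" using par by (auto simp: GM_parameters_def)
    have m': "m i = \<sigma> (map zs [1..<i])" "map zs [1..<i] \<in> Q_seqs" if "i \<in> {2..l}" for i
    proof -
      have i: "i - 1 \<in> {1..<l}" "i - 1 + 1 = i" using that by auto
      show "m i = \<sigma> (map zs [1..<i])" "map zs [1..<i] \<in> Q_seqs"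
        using bspec[OF m i(1)] seqs[OF i(1)] unfolding i(2) by blast+
    qed
    have mL: "m i \<in> L_set J" if "i \<in> {1..l}" for i
    proof (cases "i = 1")
      case True
      then show ?thesis using m1 l1 by (auto simp: L_set_def)
    next
      case False
      then have "i \<in> {2..l}" using that by auto
      then show ?thesis using \<sigma>(1) m' by auto
    qed
    have inj: "inj_on m {2..l}"
    proof (rule inj_onI)
      fix i j assume ij: "i \<in> {2..l}" "j \<in> {2..l}" "m i = m j"
      have "map zs [1..<i] = map zs [1..<j]"
        using inj_onD[OF \<sigma>(2) _ m'(2)[OF ij(1)] m'(2)[OF ij(2)]] m'(1)[OF ij(1)] m'(1)[OF ij(2)] ij(3) by simp
      then have "length (map zs [1..<i]) = length (map zs [1..<j])" by (rule arg_cong)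
      then have "i - 1 = j - 1" by simp
      moreover have "2 \<le> i" "2 \<le> j" using ij by auto
      ultimately show "i = j" by linarith
    qed
    let ?ms = "map m [1..<Suc l]"
    have ok: "lengths_ok ?ms"
    proof -
      have "set ?ms \<subseteq> L_set J" using mL by (auto simp del: upt_Suc)
      moreover have "count_list ?ms n \<le> 2" for n
      proof -
        have "[1..<Suc l] = 1 # [2..<Suc l]" using l1 by (simp add: upt_conv_Cons numeral_2_eq_2 del: upt_Suc)
        then have "count_list ?ms n \<le> 1 + count_list (map m [2..<Suc l]) n" by simp
        moreover have "distinct (map m [2..<Suc l])"
          using inj by (simp add: distinct_map atLeastLessThanSuc_atLeastAtMost del: upt_Suc)
        moreover have "distinct xs \<Longrightarrow> count_list xs n \<le> 1" for xs :: "nat list"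
          by (induction xs) (auto simp: count_list_0_iff)
        ultimately show ?thesis by fastforce
      qed
      ultimately show ?thesis by (simp add: lengths_ok_def)
    qed
    show ?thesis
    \<comment> \<open>For \<open>l = 1\<close> the weight is 1 and exceeds \<open>4 / 5\<close>, but
      then the functional is a single average.\<close>
    proof (cases "l = 1")
      case True
      then show ?thesis using zs_le[of 1 y] w by simp
    next
      case False
      then have F25: "25 / 16 \<le> logf (real l)" using l1 logf_mono[of 2 "real l"] logf_2_ge by auto
      have s54: "5 / 4 \<le> sqrt (logf (real l))"
        by (rule real_le_rsqrt) (use F25 in \<open>simp add: power2_eq_square\<close>)
      then have sp: "0 < sqrt (logf (real l))" by linarith
      have "1 / sqrt (logf (real l)) \<le> 1 / (5 / 4)"
        by (rule divide_left_mono) (use s54 sp in auto)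
      then have t: "0 \<le> 1 / sqrt (logf (real l))" "1 / sqrt (logf (real l)) \<le> 4 / 5"
        using sp by simp_all
      let ?zss = "map ?zz [1..<Suc l]"
      have "w = (1 / sqrt (logf (real l))) *\<^sub>R (\<Sum>ys\<leftarrow>?zss. (1 / logf (real (length ys))) *\<^sub>R sum_list ys)"
      proof -
        have "(\<Sum>i=1..l. zs i) = (\<Sum>i\<leftarrow>[1..<Suc l]. zs i)"
          by (simp add: interv_sum_list_conv_sum_set_nat atLeastLessThanSuc_atLeastAtMost del: upt_Suc)
        also have "\<dots> = (\<Sum>i\<leftarrow>[1..<Suc l]. (1 / logf (real (length (?zz i)))) *\<^sub>R sum_list (?zz i))"
          by (intro arg_cong[of _ _ sum_list] map_cong refl zs_eq) (auto simp del: upt_Suc)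
        finally show ?thesis unfolding w by (simp only: map_map comp_def)
      qed
      moreover have "ev (coord y) ((1 / sqrt (logf (real l))) *\<^sub>R (\<Sum>ys\<leftarrow>?zss. (1 / logf (real (length ys))) *\<^sub>R sum_list ys)) \<le> NK y"
      proof (rule ev_blocks_le_NK[OF _ _ _ t])
        have "map length ?zss = ?ms" by (simp add: comp_def del: upt_Suc)
        then show "lengths_ok (map length ?zss)" using ok by (simp only:)
        show "sorted_wrt supp_less (concat ?zss)"
        proof (rule sorted_wrt_concatI)
          show "sorted_wrt supp_less xs" if "xs \<in> set ?zss" for xs
            using that sorted by (auto simp del: upt_Suc)
          show "sorted_wrt (\<lambda>xs ys. \<forall>x\<in>set xs. \<forall>y\<in>set ys. supp_less x y) ?zss"
            unfolding sorted_wrt_map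
          proof (rule sorted_wrt_mono_rel)
            show "sorted_wrt (<) [1..<Suc l]" by (rule sorted_wrt_upt)
            fix i i' assume "i \<in> set [1..<Suc l]" "i' \<in> set [1..<Suc l]" "i < i'"
            then show "\<forall>x\<in>set (?zz i). \<forall>y\<in>set (?zz i'). supp_less x y"
              using less by (auto simp del: upt_Suc)
          qed
        qed
        show "ev (coord y) z \<le> NK y" if "z \<in> set (concat ?zss)" for z y
        proof -
          have "z \<in> (\<Union>i\<in>{1..l}. set (?zz i))"
            using that by (simp add: atLeastLessThanSuc_atLeastAtMost del: upt_Suc)
          then obtain i where "i \<in> {1..l}" "z \<in> set (?zz i)" by (rule UN_E)
          then show ?thesis by (rule zz_le)
        qed
      qed
      ultimately show ?thesis by simp
    qed
  qed
  then have "ev (coord (proj E x)) w \<le> NK (proj E x)" .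
  also have "\<dots> \<le> NK x" by (rule NK_proj_le)
  finally show ?case unfolding z ev_coord_proj .
qed

lemma nat_interval_UNIV: "nat_interval UNIV"
  by (simp add: nat_interval_def)

lemma proj_UNIV: "proj UNIV x = x"
  by (rule proj_eq_self) simp

section \<open>The norm of \<open>GM\<close>\<close>

context
  fixes J :: "nat set" and \<sigma> :: "c00 list \<Rightarrow> nat"
  assumes par: "GM_parameters J \<sigma>"
begin

interpretation lacunary "L_set J" by (rule lacunary_L_set[OF par])

lemma GM_norm_upper: "z \<in> GM_star J \<sigma> k \<Longrightarrow> ev (coord x) z \<le> GM_norm J \<sigma> x"
proof -
  assume "z \<in> GM_star J \<sigma> k"
  then have z: "z \<in> (\<Union>k. GM_star J \<sigma> k)" by blast
  have "pairing z x \<le> GM_norm J \<sigma> x"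
    unfolding GM_norm_def using z
  proof (rule cSUP_upper)
    show "bdd_above ((\<lambda>z. pairing z x) ` (\<Union>k. GM_star J \<sigma> k))"
    proof (rule bdd_aboveI2)
      fix w assume "w \<in> (\<Union>k. GM_star J \<sigma> k)"
      then obtain k where "w \<in> GM_star J \<sigma> k" by blast
      then show "pairing w x \<le> NK x" unfolding pairing_eq_ev by (rule ev_GM_star_le_NK[OF par])
    qed
  qed
  then show ?thesis by (simp add: pairing_eq_ev)
qed

lemma zero_in_GM_star_0: "0 \<in> GM_star J \<sigma> 0"
  by (auto intro!: exI[of _ 0])

lemma GM_norm_least: "(\<And>k z. z \<in> GM_star J \<sigma> k \<Longrightarrow> ev (coord x) z \<le> c) \<Longrightarrow> GM_norm J \<sigma> x \<le> c"
  unfolding GM_norm_def using zero_in_GM_star_0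
  by (intro cSUP_least) (auto simp: pairing_eq_ev simp del: GM_star.simps)

lemma GM_norm_le_NK: "GM_norm J \<sigma> x \<le> NK x"
  by (rule GM_norm_least) (rule ev_GM_star_le_NK[OF par])

text \<open>Form (2) of length 1 has weight \<open>1 / logf 1 = 1\<close>, so any functional may be
  restricted to an interval at the next level; the interval of all indices yields monotonicity in
  the level.\<close>

lemma proj_in_GM_star:
  assumes "z \<in> GM_star J \<sigma> k" "nat_interval E" shows "proj E z \<in> GM_star J \<sigma> (Suc k)"
proof -
  have "GM_form2 (GM_star J \<sigma> k) z"
    unfolding GM_form2_def by (rule exI[of _ 1], rule exI[of _ "\<lambda>_. z"]) (use assms(1) in simp)
  then show ?thesis using assms(2) by auto
qed

lemma GM_star_mono: "k \<le> k' \<Longrightarrow> GM_star J \<sigma> k \<subseteq> GM_star J \<sigma> k'"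
proof (rule lift_Suc_mono_le[of "GM_star J \<sigma>"])
  show "GM_star J \<sigma> n \<subseteq> GM_star J \<sigma> (Suc n)" for n
    using proj_in_GM_star[of _ n UNIV] nat_interval_UNIV by (auto simp: proj_UNIV simp del: GM_star.simps)
qed

text \<open>Form (2) is applied to nearly optimal functionals restricted to the given intervals.
  They are found at various levels, so \<open>k\<close> is chosen as a common one.\<close>

lemma averaging_GM_norm: "averaging_seminorm (GM_norm J \<sigma>)"
proof
  show "0 \<le> GM_norm J \<sigma> x" for x using GM_norm_upper[OF zero_in_GM_star_0, of x] by simp
next
  fix x n
  have "ev (coord (proj {n} x)) (Poly_Mapping.single n a) \<le> GM_norm J \<sigma> (proj {n} x)" if "\<bar>a\<bar> \<le> 1" for a
    by (rule GM_norm_upper[of _ 0]) (use that in auto)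
  from this[of 1] this[of "-1"] show "\<bar>coord x n\<bar> \<le> GM_norm J \<sigma> (proj {n} x)"
    by (simp add: proj.rep_eq)
next
  fix Es q I x
  assume len: "length Es \<le> q" "1 \<le> q" and Es: "sorted_wrt set_less Es" "\<forall>E\<in>set Es. nat_interval E \<and> E \<subseteq> I"
  let ?p = "GM_norm J \<sigma>"
  show "(\<Sum>E\<leftarrow>Es. ?p (proj E x)) \<le> logf (real q) * ?p (proj I x)"
  proof (rule field_le_epsilon)
    fix e :: real assume e: "0 < e"
    define d where "d = e / (real (length Es) + 1)"
    have d: "0 < d" using e by (simp add: d_def add_nonneg_pos)
    have "\<exists>z k. z \<in> GM_star J \<sigma> k \<and> ?p y - d < ev (coord y) z" for y
    proof (rule ccontr)
      assume "\<not> ?thesis"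
      then have "?p y \<le> ?p y - d" by (intro GM_norm_least) (meson not_less)
      then show False using d by simp
    qed
    then obtain Z kk where Z: "\<And>y. Z y \<in> GM_star J \<sigma> (kk y)" "\<And>y. ?p y - d < ev (coord y) (Z y)" by metis
    define k where "k = Max (insert 0 (set (map (\<lambda>E. kk (proj E x)) Es)))"
    \<comment> \<open>Form (2) asks for exactly \<open>q\<close> functionals, counted from 1; the
      missing ones are filled up with zeros.\<close>
    define zs where "zs i = (if i - 1 < length Es then proj (Es ! (i - 1)) (Z (proj (Es ! (i - 1)) x)) else 0)" for i
    let ?w = "(1 / logf (real q)) *\<^sub>R (\<Sum>i=1..q. zs i)"
    have zsk: "zs i \<in> GM_star J \<sigma> (Suc k)" for i
    proof (cases "i - 1 < length Es")
      case True
      let ?E = "Es ! (i - 1)"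
      have E: "?E \<in> set Es" using True by simp
      have "kk (proj ?E x) \<le> k" unfolding k_def using E by (intro Max_ge) auto
      then have "Z (proj ?E x) \<in> GM_star J \<sigma> k" using Z(1) GM_star_mono by blast
      then have "proj ?E (Z (proj ?E x)) \<in> GM_star J \<sigma> (Suc k)" using Es(2) E by (intro proj_in_GM_star) auto
      then show ?thesis using True by (simp add: zs_def del: GM_star.simps)
    next
      case False
      have "0 \<in> GM_star J \<sigma> (Suc k)" using zero_in_GM_star_0 GM_star_mono[of 0 "Suc k"] by blast
      then show ?thesis using False by (simp add: zs_def del: GM_star.simps)
    qed
    have less: "supp_less (zs i) (zs j)" if "i \<in> {1..q}" "j \<in> {1..q}" "i < j" for i j
    proof (cases "j - 1 < length Es")
      case True
      then have "set_less (Es ! (i - 1)) (Es ! (j - 1))"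
        using that Es(1) by (simp add: sorted_wrt_iff_nth_less)
      then show ?thesis using True that
        by (simp add: zs_def supp_less_def keys_proj set_less_def)
    next
      case False
      then show ?thesis by (simp add: zs_def supp_less_def set_less_def)
    qed
    have "GM_form2 (GM_star J \<sigma> (Suc k)) ?w"
      unfolding GM_form2_def using len zsk less by (intro exI[of _ q] exI[of _ zs]) (simp del: GM_star.simps)
    then have "proj UNIV ?w \<in> GM_star J \<sigma> (Suc (Suc k))" using nat_interval_UNIV by auto
    then have up: "ev (coord (proj I x)) ?w \<le> ?p (proj I x)" unfolding proj_UNIV by (rule GM_norm_upper)
    have F: "1 \<le> logf (real q)" using len by (intro logf_ge_1) simp
    have "(\<Sum>E\<leftarrow>Es. ?p (proj E x)) \<le> (\<Sum>E\<leftarrow>Es. ev (coord (proj E x)) (Z (proj E x)) + d)"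
      using Z(2) by (intro sum_list_mono) (simp add: less_imp_le algebra_simps)
    also have "\<dots> = (\<Sum>E\<leftarrow>Es. ev (coord (proj E x)) (Z (proj E x))) + real (length Es) * d"
      by (simp add: sum_list_addf sum_list_triv)
    also have "(\<Sum>E\<leftarrow>Es. ev (coord (proj E x)) (Z (proj E x))) = (\<Sum>i<length Es. ev (coord (proj I x)) (zs (Suc i)))"
      unfolding sum_list_sum_nth length_map atLeast0LessThan
    proof (rule sum.cong)
      fix i assume "i \<in> {..<length Es}"
      then have i: "i < length Es" by simp
      then have "proj (Es ! i) (proj I x) = proj (Es ! i) x"
        using Es(2) nth_mem[OF i] by (intro poly_mapping_eqI) (auto simp: proj.rep_eq)
      then show "map (\<lambda>E. ev (coord (proj E x)) (Z (proj E x))) Es ! i = ev (coord (proj I x)) (zs (Suc i))"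
        using i by (simp add: zs_def flip: ev_coord_proj)
    qed simp
    also have "\<dots> = (\<Sum>i<q. ev (coord (proj I x)) (zs (Suc i)))"
      using len by (intro sum.mono_neutral_left) (auto simp: zs_def)
    also have "\<dots> = logf (real q) * ev (coord (proj I x)) ?w"
      using F by (simp add: ev_scaleR ev_sum sum.shift_bounds_cl_Suc_ivl atLeast0LessThan
        sum.atLeast1_atMost_eq)
    also have "\<dots> \<le> logf (real q) * ?p (proj I x)" using up F by (intro mult_left_mono) auto
    also have "real (length Es) * d \<le> e" using e by (simp add: d_def divide_le_eq mult.commute)
    finally show "(\<Sum>E\<leftarrow>Es. ?p (proj E x)) \<le> logf (real q) * ?p (proj I x) + e" by simp
  qed
qed

end

section \<open>The norm of \<open>S\<close>\<close>

context lacunary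
begin

text \<open>The argument resembles the uniqueness proof for this norm. If one of the sets contains
  the whole support, its average is at most \<open>S_norm x / logf 2\<close>, too small to be the
  maximum; otherwise all pieces have smaller supports and \<open>NK_adm\<close> applies.\<close>

lemma S_norm_le_NK: "S_norm x \<le> NK x"
proof (induction "card (supp x)" arbitrary: x rule: less_induct)
  case less
  have eq: "norm_on_c00 S_norm" "S_norm x = max (sup_norm x) (Sup (S_averages S_norm x))"
    using S_norm_equation_S_norm by (auto simp: S_norm_equation_def)
  have N0: "0 \<le> S_norm y" "S_norm 0 = 0" for y using eq(1) by (auto simp: norm_on_c00_def)
  have v: "v \<le> max (NK x) (S_norm x / logf 2)" if v: "v \<in> S_averages S_norm x" for v
  proof -
    obtain n E where nE: "2 \<le> n" "\<forall>i\<in>{1..n}. \<forall>j\<in>{1..n}. i < j \<longrightarrow> set_less (E i) (E j)"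
      and v: "v = (\<Sum>j=1..n. S_norm (proj (E j) x)) / logf (real n)"
      using v unfolding S_averages_def by auto
    have disj: "E i \<inter> E j = {}" if "i \<in> {1..n}" "j \<in> {1..n}" "i \<noteq> j" for i j
      by (rule set_less_chain_disjoint[OF nE(2) that])
    have l1: "1 \<le> logf (real n)" using nE by (intro logf_ge_1) simp
    show ?thesis
    proof (cases "\<exists>j\<in>{1..n}. supp x \<subseteq> E j")
      case True
      then obtain j where j: "j \<in> {1..n}" "supp x \<subseteq> E j" by blast
      have "(\<Sum>i=1..n. S_norm (proj (E i) x)) = (\<Sum>i\<in>{j}. S_norm (proj (E i) x))"
      proof (rule sum.mono_neutral_right)
        show "\<forall>i\<in>{1..n} - {j}. S_norm (proj (E i) x) = 0"
        proof
          fix i assume "i \<in> {1..n} - {j}"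
          then have "E i \<inter> E j = {}" using disj j by auto
          then show "S_norm (proj (E i) x) = 0" using j N0 by (subst proj_eq_0) auto
        qed
      qed (use j in auto)
      then have "v = S_norm x / logf (real n)" using j by (simp add: v proj_eq_self)
      also have "\<dots> \<le> S_norm x / logf 2"
        using nE logf_2_gt_1 l1 N0 by (intro divide_left_mono logf_mono) auto
      finally show ?thesis by simp
    next
      case False
      let ?xs = "map (\<lambda>j. proj (E j) x) [1..<Suc n]"
      let ?g = "replicate n (1 / logf (real n))"
      have "S_norm (proj (E j) x) \<le> NK (proj (E j) x)" if "j \<in> {1..n}" for j
      proof (rule less)
        have "E j \<inter> supp x \<subset> supp x" using False that by blast
        then show "card (supp (proj (E j) x)) < card (supp x)"
          unfolding keys_proj by (intro psubset_card_mono) auto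
      qed
      then have "v \<le> (\<Sum>j=1..n. NK (proj (E j) x)) / logf (real n)"
        unfolding v using l1 by (intro divide_right_mono sum_mono) auto
      also have "\<dots> = (\<Sum>c<length ?xs. ?g ! c * NK (?xs ! c))"
        by (simp add: sum_divide_distrib sum.atLeast1_atMost_eq del: upt_Suc)
      also have "\<dots> \<le> NK (sum_list ?xs)"
      proof (rule NK_adm)
        show "adm ?g" using nE by (intro adm_replicate) simp
        show "sorted_wrt supp_less ?xs"
          unfolding sorted_wrt_map
        proof (rule sorted_wrt_mono_rel)
          show "sorted_wrt (<) [1..<Suc n]" by (rule sorted_wrt_upt)
          fix i j assume "i \<in> set [1..<Suc n]" "j \<in> set [1..<Suc n]" "i < j"
          then have "set_less (E i) (E j)" using nE(2) by (simp del: upt_Suc)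
          then show "supp_less (proj (E i) x) (proj (E j) x)" by (simp add: supp_less_def set_less_def keys_proj)
        qed
      qed simp
      also have "sum_list ?xs = proj (\<Union>j\<in>{1..n}. E j) x"
      proof (rule poly_mapping_eqI)
        fix i
        have "coord (sum_list ?xs) i = (\<Sum>j\<leftarrow>[1..<Suc n]. if i \<in> E j then coord x i else 0)"
          by (simp only: lookup_sum_list map_map comp_def proj.rep_eq)
        also have "\<dots> = (\<Sum>j=1..n. if i \<in> E j then coord x i else 0)"
          by (simp only: interv_sum_list_conv_sum_set_nat atLeastLessThanSuc_atLeastAtMost set_upt)
        also have "\<dots> = (if i \<in> (\<Union>j\<in>{1..n}. E j) then coord x i else 0)"
        proof (cases "i \<in> (\<Union>j\<in>{1..n}. E j)")
          case True
          then obtain j where j: "j \<in> {1..n}" "i \<in> E j" by blast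
          have "(\<Sum>j=1..n. if i \<in> E j then coord x i else 0) = (\<Sum>j'=1..n. if j' = j then coord x i else 0)"
            by (rule sum.cong) (use disj j in auto)
          then show ?thesis using j by auto
        qed (auto intro!: sum.neutral)
        finally show "coord (sum_list ?xs) i = coord (proj (\<Union>j\<in>{1..n}. E j) x) i" by (simp add: proj.rep_eq)
      qed
      also have "NK \<dots> \<le> NK x" by (rule NK_proj_le)
      finally show ?thesis by simp
    qed
  qed
  have "Sup (S_averages S_norm x) \<le> max (NK x) (S_norm x / logf 2)"
    by (rule cSup_least[OF S_averages_nonempty v])
  moreover have "sup_norm x \<le> NK x" by (rule sup_norm_least) (rule coord_le_NK)
  ultimately have "S_norm x \<le> max (NK x) (S_norm x / logf 2)" by (subst eq(2)) auto
  moreover have "S_norm x / logf 2 < S_norm x" if "0 < S_norm x"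
    using that logf_2_gt_1 by (simp add: divide_less_eq)
  ultimately show ?case using N0(1)[of x] NK_nonneg[of x] by (cases "0 < S_norm x") auto
qed

text \<open>The averages defining this norm start with two sets, so the case \<open>q = 1\<close> is
  derived from monotonicity under restrictions, which is proved first.\<close>

lemma averaging_S_norm: "averaging_seminorm S_norm"
proof -
  have eq: "norm_on_c00 S_norm" "S_norm x = max (sup_norm x) (Sup (S_averages S_norm x))" for x
    using S_norm_equation_S_norm by (auto simp: S_norm_equation_def)
  have N0: "0 \<le> S_norm y" for y using eq(1) by (auto simp: norm_on_c00_def)
  have sup: "sup_norm x \<le> S_norm x" for x by (subst eq(2)) simp
  have avg: "v \<le> S_norm x" if "v \<in> S_averages S_norm x" for v x
  proof -
    have "v \<le> S_op S_norm x"
      using that by (rule S_op_upper[rotated]) (rule order_trans[OF S_norm_le_NK NK_le_norm])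
    then show ?thesis by (subst eq(2)) (simp add: S_op_def)
  qed
  have mono: "S_norm (proj E x) \<le> S_norm x" for E x
  proof (subst eq(2), rule max.boundedI)
    have "sup_norm (proj E x) \<le> sup_norm x"
      using lookup_le_sup_norm[of x] sup_norm_nonneg[of x] by (intro sup_norm_least) (auto simp: proj.rep_eq)
    then show "sup_norm (proj E x) \<le> S_norm x" using sup[of x] by linarith
    show "Sup (S_averages S_norm (proj E x)) \<le> S_norm x"
    proof (rule cSup_least[OF S_averages_nonempty])
      fix v assume "v \<in> S_averages S_norm (proj E x)"
      then obtain n E' where nE: "2 \<le> n" "\<forall>j\<in>{1..n}. finite (E' j)"
          "\<forall>i\<in>{1..n}. \<forall>j\<in>{1..n}. i < j \<longrightarrow> set_less (E' i) (E' j)"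
        and v: "v = (\<Sum>j=1..n. S_norm (proj (E' j) (proj E x))) / logf (real n)"
        unfolding S_averages_def by auto
      have pp: "proj (E' j) (proj E x) = proj (E' j \<inter> E) x" for j
        by (rule poly_mapping_eqI) (auto simp: proj.rep_eq)
      have "v \<in> S_averages S_norm x"
        unfolding S_averages_def mem_Collect_eq v pp
      proof (intro exI[of _ n] exI[of _ "\<lambda>j. E' j \<inter> E"] conjI refl ballI impI nE(1))
        show "finite (E' j \<inter> E)" if "j \<in> {1..n}" for j using nE(2) that by blast
        fix i j assume "i \<in> {1..n}" "j \<in> {1..n}" "i < j"
        then have "set_less (E' i) (E' j)" using nE(3) by blast
        then show "set_less (E' i \<inter> E) (E' j \<inter> E)" by (rule set_less_subset) auto
      qed
      then show "v \<le> S_norm x" by (rule avg)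
    qed
  qed
  show ?thesis
  proof
    show "0 \<le> S_norm x" for x by (rule N0)
    show "\<bar>coord x n\<bar> \<le> S_norm (proj {n} x)" for x n
      using lookup_le_sup_norm[of "proj {n} x" n] sup[of "proj {n} x"] by (simp add: proj.rep_eq)
    fix Es q I x
    assume len: "length Es \<le> q" "1 \<le> q" and Es: "sorted_wrt set_less Es" "\<forall>E\<in>set Es. nat_interval E \<and> E \<subseteq> I"
    have sub: "proj E (proj I x) = proj E x" if "E \<in> set Es" for E
      using Es(2) that by (intro poly_mapping_eqI) (auto simp: proj.rep_eq)
    show "(\<Sum>E\<leftarrow>Es. S_norm (proj E x)) \<le> logf (real q) * S_norm (proj I x)"
    proof (cases "q = 1")
      case True
      then consider "Es = []" | E where "Es = [E]" using len by (cases Es) auto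
      then show ?thesis
      proof cases
        case 1 then show ?thesis using True N0 by simp
      next
        case (2 E)
        then show ?thesis using True mono[of E "proj I x"] sub[of E] by simp
      qed
    next
      case False
      \<comment> \<open>Intersecting with the support makes the sets finite, as the definition
        demands; empty sets fill the list up to length \<open>q\<close>.\<close>
      define E' where "E' j = (if j - 1 < length Es then Es ! (j - 1) \<inter> supp x else {})" for j
      have "(\<Sum>j=1..q. S_norm (proj (E' j) (proj I x))) / logf (real q) \<in> S_averages S_norm (proj I x)"
        unfolding S_averages_def mem_Collect_eq
      proof (intro exI[of _ q] exI[of _ E'] conjI refl ballI impI)
        show "2 \<le> q" using len False by simp
        show "finite (E' j)" for j by (simp add: E'_def)
        fix i j assume ij: "i \<in> {1..q}" "j \<in> {1..q}" "i < j"
        show "set_less (E' i) (E' j)"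
        proof (cases "j - 1 < length Es")
          case True
          then have "set_less (Es ! (i - 1)) (Es ! (j - 1))" using ij Es(1) by (simp add: sorted_wrt_iff_nth_less)
          then show ?thesis using True ij by (simp add: E'_def set_less_def)
        qed (simp add: E'_def set_less_def)
      qed
      then have *: "(\<Sum>j=1..q. S_norm (proj (E' j) (proj I x))) / logf (real q) \<le> S_norm (proj I x)" by (rule avg)
      have F: "0 < logf (real q)" using len by (intro logf_pos) simp
      have "(\<Sum>E\<leftarrow>Es. S_norm (proj E x)) = (\<Sum>i<length Es. S_norm (proj (E' (Suc i)) (proj I x)))"
        unfolding sum_list_sum_nth length_map atLeast0LessThan
      proof (rule sum.cong)
        fix i assume "i \<in> {..<length Es}"
        then have i: "i < length Es" by simp
        have "proj (E' (Suc i)) (proj I x) = proj (Es ! i) (proj I x)"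
          using i by (intro poly_mapping_eqI) (auto simp: proj.rep_eq E'_def in_keys_iff)
        then show "map (\<lambda>E. S_norm (proj E x)) Es ! i = S_norm (proj (E' (Suc i)) (proj I x))"
          using i sub by simp
      qed simp
      also have "\<dots> \<le> (\<Sum>i<q. S_norm (proj (E' (Suc i)) (proj I x)))"
        using len N0 by (intro sum_mono2) auto
      also have "\<dots> = (\<Sum>j=1..q. S_norm (proj (E' j) (proj I x)))" by (simp add: sum.atLeast1_atMost_eq)
      finally show ?thesis using * F by (simp add: divide_le_eq mult.commute)
    qed
  qed
qed

end

section \<open>Operators on completions\<close>

lemma closure_range_linear_eqI:
  fixes \<iota> :: "c00 \<Rightarrow> 'a::banach" and U V :: "'a \<Rightarrow> 'b::real_normed_vector"
  assumes "continuous_on (closure (range \<iota>)) U" "continuous_on (closure (range \<iota>)) V"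
    and "\<And>x. U (\<iota> x) = V (\<iota> x)" and y: "y \<in> closure (range \<iota>)"
  shows "U y = V y"
proof -
  obtain s where s: "\<And>n. s n \<in> range \<iota>" "s \<longlonglongrightarrow> y" using y unfolding closure_sequential by blast
  have sc: "s n \<in> closure (range \<iota>)" for n by (rule subsetD[OF closure_subset s(1)])
  have "(\<lambda>n. U (s n)) \<longlonglongrightarrow> U y" "(\<lambda>n. V (s n)) \<longlonglongrightarrow> V y"
    using continuous_on_tendsto_compose[OF assms(1) s(2) y] continuous_on_tendsto_compose[OF assms(2) s(2) y] sc
    by auto
  moreover have "(\<lambda>n. U (s n)) = (\<lambda>n. V (s n))" using s(1) assms(3) by (metis imageE)
  ultimately show ?thesis using LIMSEQ_unique by metis
qed

lemma subspace_completion: assumes "is_completion M \<iota> X" shows "subspace X"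
proof -
  have sub: "subspace (range \<iota>)" and X: "X = closure (range \<iota>)"
    using assms by (simp_all add: is_completion_def linear_subspace_image)
  show ?thesis
    unfolding subspace_def
  proof (intro conjI ballI allI)
    show "0 \<in> X" unfolding X by (rule subsetD[OF closure_subset subspace_0[OF sub]])
    fix x y assume x: "x \<in> X" and y: "y \<in> X"
    obtain s where s: "\<And>n. s n \<in> range \<iota>" "s \<longlonglongrightarrow> x" using x unfolding X closure_sequential by blast
    obtain t where t: "\<And>n. t n \<in> range \<iota>" "t \<longlonglongrightarrow> y" using y unfolding X closure_sequential by blast
    have "\<forall>n. s n + t n \<in> range \<iota>" using subspace_add[OF sub s(1) t(1)] by (rule allI)
    with tendsto_add[OF s(2) t(2)] show "x + y \<in> X" unfolding X closure_sequential
      by (intro exI[of _ "\<lambda>n. s n + t n"] conjI)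
  next
    fix x a assume x: "x \<in> X"
    obtain s where s: "\<And>n. s n \<in> range \<iota>" "s \<longlonglongrightarrow> x" using x unfolding X closure_sequential by blast
    have "\<forall>n. a *\<^sub>R s n \<in> range \<iota>" using subspace_scale[OF sub s(1)] by (rule allI)
    with tendsto_scaleR[OF tendsto_const s(2)] show "a *\<^sub>R x \<in> X" unfolding X closure_sequential
      by (intro exI[of _ "\<lambda>n. a *\<^sub>R s n"] conjI)
  qed
qed

text \<open>The map is Lipschitz on the dense range and extends by uniform continuity; linearity,
  the range and the norm bound pass to the limit.\<close>

lemma extension_exists:
  fixes \<iota> :: "c00 \<Rightarrow> 'a::banach" and \<kappa> :: "c00 \<Rightarrow> 'b::banach"
  assumes X: "is_completion M \<iota> X" and Z: "is_completion M' \<kappa> Z"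
    and T: "\<And>x y. T (x + y) = T x + T y" "\<And>c x. T (c *\<^sub>R x) = c *\<^sub>R T x"
    and C: "\<And>x. M' (T x) \<le> C * M x" "0 \<le> C"
  obtains U where "U \<in> bounded_operators X Z" "\<And>x. U (\<iota> x) = \<kappa> (T x)" "continuous_on X U"
    "\<And>y. y \<in> X \<Longrightarrow> norm (U y) \<le> C * norm y"
proof -
  have \<iota>: "linear \<iota>" "\<And>x. norm (\<iota> x) = M x" and XX: "X = closure (range \<iota>)"
    using X by (auto simp: is_completion_def)
  have \<kappa>: "linear \<kappa>" "\<And>x. norm (\<kappa> x) = M' x" and ZZ: "Z = closure (range \<kappa>)"
    using Z by (auto simp: is_completion_def)
  have Tdiff: "T (x - y) = T x - T y" for x y
    using T(1)[of x "(- 1) *\<^sub>R y"] T(2)[of "- 1" y] by simp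
  have dist: "norm (\<kappa> (T x) - \<kappa> (T y)) \<le> C * norm (\<iota> x - \<iota> y)" for x y
  proof -
    have "norm (\<kappa> (T x) - \<kappa> (T y)) = M' (T (x - y))"
      by (simp add: Tdiff linear_diff[OF \<kappa>(1)] flip: \<kappa>(2))
    also have "\<dots> \<le> C * M (x - y)" by (rule C)
    also have "M (x - y) = norm (\<iota> x - \<iota> y)" by (simp add: linear_diff[OF \<iota>(1)] flip: \<iota>(2))
    finally show ?thesis .
  qed
  \<comment> \<open>An arbitrary preimage is taken. \<open>dist\<close> shows that its choice does
    not matter, so injectivity of the embedding need not be discussed.\<close>
  define f where "f y = \<kappa> (T (inv \<iota> y))" for y
  have f: "f (\<iota> x) = \<kappa> (T x)" for x
  proof -
    have "\<iota> (inv \<iota> (\<iota> x)) = \<iota> x" by (simp add: f_inv_into_f)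
    then show ?thesis using dist[of "inv \<iota> (\<iota> x)" x] by (simp add: f_def)
  qed
  have "C-lipschitz_on (range \<iota>) f"
    using C(2) dist by (auto simp: lipschitz_on_def dist_norm f)
  then have "uniformly_continuous_on (range \<iota>) f" by (rule lipschitz_on_uniformly_continuous)
  then obtain g where g: "uniformly_continuous_on (closure (range \<iota>)) g" "\<And>x. x \<in> range \<iota> \<Longrightarrow> f x = g x"
    by (rule uniformly_continuous_on_extension_on_closure) (rule that)
  have gc: "continuous_on X g" using g(1) XX by (simp add: uniformly_continuous_imp_continuous)
  have g\<iota>: "g (\<iota> x) = \<kappa> (T x)" for x using g(2)[of "\<iota> x"] f by simp
  have lim: "\<exists>s. (\<lambda>n. \<iota> (s n)) \<longlonglongrightarrow> y \<and> (\<lambda>n. \<kappa> (T (s n))) \<longlonglongrightarrow> g y" if y: "y \<in> X" for y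
  proof -
    obtain t where t: "\<And>n. t n \<in> range \<iota>" "t \<longlonglongrightarrow> y" using y unfolding XX closure_sequential by blast
    have "t n \<in> X" for n unfolding XX by (rule subsetD[OF closure_subset t(1)])
    then have "(\<lambda>n. g (t n)) \<longlonglongrightarrow> g y" using continuous_on_tendsto_compose[OF gc t(2) y] by simp
    moreover have inv: "\<iota> (inv \<iota> (t n)) = t n" for n using t(1) by (rule f_inv_into_f)
    moreover have "g (t n) = \<kappa> (T (inv \<iota> (t n)))" for n using g\<iota>[of "inv \<iota> (t n)"] unfolding inv .
    ultimately show ?thesis using t(2) by (intro exI[of _ "\<lambda>n. inv \<iota> (t n)"]) simp
  qed
  have subX: "subspace X" by (rule subspace_completion[OF X])
  have uniq: "g y = w" if "y \<in> X" "(\<lambda>n. \<iota> (s n)) \<longlonglongrightarrow> y" "(\<lambda>n. \<kappa> (T (s n))) \<longlonglongrightarrow> w" for s y w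
  proof -
    have "\<iota> (s n) \<in> X" for n unfolding XX by (rule subsetD[OF closure_subset]) simp
    then have "(\<lambda>n. g (\<iota> (s n))) \<longlonglongrightarrow> g y" using continuous_on_tendsto_compose[OF gc that(2,1)] by simp
    then show ?thesis using LIMSEQ_unique that(3) unfolding g\<iota> by blast
  qed
  have gZ: "g y \<in> Z" if "y \<in> X" for y
  proof -
    obtain s where s: "(\<lambda>n. \<kappa> (T (s n))) \<longlonglongrightarrow> g y" using lim[OF \<open>y \<in> X\<close>] by blast
    show ?thesis unfolding ZZ closure_sequential
      by (rule exI[of _ "\<lambda>n. \<kappa> (T (s n))"]) (use s in blast)
  qed
  have gadd: "g (y + y') = g y + g y'" if y: "y \<in> X" "y' \<in> X" for y y'
  proof -
    obtain s where s: "(\<lambda>n. \<iota> (s n)) \<longlonglongrightarrow> y" "(\<lambda>n. \<kappa> (T (s n))) \<longlonglongrightarrow> g y" using lim[OF y(1)] by blast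
    obtain t where t: "(\<lambda>n. \<iota> (t n)) \<longlonglongrightarrow> y'" "(\<lambda>n. \<kappa> (T (t n))) \<longlonglongrightarrow> g y'" using lim[OF y(2)] by blast
    show ?thesis
    proof (rule uniq[of _ "\<lambda>n. s n + t n"])
      show "y + y' \<in> X" using subX y by (rule subspace_add)
    qed (use tendsto_add[OF s(1) t(1)] tendsto_add[OF s(2) t(2)] in
        \<open>simp_all add: linear_add[OF \<iota>(1)] linear_add[OF \<kappa>(1)] T\<close>)
  qed
  have gscale: "g (c *\<^sub>R y) = c *\<^sub>R g y" if y: "y \<in> X" for c y
  proof -
    obtain s where s: "(\<lambda>n. \<iota> (s n)) \<longlonglongrightarrow> y" "(\<lambda>n. \<kappa> (T (s n))) \<longlonglongrightarrow> g y" using lim[OF y] by blast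
    show ?thesis
    proof (rule uniq[of _ "\<lambda>n. c *\<^sub>R s n"])
      show "c *\<^sub>R y \<in> X" using subX y by (rule subspace_scale)
    qed (use tendsto_scaleR[OF tendsto_const s(1)] tendsto_scaleR[OF tendsto_const s(2)] in
        \<open>simp_all add: linear_cmul[OF \<iota>(1)] linear_cmul[OF \<kappa>(1)] T\<close>)
  qed
  have gnorm: "norm (g y) \<le> C * norm y" if y: "y \<in> X" for y
  proof -
    obtain s where s: "(\<lambda>n. \<iota> (s n)) \<longlonglongrightarrow> y" "(\<lambda>n. \<kappa> (T (s n))) \<longlonglongrightarrow> g y" using lim[OF y] by blast
    have "\<forall>n. norm (\<kappa> (T (s n))) \<le> C * norm (\<iota> (s n))" using C(1) by (simp add: \<iota>(2) \<kappa>(2))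
    then show ?thesis
      by (intro tendsto_le[OF _ tendsto_mult_left[OF tendsto_norm[OF s(1)]] tendsto_norm[OF s(2)]]) auto
  qed
  define U where "U y = (if y \<in> X then g y else 0)" for y
  show thesis
  proof (rule that[of U])
    show "U \<in> bounded_operators X Z"
      unfolding bounded_operators_def mem_Collect_eq U_def
      using gZ gadd gscale gnorm subspace_add[OF subX] subspace_scale[OF subX] by (auto intro!: exI[of _ C])
    have "\<iota> x \<in> X" for x unfolding XX by (rule subsetD[OF closure_subset]) simp
    then show "U (\<iota> x) = \<kappa> (T x)" for x by (simp add: U_def g\<iota>)
    show "continuous_on X U" by (rule continuous_on_eq[OF gc]) (simp add: U_def)
    show "\<And>y. y \<in> X \<Longrightarrow> norm (U y) \<le> C * norm y" by (simp add: U_def gnorm)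
  qed
qed

lemma op_norm_least:
  assumes "\<And>x. x \<in> X \<Longrightarrow> norm x \<le> 1 \<Longrightarrow> norm (T x) \<le> c" "0 \<in> X" shows "op_norm X T \<le> c"
  unfolding op_norm_def using assms by (intro cSUP_least) (auto intro: exI[of _ 0])

lemma op_norm_upper:
  assumes "\<And>x. x \<in> X \<Longrightarrow> norm (T x) \<le> c * norm x" "0 \<le> c" "x \<in> X" "norm x \<le> 1"
  shows "norm (T x) \<le> op_norm X T"
  unfolding op_norm_def
proof (rule cSUP_upper)
  show "bdd_above ((\<lambda>x. norm (T x)) ` {x \<in> X. norm x \<le> 1})"
  proof (rule bdd_aboveI2)
    fix y assume "y \<in> {x \<in> X. norm x \<le> 1}"
    then have "norm (T y) \<le> c * norm y" "norm y \<le> 1" using assms(1) by auto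
    then show "norm (T y) \<le> c" using mult_left_mono[of "norm y" 1 c] assms(2) by linarith
  qed
qed (use assms in simp)

text \<open>Besides extending each operator, the construction must be linear in the sequence
  \<open>a\<close>. This follows from density, as both sides are continuous and agree on the dense
  range.\<close>

lemma extension_family:
  fixes \<iota> :: "c00 \<Rightarrow> 'a::banach" and \<kappa> :: "c00 \<Rightarrow> 'b::banach" and T :: "l_infinity \<Rightarrow> c00 \<Rightarrow> c00"
  assumes X: "is_completion M \<iota> X" and Z: "is_completion M' \<kappa> Z"
    and T: "\<And>a x y. T a (x + y) = T a x + T a y" "\<And>a c x. T a (c *\<^sub>R x) = c *\<^sub>R T a x"
    and Ta: "\<And>a b x. T (a + b) x = T a x + T b x" "\<And>a c x. T (c *\<^sub>R a) x = c *\<^sub>R T a x"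
    and C: "\<And>a x. M' (T a x) \<le> norm a * M x"
  obtains \<Phi> where "linear_into_operators \<Phi> X Z" "\<And>a. op_norm X (\<Phi> a) \<le> norm a"
    "\<And>a x. M x \<le> 1 \<Longrightarrow> M' (T a x) \<le> op_norm X (\<Phi> a)"
proof -
  have \<iota>: "linear \<iota>" "\<And>x. norm (\<iota> x) = M x" and XX: "X = closure (range \<iota>)"
    using X by (auto simp: is_completion_def)
  have \<kappa>: "linear \<kappa>" "\<And>x. norm (\<kappa> x) = M' x" using Z by (auto simp: is_completion_def)
  let ?ext = "\<lambda>a U. U \<in> bounded_operators X Z \<and> (\<forall>x. U (\<iota> x) = \<kappa> (T a x)) \<and> continuous_on X U \<and>
      (\<forall>y\<in>X. norm (U y) \<le> norm a * norm y)"
  have "\<exists>U. ?ext a U" for a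
  proof -
    obtain U where "U \<in> bounded_operators X Z" "\<And>x. U (\<iota> x) = \<kappa> (T a x)" "continuous_on X U"
      "\<And>y. y \<in> X \<Longrightarrow> norm (U y) \<le> norm a * norm y"
      by (rule extension_exists[OF X Z T(1)[of a] T(2)[of a] C[of a] norm_ge_zero[of a]]) (rule that)
    then show ?thesis by (intro exI[of _ U]) simp
  qed
  then have "\<forall>a. \<exists>U. ?ext a U" ..
  from choice[OF this] obtain \<Phi> where "\<forall>a. ?ext a (\<Phi> a)" ..
  then have \<Phi>: "\<Phi> a \<in> bounded_operators X Z" "\<Phi> a (\<iota> x) = \<kappa> (T a x)"
    "continuous_on X (\<Phi> a)" "y \<in> X \<Longrightarrow> norm (\<Phi> a y) \<le> norm a * norm y" for a x y by simp_all
  have out: "\<Phi> a x = 0" if "x \<notin> X" for a x using \<Phi>(1)[of a] that by (simp add: bounded_operators_def)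
  have iX: "\<iota> x \<in> X" for x unfolding XX by (rule subsetD[OF closure_subset]) simp
  have subX: "subspace X" by (rule subspace_completion[OF X])
  show thesis
  proof (rule that[of \<Phi>])
    show "linear_into_operators \<Phi> X Z"
      unfolding linear_into_operators_def
    proof (intro conjI allI ext)
      show "range \<Phi> \<subseteq> bounded_operators X Z" using \<Phi>(1) by blast
      fix a b y
      show "\<Phi> (a + b) y = \<Phi> a y + \<Phi> b y"
      proof (cases "y \<in> X")
        case True
        show ?thesis
          by (rule closure_range_linear_eqI[of \<iota> "\<Phi> (a + b)" "\<lambda>y. \<Phi> a y + \<Phi> b y"])
            (use \<Phi>(3) True XX in \<open>auto intro!: continuous_on_add simp: \<Phi>(2) Ta linear_add[OF \<kappa>(1)]\<close>)
      qed (simp add: out)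
    next
      fix c a y
      show "\<Phi> (c *\<^sub>R a) y = c *\<^sub>R \<Phi> a y"
      proof (cases "y \<in> X")
        case True
        show ?thesis
          by (rule closure_range_linear_eqI[of \<iota> "\<Phi> (c *\<^sub>R a)" "\<lambda>y. c *\<^sub>R \<Phi> a y"])
            (use \<Phi>(3) True XX in \<open>auto intro!: continuous_on_scaleR continuous_on_const simp: \<Phi>(2) Ta linear_cmul[OF \<kappa>(1)]\<close>)
      qed (simp add: out)
    qed
    show "op_norm X (\<Phi> a) \<le> norm a" for a
    proof (rule op_norm_least)
      fix y assume y: "y \<in> X" "norm y \<le> 1"
      have "norm (\<Phi> a y) \<le> norm a * norm y" by (rule \<Phi>(4)[OF y(1)])
      also have "\<dots> \<le> norm a * 1" using y(2) by (intro mult_left_mono) auto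
      finally show "norm (\<Phi> a y) \<le> norm a" by simp
    qed (use subX subspace_0 in blast)
    show "M' (T a x) \<le> op_norm X (\<Phi> a)" if "M x \<le> 1" for a x
    proof -
      have "norm (\<Phi> a (\<iota> x)) \<le> op_norm X (\<Phi> a)"
        by (rule op_norm_upper[OF \<Phi>(4) norm_ge_zero iX]) (simp_all add: \<iota>(2) that)
      then show ?thesis by (simp add: \<Phi>(2) \<kappa>(2))
    qed
  qed
qed

text \<open>Indicator sequences of distinct sets of naturals have distance at least 1. Choosing for
  each an element of a countable dense set at distance less than \<open>1 / 2\<close> would embed
  the power set of the naturals into that set.\<close>

lemma not_separable_if_isometric:
  fixes X :: "'a::real_normed_vector set" and Z :: "'b::real_normed_vector set"
  assumes "l_infinity_isometric_in_operators X Z" "0 \<in> X" shows "\<not> separable_operators X Z"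
proof
  assume "separable_operators X Z"
  then obtain D where D: "countable D" "D \<subseteq> bounded_operators X Z"
    "\<And>T \<epsilon>. T \<in> bounded_operators X Z \<Longrightarrow> \<epsilon> > 0 \<Longrightarrow> \<exists>U\<in>D. op_norm X (\<lambda>x. T x - U x) < \<epsilon>"
    unfolding separable_operators_def by blast
  obtain \<Phi> :: "l_infinity \<Rightarrow> 'a \<Rightarrow> 'b" where \<Phi>: "linear_into_operators \<Phi> X Z" "\<And>a. op_norm X (\<Phi> a) = norm a"
    using assms(1) unfolding l_infinity_isometric_in_operators_def by blast
  have op: "\<Phi> a \<in> bounded_operators X Z" for a using \<Phi>(1) by (auto simp: linear_into_operators_def)
  define ind where "ind A = Bcontfun (\<lambda>n. indicator A n :: real)" for A :: "nat set"
  have ind: "apply_bcontfun (ind A) n = indicator A n" for A n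
  proof -
    have "(\<lambda>n. indicator A n :: real) \<in> bcontfun"
      by (rule bcontfun_normI[of _ 1]) (auto simp: indicator_def)
    then show ?thesis unfolding ind_def by (simp add: Bcontfun_inverse)
  qed
  have "\<exists>U. U \<in> D \<and> op_norm X (\<lambda>x. \<Phi> (ind A) x - U x) < 1 / 2" for A
    using D(3)[OF op, of "1 / 2" "ind A"] by auto
  then obtain U where U: "\<And>A. U A \<in> D" "\<And>A. op_norm X (\<lambda>x. \<Phi> (ind A) x - U A x) < 1 / 2" by metis
  have "inj U"
  proof (rule injI)
    fix A B assume eq: "U A = U B"
    show "A = B"
    proof (rule ccontr)
      assume "A \<noteq> B"
      then obtain n where "n \<in> A \<longleftrightarrow> n \<notin> B" by blast
      then have "1 \<le> norm (apply_bcontfun (ind A - ind B) n)" by (auto simp: ind minus_bcontfun.rep_eq indicator_def)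
      also have "\<dots> \<le> norm (ind A - ind B)" by (rule norm_bounded)
      also have "\<dots> = op_norm X (\<Phi> (ind A - ind B))" by (simp add: \<Phi>(2))
      also have "\<dots> < 1"
      proof -
        have lin: "\<Phi> (ind A - ind B) x = \<Phi> (ind A) x - \<Phi> (ind B) x" for x
        proof -
          have "\<Phi> (ind A + (- 1) *\<^sub>R ind B) x = \<Phi> (ind A) x + (- 1) *\<^sub>R \<Phi> (ind B) x"
            using \<Phi>(1) by (simp only: linear_into_operators_def)
          then show ?thesis by simp
        qed
        \<comment> \<open>As a supremum of reals, \<open>op_norm\<close> dominates the single values
          only if these are bounded. This is where the elements of \<open>D\<close> must be bounded
          operators.\<close>
        have b: "norm (\<Phi> (ind C) x - U C x) \<le> op_norm X (\<lambda>x. \<Phi> (ind C) x - U C x)" if x: "x \<in> X" "norm x \<le> 1" for C x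
        proof -
          have bdd: "\<exists>k. \<forall>x\<in>X. norm (V x) \<le> k * norm x" if "V \<in> bounded_operators X Z" for V :: "'a \<Rightarrow> 'b"
            using that by (simp add: bounded_operators_def)
          obtain k k' where k: "\<forall>x\<in>X. norm (\<Phi> (ind C) x) \<le> k * norm x" "\<forall>x\<in>X. norm (U C x) \<le> k' * norm x"
            using bdd[OF op[of "ind C"]] bdd[OF subsetD[OF D(2) U(1)[of C]]] by blast
          have "norm (\<Phi> (ind C) y - U C y) \<le> (\<bar>k\<bar> + \<bar>k'\<bar>) * norm y" if "y \<in> X" for y
          proof -
            have "norm (\<Phi> (ind C) y - U C y) \<le> k * norm y + k' * norm y"
              using k that by (intro order_trans[OF norm_triangle_ineq4]) (auto intro: add_mono)
            also have "\<dots> \<le> \<bar>k\<bar> * norm y + \<bar>k'\<bar> * norm y" by (intro add_mono mult_right_mono) auto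
            finally show ?thesis by (simp add: distrib_right)
          qed
          then show ?thesis using x by (intro op_norm_upper[of X _ "\<bar>k\<bar> + \<bar>k'\<bar>"]) auto
        qed
        have "op_norm X (\<Phi> (ind A - ind B))
            \<le> op_norm X (\<lambda>x. \<Phi> (ind A) x - U A x) + op_norm X (\<lambda>x. \<Phi> (ind B) x - U B x)"
        proof (rule op_norm_least[OF _ assms(2)])
          fix x assume x: "x \<in> X" "norm x \<le> 1"
          have "norm (\<Phi> (ind A - ind B) x) = norm ((\<Phi> (ind A) x - U A x) - (\<Phi> (ind B) x - U B x))"
            by (simp add: lin eq)
          also have "\<dots> \<le> norm (\<Phi> (ind A) x - U A x) + norm (\<Phi> (ind B) x - U B x)" by (rule norm_triangle_ineq4)
          finally show "norm (\<Phi> (ind A - ind B) x)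
              \<le> op_norm X (\<lambda>x. \<Phi> (ind A) x - U A x) + op_norm X (\<lambda>x. \<Phi> (ind B) x - U B x)"
            using b[OF x, of A] b[OF x, of B] by linarith
        qed
        then show ?thesis using U(2)[of A] U(2)[of B] by simp
      qed
      finally show False by simp
    qed
  qed
  moreover have "countable (range U)" using U(1) D(1) by (intro countable_subset[of "range U" D]) auto
  ultimately have "countable (UNIV :: nat set set)" by (rule countable_image_inj_on[rotated])
  then obtain e :: "nat \<Rightarrow> nat set" where "range e = UNIV" by (metis UNIV_not_empty uncountable_def)
  then show False using Cantors_theorem[of "UNIV :: nat set"] by (metis Pow_UNIV)
qed

section \<open>Multiplier operators\<close>

lemma (in averaging_seminorm) coord_le_p: "\<bar>coord x n\<bar> \<le> p x"
proof -
  have "\<bar>coord x n\<bar> \<le> p (proj {n} x)" by (rule p_coord)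
  also have "\<dots> \<le> p (proj UNIV x)" by (rule p_mono) (auto simp: nat_interval_def)
  finally show ?thesis by (simp add: proj_UNIV)
qed

context multiplier
begin

lemma p_proj_le: "nat_interval E \<Longrightarrow> p (proj E x) \<le> p x"
  using p_mono[of E UNIV x] by (simp add: proj_UNIV nat_interval_UNIV)

lemma supp_place_block: "supp (place (\<lambda>i. s + i) (ycoef n r)) \<subseteq> block s n r"
  using supp_place[of "\<lambda>i. s + i" "ycoef n r"] by force

lemma Y_proj: "Y s n r (proj (block s n r) x) = Y s n r x"
  unfolding Y_def
proof (rule ev_cong)
  fix k assume "k \<in> supp (place (\<lambda>i. s + i) (ycoef n r))"
  then have "k \<in> block s n r" by (rule subsetD[OF supp_place_block])
  then show "coord (proj (block s n r) x) k = coord x k" by (simp add: proj.rep_eq)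
qed

lemma Y_eq_0: assumes "supp x \<subseteq> {..<s}" shows "Y s n r x = 0"
proof -
  have "Y s n r x = ev (\<lambda>_. 0) (place (\<lambda>i. s + i) (ycoef n r))"
    unfolding Y_def
  proof (rule ev_cong)
    fix k assume "k \<in> supp (place (\<lambda>i. s + i) (ycoef n r))"
    then have "k \<in> block s n r" by (rule subsetD[OF supp_place_block])
    then have "s \<le> k" by simp
    then show "coord x k = 0" using assms by (auto simp: in_keys_iff)
  qed
  then show ?thesis by (simp add: ev_def)
qed

lemma Y_add: "Y s n r (x + y) = Y s n r x + Y s n r y"
  by (simp add: Y_def ev_coord_add)

lemma Y_scaleR: "Y s n r (a *\<^sub>R x) = a * Y s n r x"
  by (simp add: Y_def ev_coord_scaleR)

text \<open>The supports of the functionals are put side by side. As every block is nonempty,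
  \<open>n <= pos n\<close>; hence only finitely many of the functionals see a given finitely
  supported vector, and the multiplier maps into \<open>c00\<close>.\<close>

definition pos :: "nat \<Rightarrow> nat" where "pos n = (\<Sum>i<n. len i 0)"

lemma spaced_pos: "spaced 0 pos"
  by (simp add: spaced_def pos_def)

lemma le_pos: "n \<le> pos n"
proof (induction n)
  case (Suc n)
  then show ?case using len_pos[of n 0] by (simp add: pos_def)
qed simp

abbreviation "y n \<equiv> Y (pos n) n 0"

definition mult_op :: "(nat \<Rightarrow> real) \<Rightarrow> c00 \<Rightarrow> c00" where
  "mult_op b x = Abs_poly_mapping (\<lambda>n. b n * y n x)"

lemma coord_mult_op: "coord (mult_op b x) = (\<lambda>n. b n * y n x)"
proof -
  obtain m where m: "supp x \<subseteq> {..<m}" using finite_nat_bounded[of "supp x"] by auto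
  have "{n. b n * y n x \<noteq> 0} \<subseteq> {..<m}"
  proof
    fix n assume n: "n \<in> {n. b n * y n x \<noteq> 0}"
    show "n \<in> {..<m}"
    proof (rule ccontr)
      assume "n \<notin> {..<m}"
      then have "supp x \<subseteq> {..<pos n}" using m le_pos[of n] by force
      then show False using n Y_eq_0 by simp
    qed
  qed
  then have "finite {n. b n * y n x \<noteq> 0}" by (rule finite_subset) simp
  then show ?thesis unfolding mult_op_def by (subst Abs_poly_mapping_inverse) auto
qed

lemma mult_op_add: "mult_op b (x + z) = mult_op b x + mult_op b z"
  by (rule poly_mapping_eqI) (simp add: coord_mult_op lookup_add Y_add distrib_left)

lemma mult_op_scaleR: "mult_op b (c *\<^sub>R x) = c *\<^sub>R mult_op b x"
  by (rule poly_mapping_eqI) (simp add: coord_mult_op Y_scaleR)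

lemma mult_op_fun_add: "mult_op (\<lambda>n. b n + b' n) x = mult_op b x + mult_op b' x"
  by (rule poly_mapping_eqI) (simp add: coord_mult_op lookup_add distrib_right)

lemma mult_op_fun_scale: "mult_op (\<lambda>n. c * b n) x = c *\<^sub>R mult_op b x"
  by (rule poly_mapping_eqI) (simp add: coord_mult_op)

lemma NK_mult_op_le:
  assumes "\<And>n. \<bar>b n\<bar> \<le> 2" "\<And>n x. \<bar>b n * y n x\<bar> \<le> p (proj (block (pos n) n 0) x)"
  shows "NK (mult_op b x) \<le> p x"
proof (rule NK_least)
  fix z assume z: "z \<in> K"
  have "ev (coord (mult_op b x)) z = \<Psi> b pos 0 x z"
    by (simp add: coord_mult_op multiplier_functional_def)
  also have "\<dots> \<le> \<bar>\<Psi> b pos 0 x z\<bar>" by simp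
  also have "\<dots> \<le> p (proj (extent 0 pos (supp z)) x)" by (rule \<Psi>_le[OF z assms(1) spaced_pos assms(2)])
  also have "\<dots> \<le> p x" by (rule p_proj_le[OF nat_interval_extent])
  finally show "ev (coord (mult_op b x)) z \<le> p x" .
qed

text \<open>The factors \<open>\<kappa> n\<close> rescale the functionals: they are 1 for the
  embedding and reciprocals of dual norms for the isometry.\<close>

lemma NK_mult_op_le_norm:
  assumes \<kappa>: "\<And>n. \<bar>\<kappa> n\<bar> \<le> 2" "\<And>n x. \<bar>\<kappa> n * y n x\<bar> \<le> p (proj (block (pos n) n 0) x)"
  shows "NK (mult_op (\<lambda>n. apply_bcontfun a n * \<kappa> n) x) \<le> norm a * p x"
proof (cases "a = 0")
  case True
  have "mult_op (\<lambda>n. apply_bcontfun a n * \<kappa> n) x = 0"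
    by (rule poly_mapping_eqI) (simp add: coord_mult_op True zero_bcontfun.rep_eq)
  then show ?thesis using True by simp
next
  case False
  define b where "b n = apply_bcontfun a n / norm a" for n
  have b: "\<bar>b n\<bar> \<le> 1" for n using norm_bounded[of a n] False by (simp add: b_def abs_divide)
  have "mult_op (\<lambda>n. apply_bcontfun a n * \<kappa> n) x = norm a *\<^sub>R mult_op (\<lambda>n. b n * \<kappa> n) x"
    using False by (simp add: b_def flip: mult_op_fun_scale)
  also have "NK \<dots> \<le> norm a * NK (mult_op (\<lambda>n. b n * \<kappa> n) x)" by (rule NK_scaleR_nonneg) simp
  also have "\<dots> \<le> norm a * p x"
  proof (intro mult_left_mono NK_mult_op_le norm_ge_zero)
    show "\<bar>b n * \<kappa> n\<bar> \<le> 2" for n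
      using mult_mono[OF b[of n] \<kappa>(1)[of n]] by (simp add: abs_mult)
    show "\<bar>b n * \<kappa> n * y n x\<bar> \<le> p (proj (block (pos n) n 0) x)" for n x
      using mult_mono[OF b[of n] \<kappa>(2)[of n x]] by (simp add: abs_mult mult.assoc)
  qed
  finally show ?thesis .
qed

lemma operators_exist:
  fixes \<iota> :: "c00 \<Rightarrow> 'a::banach" and \<iota>' :: "c00 \<Rightarrow> 'b::banach"
  assumes X: "is_completion p \<iota> X" and Z: "is_completion q \<iota>' Z"
    and q: "\<And>x. q x \<le> NK x" "\<And>x n. \<bar>coord x n\<bar> \<le> q x"
    and \<kappa>: "\<And>n. \<bar>\<kappa> n\<bar> \<le> 2" "\<And>n x. \<bar>\<kappa> n * y n x\<bar> \<le> p (proj (block (pos n) n 0) x)"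
  obtains \<Phi> :: "l_infinity \<Rightarrow> 'a \<Rightarrow> 'b" where "linear_into_operators \<Phi> X Z" "\<And>a. op_norm X (\<Phi> a) \<le> norm a"
    "\<And>a n x. p x \<le> 1 \<Longrightarrow> \<bar>apply_bcontfun a n * \<kappa> n * y n x\<bar> \<le> op_norm X (\<Phi> a)"
proof -
  let ?T = "\<lambda>a. mult_op (\<lambda>n. apply_bcontfun a n * \<kappa> n)"
  have Ta: "?T (a + b) x = ?T a x + ?T b x" for a b x
    by (simp add: plus_bcontfun.rep_eq distrib_right mult_op_fun_add)
  have Tc: "?T (c *\<^sub>R a) x = c *\<^sub>R ?T a x" for c a x
    by (simp add: scaleR_bcontfun.rep_eq mult.assoc mult_op_fun_scale)
  have C: "q (?T a x) \<le> norm a * p x" for a x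
    by (rule order_trans[OF q(1) NK_mult_op_le_norm[OF \<kappa>]])
  obtain \<Phi> where \<Phi>: "linear_into_operators \<Phi> X Z" "\<And>a. op_norm X (\<Phi> a) \<le> norm a"
    "\<And>a x. p x \<le> 1 \<Longrightarrow> q (?T a x) \<le> op_norm X (\<Phi> a)"
    by (rule extension_family[OF X Z mult_op_add mult_op_scaleR Ta Tc C]) (rule that)
  have "\<bar>apply_bcontfun a n * \<kappa> n * y n x\<bar> \<le> op_norm X (\<Phi> a)" if "p x \<le> 1" for a n x
    using q(2)[of "?T a x" n] \<Phi>(3)[OF that, of a] by (simp add: coord_mult_op)
  with \<Phi>(1,2) show thesis by (rule that)
qed

text \<open>The factor \<open>1 / 2\<close> normalizes vectors whose \<open>NK\<close>-norm is at
  most 2. One vector serves all domains, because \<open>NK\<close> dominates their norms.\<close>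

definition test_vector :: "nat \<Rightarrow> c00" where
  "test_vector n = (1 / 2) *\<^sub>R place (\<lambda>i. pos n + i) (vcoef n 0)"

lemma y_test_vector: "y n (test_vector n) = 1 / 2"
  using ev_ycoef_vcoef[of "\<lambda>i. pos n + i" n 0] by (simp add: test_vector_def Y_def ev_coord_scaleR strict_mono_def)

lemma NK_test_vector: "NK (test_vector n) \<le> 1"
  using NK_scaleR_nonneg[of "1 / 2" "place (\<lambda>i. pos n + i) (vcoef n 0)"]
    NK_place_vcoef_le_2[of "\<lambda>i. pos n + i" n] by (simp add: test_vector_def strict_mono_def)

theorem multipliers_embed:
  fixes \<iota> :: "c00 \<Rightarrow> 'a::banach" and \<iota>' :: "c00 \<Rightarrow> 'b::banach"
  assumes X: "is_completion p \<iota> X" and Z: "is_completion q \<iota>' Z"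
    and q: "\<And>x. q x \<le> NK x" "\<And>x n. \<bar>coord x n\<bar> \<le> q x" and p: "\<And>x. p x \<le> NK x"
  shows "l_infinity_embeds_in_operators X Z"
proof -
  have \<kappa>: "\<bar>1\<bar> \<le> (2::real)" "\<And>n x. \<bar>1 * y n x\<bar> \<le> p (proj (block (pos n) n 0) x)"
    using abs_Y_le by simp_all
  obtain \<Phi> :: "l_infinity \<Rightarrow> 'a \<Rightarrow> 'b" where \<Phi>: "linear_into_operators \<Phi> X Z" "\<And>a. op_norm X (\<Phi> a) \<le> norm a"
    "\<And>a n x. p x \<le> 1 \<Longrightarrow> \<bar>apply_bcontfun a n * 1 * y n x\<bar> \<le> op_norm X (\<Phi> a)"
    by (rule operators_exist[OF X Z q \<kappa>]) (rule that)
  have "1 / 2 * norm a \<le> op_norm X (\<Phi> a)" for a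
  proof -
    have "norm a \<le> 2 * op_norm X (\<Phi> a)"
    proof (rule norm_bound)
      fix n
      have "\<bar>apply_bcontfun a n * 1 * y n (test_vector n)\<bar> \<le> op_norm X (\<Phi> a)"
        by (rule \<Phi>(3)[OF order_trans[OF p NK_test_vector]])
      then show "norm (apply_bcontfun a n) \<le> 2 * op_norm X (\<Phi> a)" by (simp add: y_test_vector abs_mult)
    qed
    then show ?thesis by simp
  qed
  then show ?thesis
    unfolding l_infinity_embeds_in_operators_def using \<Phi>(1,2)
    by (intro exI[of _ \<Phi>] conjI exI[of _ "1 / 2"] exI[of _ 1] allI) simp_all
qed

theorem multipliers_isometric:
  fixes \<iota> :: "c00 \<Rightarrow> 'a::banach" and \<iota>' :: "c00 \<Rightarrow> 'b::banach"
  assumes X: "is_completion p \<iota> X" and Z: "is_completion q \<iota>' Z"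
    and q: "\<And>x. q x \<le> NK x" "\<And>x n. \<bar>coord x n\<bar> \<le> q x" and p: "\<And>x. p x \<le> NK x"
  shows "l_infinity_isometric_in_operators X Z"
proof -
  have p_scaleR: "p (c *\<^sub>R x) = \<bar>c\<bar> * p x" for c x
    using X unfolding is_completion_def by (metis linear_cmul norm_scaleR)
  \<comment> \<open>Dividing by the dual norm \<open>M n\<close> of \<open>y n\<close> turns the lower estimate into an exact one.\<close>
  define M where "M n = (SUP x\<in>{x. p x \<le> 1}. \<bar>y n x\<bar>)" for n
  have y_le: "\<bar>y n x\<bar> \<le> p x" for n x
    by (rule order_trans[OF abs_Y_le p_proj_le[OF nat_interval_ivl]])
  have upper: "\<bar>y n x\<bar> \<le> M n" if "p x \<le> 1" for n x
    unfolding M_def by (rule cSUP_upper) (use that y_le in \<open>auto intro!: bdd_aboveI2[of _ _ 1] intro: order_trans\<close>)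
  have least: "M n \<le> c" if "\<And>x. p x \<le> 1 \<Longrightarrow> \<bar>y n x\<bar> \<le> c" for n c
    unfolding M_def by (rule cSUP_least) (use that order_trans[OF p NK_test_vector] in auto)
  have M_ge: "1 / 2 \<le> M n" for n
    using upper[OF order_trans[OF p NK_test_vector[of n]], of n] unfolding y_test_vector by simp
  have y_le_M: "\<bar>y n x\<bar> \<le> M n * p x" for n x
  proof (cases "p x = 0")
    case True
    then show ?thesis using y_le[of n x] by simp
  next
    case False
    then have pos: "0 < p x" using p_nonneg[of x] by simp
    have "\<bar>y n ((1 / p x) *\<^sub>R x)\<bar> \<le> M n" by (rule upper) (use pos in \<open>simp add: p_scaleR\<close>)
    then show ?thesis using pos by (simp add: Y_scaleR abs_mult field_simps)
  qed
  \<comment> \<open>The test vectors keep the dual norms above \<open>1 / 2\<close>; this is the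
    source of the bound 2 carried through all multiplier estimates.\<close>
  have \<kappa>1: "\<bar>1 / M n\<bar> \<le> 2" for n using M_ge[of n] by (simp add: field_simps)
  \<comment> \<open>As \<open>y n\<close> only sees its own block, the estimate by the dual norm may
    be applied to the restriction of the vector to that block.\<close>
  have \<kappa>2: "\<bar>1 / M n * y n x\<bar> \<le> p (proj (block (pos n) n 0) x)" for n x
    using y_le_M[of n "proj (block (pos n) n 0) x"] M_ge[of n] by (simp add: Y_proj abs_mult field_simps)
  obtain \<Phi> :: "l_infinity \<Rightarrow> 'a \<Rightarrow> 'b" where \<Phi>: "linear_into_operators \<Phi> X Z" "\<And>a. op_norm X (\<Phi> a) \<le> norm a"
    "\<And>a n x. p x \<le> 1 \<Longrightarrow> \<bar>apply_bcontfun a n * (1 / M n) * y n x\<bar> \<le> op_norm X (\<Phi> a)"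
    by (rule operators_exist[OF X Z q \<kappa>1 \<kappa>2]) (rule that)
  have "norm a \<le> op_norm X (\<Phi> a)" for a
  proof (rule norm_bound)
    fix n
    let ?a = "\<bar>apply_bcontfun a n\<bar>"
    have Mn: "0 < M n" using M_ge[of n] by linarith
    have le: "?a * \<bar>y n x\<bar> \<le> op_norm X (\<Phi> a) * M n" if "p x \<le> 1" for x
      using \<Phi>(3)[OF that, of a n] Mn by (simp add: abs_mult field_simps)
    show "norm (apply_bcontfun a n) \<le> op_norm X (\<Phi> a)"
    proof (cases "apply_bcontfun a n = 0")
      case True
      have "0 \<le> op_norm X (\<Phi> a) * M n" using le[OF order_trans[OF p NK_test_vector]] True by simp
      then show ?thesis using True Mn by (simp add: zero_le_mult_iff)
    next
      case False
      \<comment> \<open>Exactness comes from the least upper bound: no single vector has to attain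
        the dual norm.\<close>
      have "M n \<le> op_norm X (\<Phi> a) * M n / ?a"
        by (rule least) (use le False in \<open>simp add: le_divide_eq mult.commute\<close>)
      then show ?thesis using False Mn by (simp add: le_divide_eq mult.commute)
    qed
  qed
  then have "op_norm X (\<Phi> a) = norm a" for a using \<Phi>(2) by (simp add: antisym)
  then show ?thesis unfolding l_infinity_isometric_in_operators_def using \<Phi>(1) by blast
qed

end

theorem mainTheorem3:
  fixes J :: "nat set" and \<sigma> :: "c00 list \<Rightarrow> nat"
    and \<iota>\<^sub>G :: "c00 \<Rightarrow> 'g::banach" and GM :: "'g set"
    and \<iota>\<^sub>S :: "c00 \<Rightarrow> 's::banach" and S :: "'s set"
  assumes "GM_parameters J \<sigma>"
    and "is_completion (GM_norm J \<sigma>) \<iota>\<^sub>G GM"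
    and "is_completion S_norm \<iota>\<^sub>S S"
  shows "l_infinity_isometric_in_operators GM GM \<and>
         \<not> separable_operators GM GM \<and>
         l_infinity_embeds_in_operators S GM \<and>
         l_infinity_embeds_in_operators GM GM"
proof -
  note par = assms(1) and G = assms(2) and S = assms(3)
  have lac: "lacunary (L_set J)" by (rule lacunary_L_set[OF par])
  obtain N l where tree: "tree (L_set J) N l" by (rule lacunary.tree_exists[OF lac])
  \<comment> \<open>One tree serves both domains, since its construction refers only to
    \<open>NK\<close>.\<close>
  interpret G: multiplier "L_set J" N l "GM_norm J \<sigma>"
    by (rule multiplier.intro[OF tree averaging_GM_norm[OF par]])
  interpret S: multiplier "L_set J" N l S_norm
    by (rule multiplier.intro[OF tree lacunary.averaging_S_norm[OF lac]])
  have iso: "l_infinity_isometric_in_operators GM GM"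
    by (rule G.multipliers_isometric[OF G G GM_norm_le_NK[OF par] G.coord_le_p GM_norm_le_NK[OF par]])
  moreover have "\<not> separable_operators GM GM"
    by (rule not_separable_if_isometric[OF iso subspace_0[OF subspace_completion[OF G]]])
  moreover have "l_infinity_embeds_in_operators S GM"
    by (rule S.multipliers_embed[OF S G GM_norm_le_NK[OF par] G.coord_le_p lacunary.S_norm_le_NK[OF lac]])
  moreover have "l_infinity_embeds_in_operators GM GM"
    by (rule G.multipliers_embed[OF G G GM_norm_le_NK[OF par] G.coord_le_p GM_norm_le_NK[OF par]])
  ultimately show ?thesis by blast
qed

end
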